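(* Let $\mathcal{A}$ be a quasi-abelian category, and let $$\begin{array}{ccccc} A & \xrightarrow{f} & B & \xrightarrow{g} & C\\ {\scriptstyle a}\downarrow & S & {\scriptstyle b}\downarrow & T & \downarrow{\scriptstyle c}\\ A' & \xrightarrow{f'} & B' & \xrightarrow{g'} & C'\end{array}$$ be a commutative diagram in $\mathcal{A}$ with semiexact rows (i.e. $gf=0$ and $g'f'=0$). The following assertions hold. (1) If the sequence $A'\to B'\to C'$ is exact and $b$ is a strict monomorphism, then there exists a canonical morphism $\theta:H(A\to B\to C)\to\operatorname{Im}S$ such that the sequence $$0\to H(A\to B\to C)\xrightarrow{\theta}\operatorname{Im}S\xrightarrow{\Lambda}\operatorname{Ker}T\to 0$$ is exact. (2) If the sequence $A\to B\to C$ is exact and $b$ is a strict epimorphism, then there exists a canonical morphism $\varkappa:\operatorname{Ker}T\to H(A'\to B'\to C')$ such that the sequence $$0\to\operatorname{Im}S\xrightarrow{\Lambda}\operatorname{Ker}T\xrightarrow{\varkappa}H(A'\to B'\to C')\to 0$$ is exact.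
   Context: Composition is written right to left. For a morphism $\alpha$ in an additive category with kernels and cokernels, $\ker\alpha$, $\operatorname{coker}\alpha$ denote the kernel and cokernel morphisms and $\operatorname{Ker}\alpha$, $\operatorname{Coker}\alpha$ the corresponding objects; $\operatorname{im}\alpha=\ker\operatorname{coker}\alpha$ with source object $\operatorname{Im}\alpha$, $\operatorname{coim}\alpha=\operatorname{coker}\ker\alpha$ with target object $\operatorname{Coim}\alpha$; $\alpha=(\operatorname{im}\alpha)\bar\alpha(\operatorname{coim}\alpha)$ is the canonical decomposition. The morphism $\alpha$ is strict if $\bar\alpha$ is an isomorphism. A strict epimorphism is a morphism that is a cokernel; a strict monomorphism is a morphism that is a kernel. A quasi-abelian category is an additive category in which every morphism has a kernel and a cokernel, strict epimorphisms are stable under pullback, and strict monomorphisms are stable under pushout. A sequence $\cdot\xrightarrow{\alpha}\cdot\xrightarrow{\beta}\cdot$ is semiexact if $\beta\alpha=0$ and exact if $\operatorname{im}\alpha=\ker\beta$ (as subobjects); a longer sequence is exact if it is exact at each inner term. For a semiexact sequence $A\xrightarrow{f}B\xrightarrow{g}C$, the homology object $H(A\to B\to C)$ is $\operatorname{Coker}\varepsilon$, where $\varepsilon:\operatorname{Im}f\to\operatorname{Ker}g$ is the unique morphism with $\operatorname{im}f=(\ker g)\varepsilon$. Lambek invariants. For a commutative square $S$ with $\alpha:C\to D$, $g:C\to A$, $\beta:A\to B$, $f:D\to B$, $f\alpha=\beta g$ (letters here are local to this definition): (i) Let $I_S$ with $k_S:I_S\to\operatorname{Im}f$ and $l_S:I_S\to\operatorname{Im}\beta$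 be the pullback of $\operatorname{im}f:\operatorname{Im}f\to B$ and $\operatorname{im}\beta:\operatorname{Im}\beta\to B$. There are morphisms $k':\operatorname{Im}(f\alpha)\to\operatorname{Im}f$ and $l':\operatorname{Im}(f\alpha)\to\operatorname{Im}\beta$ with $\operatorname{im}(f\alpha)=(\operatorname{im}f)k'=(\operatorname{im}\beta)l'$; let $\rho_S:\operatorname{Im}(f\alpha)\to I_S$ be the unique morphism with $k'=k_S\rho_S$, $l'=l_S\rho_S$. Put $\operatorname{Im}S=\operatorname{Coker}\rho_S$. (ii) Let $\mu_S:\operatorname{Ker}g\to\operatorname{Ker}(f\alpha)$ and $\nu_S:\operatorname{Ker}\alpha\to\operatorname{Ker}(f\alpha)$ be the natural inclusions, and $\langle\mu_S,\nu_S\rangle:\operatorname{Ker}g\oplus\operatorname{Ker}\alpha\to\operatorname{Ker}(f\alpha)$ the induced morphism. Put $\operatorname{Ker}S=\operatorname{Coker}\langle\mu_S,\nu_S\rangle$. (iii) Equivalently, let $J_S$ with $i_S:\operatorname{Coim}g\to J_S$ and $j_S:\operatorname{Coim}\alpha\to J_S$ be the pushout of $\operatorname{coim}g:C\to\operatorname{Coim}g$ and $\operatorname{coim}\alpha:C\to\operatorname{Coim}\alpha$, and let $\sigma_S:J_S\to B$ be the unique morphism with $\sigma_Sj_S=f(\operatorname{im}\alpha)\bar\alpha$ and $\sigma_Si_S=\beta(\operatorname{im}g)\bar g$. Then $\operatorname{Ker}S$ is naturally isomorphic to $\operatorname{Ker}\sigma_S$, via the isomorphism $\eta:\operatorname{Ker}S\to\operatorname{Ker}\sigma_S$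 with $(\ker\sigma_S)\,\eta\,\operatorname{coker}\langle\mu_S,\nu_S\rangle=j_S(\operatorname{coim}\alpha)\ker(f\alpha)$; one identifies $\operatorname{Ker}S$ with $\operatorname{Ker}\sigma_S$ by means of it. In the diagram of the claim, $S$ is the square with top $f$, left $a$, bottom $f'$, right $b$, so $k_S:I_S\to\operatorname{Im}b$, $l_S:I_S\to\operatorname{Im}f'$, $\rho_S:\operatorname{Im}(bf)\to I_S$; and $T$ is the square with top $g$, left $b$, bottom $g'$, right $c$, so $\operatorname{Ker}T=\operatorname{Coker}(\operatorname{Ker}b\oplus\operatorname{Ker}g\to\operatorname{Ker}(g'b))$, $i_T:\operatorname{Coim}b\to J_T$, $j_T:\operatorname{Coim}g\to J_T$, $\sigma_T:J_T\to C'$. Nomura's morphism $\Lambda$: if the rows are semiexact and $b$ is strict (so that $\operatorname{Im}b$ and $\operatorname{Coim}b$ are identified via $\bar b$), then $\Lambda:\operatorname{Im}S\to\operatorname{Ker}T\cong\operatorname{Ker}\sigma_T$ is the morphism characterized by $(\ker\sigma_T)\,\Lambda\,(\operatorname{coker}\rho_S)=i_T\,k_S$ (i.e. $i_T\,\bar b^{-1}k_S$). *)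

theory Defs
  imports "HOL-Algebra.Group"
begin

text \<open>
  Categories are given by a set of objects and a set of morphisms inside two arbitrary types.
  Composition is written right to left and is meaningful only for composable morphisms;
  \<open>zmor \<A> X Y\<close> is the zero morphism from \<open>X\<close> to \<open>Y\<close>.
\<close>

record ('o, 'm) precategory =
  Obj :: "'o set"
  Mor :: "'m set"
  src :: "'m \<Rightarrow> 'o"
  tgt :: "'m \<Rightarrow> 'o"
  ident :: "'o \<Rightarrow> 'm"
  cmp :: "'m \<Rightarrow> 'm \<Rightarrow> 'm" (infixr "\<cdot>\<index>" 70)
  madd :: "'m \<Rightarrow> 'm \<Rightarrow> 'm"
  zmor :: "'o \<Rightarrow> 'o \<Rightarrow> 'm"

context
  fixes \<A> :: "('o, 'm) precategory" (structure)
begin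

definition Hom :: "'o \<Rightarrow> 'o \<Rightarrow> 'm set" where
  "Hom X Y = {h \<in> Mor \<A>. src \<A> h = X \<and> tgt \<A> h = Y}"

definition is_iso :: "'m \<Rightarrow> bool" where
  "is_iso h \<longleftrightarrow> h \<in> Mor \<A> \<and>
     (\<exists>k \<in> Hom (tgt \<A> h) (src \<A> h).
        k \<cdot> h = ident \<A> (src \<A> h) \<and> h \<cdot> k = ident \<A> (tgt \<A> h))"

definition is_zero_object :: "'o \<Rightarrow> bool" where
  "is_zero_object Z \<longleftrightarrow> Z \<in> Obj \<A> \<and>
     (\<forall>X \<in> Obj \<A>. (\<exists>!h. h \<in> Hom Z X) \<and> (\<exists>!h. h \<in> Hom X Z))"

definition is_biproduct :: "'o \<Rightarrow> 'o \<Rightarrow> 'm \<Rightarrow> 'm \<Rightarrow> 'm \<Rightarrow> 'm \<Rightarrow> bool" where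
  "is_biproduct X Y i1 i2 p1 p2 \<longleftrightarrow>
     (\<exists>P \<in> Obj \<A>. i1 \<in> Hom X P \<and> i2 \<in> Hom Y P \<and> p1 \<in> Hom P X \<and> p2 \<in> Hom P Y \<and>
        p1 \<cdot> i1 = ident \<A> X \<and> p2 \<cdot> i2 = ident \<A> Y \<and>
        p1 \<cdot> i2 = zmor \<A> Y X \<and> p2 \<cdot> i1 = zmor \<A> X Y \<and>
        madd \<A> (i1 \<cdot> p1) (i2 \<cdot> p2) = ident \<A> P)"

definition is_kernel :: "'m \<Rightarrow> 'm \<Rightarrow> bool" where
  "is_kernel k h \<longleftrightarrow> k \<in> Mor \<A> \<and> h \<in> Mor \<A> \<and> tgt \<A> k = src \<A> h \<and>
     h \<cdot> k = zmor \<A> (src \<A> k) (tgt \<A> h) \<and>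
     (\<forall>x \<in> Mor \<A>. tgt \<A> x = src \<A> h \<and> h \<cdot> x = zmor \<A> (src \<A> x) (tgt \<A> h) \<longrightarrow>
        (\<exists>!u. u \<in> Hom (src \<A> x) (src \<A> k) \<and> k \<cdot> u = x))"

definition is_cokernel :: "'m \<Rightarrow> 'm \<Rightarrow> bool" where
  "is_cokernel e h \<longleftrightarrow> e \<in> Mor \<A> \<and> h \<in> Mor \<A> \<and> src \<A> e = tgt \<A> h \<and>
     e \<cdot> h = zmor \<A> (src \<A> h) (tgt \<A> e) \<and>
     (\<forall>x \<in> Mor \<A>. src \<A> x = tgt \<A> h \<and> x \<cdot> h = zmor \<A> (src \<A> h) (tgt \<A> x) \<longrightarrow>
        (\<exists>!u. u \<in> Hom (tgt \<A> e) (tgt \<A> x) \<and> u \<cdot> e = x))"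

definition strict_monic :: "'m \<Rightarrow> bool" where
  "strict_monic m \<longleftrightarrow> (\<exists>h. is_kernel m h)"

definition strict_epic :: "'m \<Rightarrow> bool" where
  "strict_epic e \<longleftrightarrow> (\<exists>h. is_cokernel e h)"

text \<open>In a pullback square \<open>h \<cdot> p = k \<cdot> q\<close>, the morphism \<open>p\<close> is parallel to \<open>k\<close>;
  in a pushout square \<open>i \<cdot> h = j \<cdot> k\<close>, the morphism \<open>i\<close> is parallel to \<open>k\<close>.\<close>

definition is_pullback :: "'m \<Rightarrow> 'm \<Rightarrow> 'm \<Rightarrow> 'm \<Rightarrow> bool" where
  "is_pullback p q h k \<longleftrightarrow> {p, q, h, k} \<subseteq> Mor \<A> \<and> tgt \<A> h = tgt \<A> k \<and> src \<A> p = src \<A> q \<and>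
     tgt \<A> p = src \<A> h \<and> tgt \<A> q = src \<A> k \<and> h \<cdot> p = k \<cdot> q \<and>
     (\<forall>x \<in> Mor \<A>. \<forall>y \<in> Mor \<A>.
        src \<A> x = src \<A> y \<and> tgt \<A> x = src \<A> h \<and> tgt \<A> y = src \<A> k \<and> h \<cdot> x = k \<cdot> y \<longrightarrow>
        (\<exists>!u. u \<in> Hom (src \<A> x) (src \<A> p) \<and> p \<cdot> u = x \<and> q \<cdot> u = y))"

definition is_pushout :: "'m \<Rightarrow> 'm \<Rightarrow> 'm \<Rightarrow> 'm \<Rightarrow> bool" where
  "is_pushout i j h k \<longleftrightarrow> {i, j, h, k} \<subseteq> Mor \<A> \<and> src \<A> h = src \<A> k \<and> tgt \<A> i = tgt \<A> j \<and>
     src \<A> i = tgt \<A> h \<and> src \<A> j = tgt \<A> k \<and> i \<cdot> h = j \<cdot> k \<and>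
     (\<forall>x \<in> Mor \<A>. \<forall>y \<in> Mor \<A>.
        tgt \<A> x = tgt \<A> y \<and> src \<A> x = tgt \<A> h \<and> src \<A> y = tgt \<A> k \<and> x \<cdot> h = y \<cdot> k \<longrightarrow>
        (\<exists>!u. u \<in> Hom (tgt \<A> i) (tgt \<A> x) \<and> u \<cdot> i = x \<and> u \<cdot> j = y))"

end

locale category =
  fixes \<A> :: "('o, 'm) precategory" (structure)
  assumes src_in_Obj: "h \<in> Mor \<A> \<Longrightarrow> src \<A> h \<in> Obj \<A>"
    and tgt_in_Obj: "h \<in> Mor \<A> \<Longrightarrow> tgt \<A> h \<in> Obj \<A>"
    and ident_in_Hom: "X \<in> Obj \<A> \<Longrightarrow> ident \<A> X \<in> Hom \<A> X X"
    and cmp_in_Hom: "\<lbrakk>k \<in> Hom \<A> Y Z; h \<in> Hom \<A> X Y\<rbrakk> \<Longrightarrow> k \<cdot> h \<in> Hom \<A> X Z"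
    and cmp_assoc: "\<lbrakk>l \<in> Hom \<A> Y Z; k \<in> Hom \<A> X Y; h \<in> Hom \<A> W X\<rbrakk> \<Longrightarrow> (l \<cdot> k) \<cdot> h = l \<cdot> (k \<cdot> h)"
    and cmp_ident_left: "h \<in> Hom \<A> X Y \<Longrightarrow> ident \<A> Y \<cdot> h = h"
    and cmp_ident_right: "h \<in> Hom \<A> X Y \<Longrightarrow> h \<cdot> ident \<A> X = h"

locale preadditive_category = category +
  assumes Hom_comm_group: "\<lbrakk>X \<in> Obj \<A>; Y \<in> Obj \<A>\<rbrakk> \<Longrightarrow>
      comm_group \<lparr>carrier = Hom \<A> X Y, monoid.mult = madd \<A>, one = zmor \<A> X Y\<rparr>"
    and cmp_madd_left: "\<lbrakk>k \<in> Hom \<A> Y Z; l \<in> Hom \<A> Y Z; h \<in> Hom \<A> X Y\<rbrakk> \<Longrightarrow>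
      madd \<A> k l \<cdot> h = madd \<A> (k \<cdot> h) (l \<cdot> h)"
    and cmp_madd_right: "\<lbrakk>l \<in> Hom \<A> Y Z; h \<in> Hom \<A> X Y; k \<in> Hom \<A> X Y\<rbrakk> \<Longrightarrow>
      l \<cdot> madd \<A> h k = madd \<A> (l \<cdot> h) (l \<cdot> k)"

locale additive_category = preadditive_category +
  assumes zero_object_exists: "\<exists>Z. is_zero_object \<A> Z"
    and biproduct_exists: "\<lbrakk>X \<in> Obj \<A>; Y \<in> Obj \<A>\<rbrakk> \<Longrightarrow>
      \<exists>i1 i2 p1 p2. is_biproduct \<A> X Y i1 i2 p1 p2"

locale quasi_abelian_category = additive_category +
  assumes kernel_exists: "h \<in> Mor \<A> \<Longrightarrow> \<exists>k. is_kernel \<A> k h"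
    and cokernel_exists: "h \<in> Mor \<A> \<Longrightarrow> \<exists>e. is_cokernel \<A> e h"
    and strict_epic_pullback: "\<lbrakk>is_pullback \<A> p q h k; strict_epic \<A> k\<rbrakk> \<Longrightarrow> strict_epic \<A> p"
    and strict_monic_pushout: "\<lbrakk>is_pushout \<A> i j h k; strict_monic \<A> k\<rbrakk> \<Longrightarrow> strict_monic \<A> i"

text \<open>
  A commutative square; \<open>top\<close> and \<open>left\<close> have a common source, \<open>right\<close> and \<open>bottom\<close> a common
  target, and \<open>right \<cdot> top = bottom \<cdot> left\<close>.
\<close>

record 'm square =
  sq_top :: 'm
  sq_left :: 'm
  sq_bottom :: 'm
  sq_right :: 'm

text \<open>
  Kernels, cokernels, pullbacks, pushouts, direct sums and the zero object are determined up to
  isomorphism; below, one representative of each is fixed by Hilbert choice. The final \<open>O\<close> in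
  \<open>kerO\<close>, \<open>cokerO\<close>, \<open>imO\<close>, \<open>coimO\<close> marks the object belonging to the morphism.
\<close>

context
  fixes \<A> :: "('o, 'm) precategory" (structure)
begin

definition zero_object :: 'o where
  "zero_object = (SOME Z. is_zero_object \<A> Z)"

definition ker :: "'m \<Rightarrow> 'm" where
  "ker h = (SOME k. is_kernel \<A> k h)"

definition kerO :: "'m \<Rightarrow> 'o" where
  "kerO h = src \<A> (ker h)"

definition coker :: "'m \<Rightarrow> 'm" where
  "coker h = (SOME e. is_cokernel \<A> e h)"

definition cokerO :: "'m \<Rightarrow> 'o" where
  "cokerO h = tgt \<A> (coker h)"

definition im :: "'m \<Rightarrow> 'm" where
  "im h = ker (coker h)"

definition imO :: "'m \<Rightarrow> 'o" where
  "imO h = src \<A> (im h)"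

definition coim :: "'m \<Rightarrow> 'm" where
  "coim h = coker (ker h)"

definition coimO :: "'m \<Rightarrow> 'o" where
  "coimO h = tgt \<A> (coim h)"

definition bar :: "'m \<Rightarrow> 'm" where
  "bar h = (THE u. u \<in> Hom \<A> (coimO h) (imO h) \<and> im h \<cdot> u \<cdot> coim h = h)"

text \<open>Only used for isomorphisms.\<close>
definition inv_mor :: "'m \<Rightarrow> 'm" where
  "inv_mor h = (THE k. k \<in> Hom \<A> (tgt \<A> h) (src \<A> h) \<and>
     k \<cdot> h = ident \<A> (src \<A> h) \<and> h \<cdot> k = ident \<A> (tgt \<A> h))"

text \<open>The unique factorization of \<open>h\<close> through a monomorphism \<open>m\<close>.\<close>
definition lift :: "'m \<Rightarrow> 'm \<Rightarrow> 'm" where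
  "lift m h = (THE u. u \<in> Hom \<A> (src \<A> h) (src \<A> m) \<and> m \<cdot> u = h)"

definition biproduct :: "'o \<Rightarrow> 'o \<Rightarrow> 'm \<times> 'm \<times> 'm \<times> 'm" where
  "biproduct X Y = (SOME (i1, i2, p1, p2). is_biproduct \<A> X Y i1 i2 p1 p2)"

text \<open>The morphism \<open>\<langle>h, k\<rangle>\<close> out of the direct sum of the sources of \<open>h\<close> and \<open>k\<close>.\<close>
definition copair :: "'m \<Rightarrow> 'm \<Rightarrow> 'm" where
  "copair h k = (case biproduct (src \<A> h) (src \<A> k) of (i1, i2, p1, p2) \<Rightarrow>
     (THE u. u \<in> Hom \<A> (tgt \<A> i1) (tgt \<A> h) \<and> u \<cdot> i1 = h \<and> u \<cdot> i2 = k))"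

definition pullback :: "'m \<Rightarrow> 'm \<Rightarrow> 'm \<times> 'm" where
  "pullback h k = (SOME (p, q). is_pullback \<A> p q h k)"

definition pushout :: "'m \<Rightarrow> 'm \<Rightarrow> 'm \<times> 'm" where
  "pushout h k = (SOME (i, j). is_pushout \<A> i j h k)"

definition semiexact :: "'m \<Rightarrow> 'm \<Rightarrow> bool" where
  "semiexact h k \<longleftrightarrow> h \<in> Mor \<A> \<and> k \<in> Mor \<A> \<and> tgt \<A> h = src \<A> k \<and>
     k \<cdot> h = zmor \<A> (src \<A> h) (tgt \<A> k)"

text \<open>\<open>im h = ker k\<close> is an equality of subobjects.\<close>
definition exact :: "'m \<Rightarrow> 'm \<Rightarrow> bool" where
  "exact h k \<longleftrightarrow> h \<in> Mor \<A> \<and> k \<in> Mor \<A> \<and> tgt \<A> h = src \<A> k \<and>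
     (\<exists>u \<in> Hom \<A> (imO h) (kerO k). is_iso \<A> u \<and> ker k \<cdot> u = im h)"

definition exact_seq :: "'m list \<Rightarrow> bool" where
  "exact_seq hs \<longleftrightarrow> successively exact hs"

definition homology_eps :: "'m \<Rightarrow> 'm \<Rightarrow> 'm" where
  "homology_eps h k = lift (ker k) (im h)"

definition homology :: "'m \<Rightarrow> 'm \<Rightarrow> 'o" where
  "homology h k = cokerO (homology_eps h k)"

definition sq_diag :: "'m square \<Rightarrow> 'm" where
  "sq_diag S = sq_right S \<cdot> sq_top S"

definition sq_k :: "'m square \<Rightarrow> 'm" where
  "sq_k S = fst (pullback (im (sq_right S)) (im (sq_bottom S)))"

definition sq_l :: "'m square \<Rightarrow> 'm" where
  "sq_l S = snd (pullback (im (sq_right S)) (im (sq_bottom S)))"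

definition sq_I :: "'m square \<Rightarrow> 'o" where
  "sq_I S = src \<A> (sq_k S)"

definition sq_rho :: "'m square \<Rightarrow> 'm" where
  "sq_rho S = (THE r. r \<in> Hom \<A> (imO (sq_diag S)) (sq_I S) \<and>
     sq_k S \<cdot> r = lift (im (sq_right S)) (im (sq_diag S)) \<and>
     sq_l S \<cdot> r = lift (im (sq_bottom S)) (im (sq_diag S)))"

definition Im_sq :: "'m square \<Rightarrow> 'o" where
  "Im_sq S = cokerO (sq_rho S)"

definition sq_mu :: "'m square \<Rightarrow> 'm" where
  "sq_mu S = lift (ker (sq_diag S)) (ker (sq_left S))"

definition sq_nu :: "'m square \<Rightarrow> 'm" where
  "sq_nu S = lift (ker (sq_diag S)) (ker (sq_top S))"

definition Ker_sq :: "'m square \<Rightarrow> 'o" where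
  "Ker_sq S = cokerO (copair (sq_mu S) (sq_nu S))"

definition sq_i :: "'m square \<Rightarrow> 'm" where
  "sq_i S = fst (pushout (coim (sq_left S)) (coim (sq_top S)))"

definition sq_j :: "'m square \<Rightarrow> 'm" where
  "sq_j S = snd (pushout (coim (sq_left S)) (coim (sq_top S)))"

definition sq_J :: "'m square \<Rightarrow> 'o" where
  "sq_J S = tgt \<A> (sq_i S)"

definition sq_sigma :: "'m square \<Rightarrow> 'm" where
  "sq_sigma S = (THE s. s \<in> Hom \<A> (sq_J S) (tgt \<A> (sq_right S)) \<and>
     s \<cdot> sq_j S = sq_right S \<cdot> im (sq_top S) \<cdot> bar (sq_top S) \<and>
     s \<cdot> sq_i S = sq_bottom S \<cdot> im (sq_left S) \<cdot> bar (sq_left S))"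

text \<open>The identification of \<open>Ker_sq S\<close> with the kernel object of \<open>sq_sigma S\<close>.\<close>
definition sq_eta :: "'m square \<Rightarrow> 'm" where
  "sq_eta S = (THE e. e \<in> Hom \<A> (Ker_sq S) (kerO (sq_sigma S)) \<and> is_iso \<A> e \<and>
     ker (sq_sigma S) \<cdot> e \<cdot> coker (copair (sq_mu S) (sq_nu S)) =
     sq_j S \<cdot> coim (sq_top S) \<cdot> ker (sq_diag S))"

text \<open>
  Nomura's morphism for two adjacent squares with strict common edge
  \<open>b = sq_right S = sq_left T\<close>. Its target is \<open>Ker_sq T\<close>; the identification \<open>sq_eta T\<close> is
  inserted explicitly.
\<close>
definition Lambda :: "'m square \<Rightarrow> 'm square \<Rightarrow> 'm" where
  "Lambda S T = (THE L. L \<in> Hom \<A> (Im_sq S) (Ker_sq T) \<and>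
     ker (sq_sigma T) \<cdot> sq_eta T \<cdot> L \<cdot> coker (sq_rho S) =
     sq_i T \<cdot> inv_mor (bar (sq_right S)) \<cdot> sq_k S)"

text \<open>
  The canonical morphism \<open>\<theta>\<close> is the one induced on cokernels by the morphism \<open>w\<close> through which
  \<open>b\<close> maps \<open>Ker g\<close> into the intersection \<open>sq_I S\<close> of \<open>Im b\<close> and \<open>Im f'\<close>, where \<open>f = sq_top S\<close>,
  \<open>f' = sq_bottom S\<close>, \<open>g = sq_top T\<close>, \<open>b = sq_right S = sq_left T\<close>.
\<close>
definition is_canonical_theta :: "'m square \<Rightarrow> 'm square \<Rightarrow> 'm \<Rightarrow> bool" where
  "is_canonical_theta S T \<theta> \<longleftrightarrow>
     \<theta> \<in> Hom \<A> (homology (sq_top S) (sq_top T)) (Im_sq S) \<and>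
     (\<exists>w \<in> Hom \<A> (kerO (sq_top T)) (sq_I S).
        im (sq_right S) \<cdot> sq_k S \<cdot> w = sq_right S \<cdot> ker (sq_top T) \<and>
        \<theta> \<cdot> coker (homology_eps (sq_top S) (sq_top T)) = coker (sq_rho S) \<cdot> w)"

text \<open>
  The canonical morphism \<open>\<kappa>\<close> is the one induced on cokernels by the restriction
  \<open>w : Ker (g' \<cdot> b) \<rightarrow> Ker g'\<close> of \<open>b\<close>, where moreover \<open>g' = sq_bottom T\<close>.
\<close>
definition is_canonical_kappa :: "'m square \<Rightarrow> 'm square \<Rightarrow> 'm \<Rightarrow> bool" where
  "is_canonical_kappa S T \<kappa> \<longleftrightarrow>
     \<kappa> \<in> Hom \<A> (Ker_sq T) (homology (sq_bottom S) (sq_bottom T)) \<and>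
     (\<exists>w \<in> Hom \<A> (kerO (sq_diag T)) (kerO (sq_bottom T)).
        ker (sq_bottom T) \<cdot> w = sq_left T \<cdot> ker (sq_diag T) \<and>
        \<kappa> \<cdot> coker (copair (sq_mu T) (sq_nu T)) =
        coker (homology_eps (sq_bottom S) (sq_bottom T)) \<cdot> w)"

end

end

theory Submission
  imports Defs
begin

text \<open>
  Both sequences are instances of the third isomorphism theorem. For \<open>m : M \<rightarrow> N\<close> and a strict
  monomorphism \<open>n : N \<rightarrow> P\<close>, the sequence \<open>0 \<rightarrow> N/M \<rightarrow> P/M \<rightarrow> P/N \<rightarrow> 0\<close> is short exact, where quotients
  stand for cokernels (\<open>third_isomorphism\<close>, \<open>short_exact_seq\<close>). What remains is to recognise the
  three objects of each sequence as such quotients, and \<open>\<Lambda>\<close> as the induced morphism.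

  If \<open>b\<close> is a strict monomorphism and \<open>Im f' = Ker g'\<close>, then the intersection of \<open>Im b\<close> and \<open>Im f'\<close> is
  \<open>Ker (g' b)\<close>, and the chain is \<open>Im f \<rightarrow> Ker g \<rightarrow> Ker (g' b)\<close>: the homology is \<open>Ker g / Im f\<close>, \<open>Im S\<close> is
  \<open>Ker (g' b) / Im f\<close>, and \<open>Ker T\<close> is \<open>Ker (g' b) / Ker g\<close> because \<open>Ker b = 0\<close> (\<open>theta_sequence\<close>).

  If \<open>b\<close> is a strict epimorphism and \<open>Im f = Ker g\<close>, then the intersection is \<open>Im f'\<close>, and the chain is
  \<open>Im (b f) \<rightarrow> Im f' \<rightarrow> Ker g'\<close>. Here \<open>Ker (g' b) \<rightarrow> Ker g'\<close> is a quotient by \<open>Ker b\<close>, so \<open>Ker T\<close>, which is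
  \<open>Ker (g' b) / (Ker b + Ker g)\<close>, is \<open>Ker g'\<close> modulo \<open>b (Ker g) = b (Im f)\<close> (\<open>kappa_sequence\<close>).

  The axioms of a quasi-abelian category enter at two places. Stability of strict monomorphisms
  under pushout gives the monomorphism \<open>N/M \<rightarrow> P/M\<close>, hence composites of strict monomorphisms are
  strict and the corestriction of a morphism to its image is epic (\<open>image_corestriction_epic\<close>). As a
  cokernel of a morphism is determined by what annihilates that morphism, images may then be replaced
  by sources whenever a cokernel is taken. Stability of strict epimorphisms under pullback makes
  \<open>Ker (h p) \<rightarrow> Ker h\<close> a quotient by \<open>Ker p\<close> for a strict epimorphism \<open>p\<close>
  (\<open>kernel_restriction_cokernel\<close>); this is used for \<open>p = b\<close> and to identify the two descriptions of
  \<open>Ker T\<close> (\<open>sq_eta_characterization\<close>), by which \<open>\<Lambda>\<close> is characterised.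
\<close>

section \<open>Calculus of composable morphisms\<close>

lemma Hom_iff [simp]: "h \<in> Hom \<A> X Y \<longleftrightarrow> h \<in> Mor \<A> \<and> src \<A> h = X \<and> tgt \<A> h = Y"
  by (simp add: Hom_def)

context category
begin

declare src_in_Obj [simp] tgt_in_Obj [simp]

lemma ident_typing [simp]:
  assumes "X \<in> Obj \<A>"
  shows "ident \<A> X \<in> Mor \<A>" "src \<A> (ident \<A> X) = X" "tgt \<A> (ident \<A> X) = X"
  using ident_in_Hom[OF assms] by simp_all

lemma cmp_typing [simp]:
  assumes "k \<in> Mor \<A>" "h \<in> Mor \<A>" "src \<A> k = tgt \<A> h"
  shows "k \<cdot> h \<in> Mor \<A>" "src \<A> (k \<cdot> h) = src \<A> h" "tgt \<A> (k \<cdot> h) = tgt \<A> k"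
  using cmp_in_Hom[of k "tgt \<A> h" "tgt \<A> k" h "src \<A> h"] assms by simp_all

lemma assoc [simp]:
  assumes "l \<in> Mor \<A>" "k \<in> Mor \<A>" "h \<in> Mor \<A>" "src \<A> l = tgt \<A> k" "src \<A> k = tgt \<A> h"
  shows "(l \<cdot> k) \<cdot> h = l \<cdot> (k \<cdot> h)"
  using cmp_assoc[of l "tgt \<A> k" "tgt \<A> l" k "tgt \<A> h" h "src \<A> h"] assms by simp

lemma ident_cmp [simp]: "h \<in> Mor \<A> \<Longrightarrow> tgt \<A> h = Y \<Longrightarrow> ident \<A> Y \<cdot> h = h"
  using cmp_ident_left[of h] by simp

lemma cmp_ident [simp]: "h \<in> Mor \<A> \<Longrightarrow> src \<A> h = X \<Longrightarrow> h \<cdot> ident \<A> X = h"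
  using cmp_ident_right[of h] by simp

text \<open>Compositions are kept in right-associated normal form; this turns an equation between
  two-factor composites into a rewrite rule under a further factor on the right.\<close>

lemma cmp_extend:
  assumes "k \<cdot> h = l" "k \<in> Mor \<A>" "h \<in> Mor \<A>" "x \<in> Mor \<A>" "src \<A> k = tgt \<A> h" "src \<A> h = tgt \<A> x"
  shows "k \<cdot> (h \<cdot> x) = l \<cdot> x"
  using assms(1) assoc[OF assms(2-6)] by simp

definition monic where
  "monic m \<longleftrightarrow> m \<in> Mor \<A> \<and> (\<forall>x \<in> Mor \<A>. \<forall>y \<in> Mor \<A>.
     src \<A> x = src \<A> y \<and> tgt \<A> x = src \<A> m \<and> tgt \<A> y = src \<A> m \<and> m \<cdot> x = m \<cdot> y \<longrightarrow> x = y)"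

definition epic where
  "epic e \<longleftrightarrow> e \<in> Mor \<A> \<and> (\<forall>x \<in> Mor \<A>. \<forall>y \<in> Mor \<A>.
     tgt \<A> x = tgt \<A> y \<and> src \<A> x = tgt \<A> e \<and> src \<A> y = tgt \<A> e \<and> x \<cdot> e = y \<cdot> e \<longrightarrow> x = y)"

lemma monic_cancel:
  assumes "monic m" "m \<cdot> x = m \<cdot> y" "x \<in> Mor \<A>" "y \<in> Mor \<A>"
    "src \<A> x = src \<A> y" "tgt \<A> x = src \<A> m" "tgt \<A> y = src \<A> m"
  shows "x = y"
  using assms unfolding monic_def by blast

lemma epic_cancel:
  assumes "epic e" "x \<cdot> e = y \<cdot> e" "x \<in> Mor \<A>" "y \<in> Mor \<A>"
    "tgt \<A> x = tgt \<A> y" "src \<A> x = tgt \<A> e" "src \<A> y = tgt \<A> e"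
  shows "x = y"
  using assms unfolding epic_def by blast

lemma epic_cmp:
  assumes "epic d" "epic e" "src \<A> d = tgt \<A> e"
  shows "epic (d \<cdot> e)"
  unfolding epic_def
proof (intro conjI ballI impI)
  have M: "d \<in> Mor \<A>" "e \<in> Mor \<A>"
    using assms unfolding epic_def by blast+
  show "d \<cdot> e \<in> Mor \<A>" using M assms by simp
  fix x y
  assume xy: "x \<in> Mor \<A>" "y \<in> Mor \<A>" "tgt \<A> x = tgt \<A> y \<and> src \<A> x = tgt \<A> (d \<cdot> e) \<and>
    src \<A> y = tgt \<A> (d \<cdot> e) \<and> x \<cdot> d \<cdot> e = y \<cdot> d \<cdot> e"
  have "x \<cdot> d = y \<cdot> d"
    by (rule epic_cancel[OF assms(2)]) (use M assms xy in simp_all)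
  then show "x = y"
    using epic_cancel[OF assms(1), of x y] M assms xy by simp
qed

lemma monic_cmp:
  assumes "monic m" "monic n" "src \<A> m = tgt \<A> n"
  shows "monic (m \<cdot> n)"
  unfolding monic_def
proof (intro conjI ballI impI)
  have M: "m \<in> Mor \<A>" "n \<in> Mor \<A>"
    using assms unfolding monic_def by blast+
  show "m \<cdot> n \<in> Mor \<A>" using M assms by simp
  fix x y
  assume xy: "x \<in> Mor \<A>" "y \<in> Mor \<A>" "src \<A> x = src \<A> y \<and> tgt \<A> x = src \<A> (m \<cdot> n) \<and>
    tgt \<A> y = src \<A> (m \<cdot> n) \<and> (m \<cdot> n) \<cdot> x = (m \<cdot> n) \<cdot> y"
  then have "m \<cdot> n \<cdot> x = m \<cdot> n \<cdot> y" using M assms(3) by (metis assoc cmp_typing(2))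
  then have "n \<cdot> x = n \<cdot> y"
    using monic_cancel[OF assms(1), of "n \<cdot> x" "n \<cdot> y"] M assms(3) xy(1,2) xy(3)[THEN conjunct1]
      xy(3)[THEN conjunct2, THEN conjunct1] xy(3)[THEN conjunct2, THEN conjunct2, THEN conjunct1] by simp
  then show "x = y"
    using monic_cancel[OF assms(2), of x y] M assms xy by simp
qed

lemma is_isoI:
  assumes "h \<in> Mor \<A>" "k \<in> Mor \<A>" "src \<A> k = tgt \<A> h" "tgt \<A> k = src \<A> h"
    "k \<cdot> h = ident \<A> (src \<A> h)" "h \<cdot> k = ident \<A> (tgt \<A> h)"
  shows "is_iso \<A> h"
  unfolding is_iso_def using assms by auto

lemma is_isoE:
  assumes "is_iso \<A> h"
  obtains k where "h \<in> Mor \<A>" "k \<in> Mor \<A>" "src \<A> k = tgt \<A> h" "tgt \<A> k = src \<A> h"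
    "k \<cdot> h = ident \<A> (src \<A> h)" "h \<cdot> k = ident \<A> (tgt \<A> h)"
  using assms unfolding is_iso_def by auto

lemma iso_epic:
  assumes "is_iso \<A> h"
  shows "epic h"
proof -
  obtain k where k: "h \<in> Mor \<A>" "k \<in> Mor \<A>" "src \<A> k = tgt \<A> h" "tgt \<A> k = src \<A> h"
    "k \<cdot> h = ident \<A> (src \<A> h)" "h \<cdot> k = ident \<A> (tgt \<A> h)"
    using assms by (rule is_isoE)
  have "x = y" if "x \<in> Mor \<A>" "y \<in> Mor \<A>" "src \<A> x = tgt \<A> h" "src \<A> y = tgt \<A> h" "x \<cdot> h = y \<cdot> h" for x y
  proof -
    have "x = (x \<cdot> h) \<cdot> k" using that(1-4) k by simp
    also have "\<dots> = y" unfolding that(5) using that(1-4) k by simp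
    finally show ?thesis .
  qed
  then show ?thesis using k unfolding epic_def by blast
qed

lemma iso_monic:
  assumes "is_iso \<A> h"
  shows "monic h"
proof -
  obtain k where k: "h \<in> Mor \<A>" "k \<in> Mor \<A>" "src \<A> k = tgt \<A> h" "tgt \<A> k = src \<A> h"
    "k \<cdot> h = ident \<A> (src \<A> h)" "h \<cdot> k = ident \<A> (tgt \<A> h)"
    using assms by (rule is_isoE)
  have "x = y" if "x \<in> Mor \<A>" "y \<in> Mor \<A>" "tgt \<A> x = src \<A> h" "tgt \<A> y = src \<A> h" "h \<cdot> x = h \<cdot> y" for x y
  proof -
    have "x = k \<cdot> h \<cdot> x" using that(1-4) k cmp_extend[OF k(5)] by simp
    also have "\<dots> = y" unfolding that(5) using that(1-4) k cmp_extend[OF k(5)] by simp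
    finally show ?thesis .
  qed
  then show ?thesis using k unfolding monic_def by blast
qed

lemma inv_mor_inverse:
  assumes "is_iso \<A> h"
  shows "inv_mor \<A> h \<in> Mor \<A>" "src \<A> (inv_mor \<A> h) = tgt \<A> h" "tgt \<A> (inv_mor \<A> h) = src \<A> h"
    "inv_mor \<A> h \<cdot> h = ident \<A> (src \<A> h)" "h \<cdot> inv_mor \<A> h = ident \<A> (tgt \<A> h)"
proof -
  obtain k where k: "h \<in> Mor \<A>" "k \<in> Mor \<A>" "src \<A> k = tgt \<A> h" "tgt \<A> k = src \<A> h"
    "k \<cdot> h = ident \<A> (src \<A> h)" "h \<cdot> k = ident \<A> (tgt \<A> h)"
    using assms by (rule is_isoE)
  have "inv_mor \<A> h = k"
    unfolding inv_mor_def
  proof (rule the_equality)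
    fix k' assume "k' \<in> Hom \<A> (tgt \<A> h) (src \<A> h) \<and> k' \<cdot> h = ident \<A> (src \<A> h) \<and>
      h \<cdot> k' = ident \<A> (tgt \<A> h)"
    then show "k' = k"
      using epic_cancel[OF iso_epic[OF assms], of k' k] k by simp
  qed (use k in simp)
  then show "inv_mor \<A> h \<in> Mor \<A>" "src \<A> (inv_mor \<A> h) = tgt \<A> h" "tgt \<A> (inv_mor \<A> h) = src \<A> h"
    "inv_mor \<A> h \<cdot> h = ident \<A> (src \<A> h)" "h \<cdot> inv_mor \<A> h = ident \<A> (tgt \<A> h)"
    using k by simp_all
qed

lemma iso_cmp:
  assumes "is_iso \<A> h" "is_iso \<A> k" "src \<A> h = tgt \<A> k"
  shows "is_iso \<A> (h \<cdot> k)"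
proof -
  note H = inv_mor_inverse[OF assms(1)] and K = inv_mor_inverse[OF assms(2)]
  have M: "h \<in> Mor \<A>" "k \<in> Mor \<A>"
    using assms unfolding is_iso_def by blast+
  show ?thesis
    by (rule is_isoI[where k = "inv_mor \<A> k \<cdot> inv_mor \<A> h"])
      (use assms M H K cmp_extend[OF H(4)] cmp_extend[OF K(5)] in simp_all)
qed

lemma iso_inv_mor:
  assumes "is_iso \<A> h"
  shows "is_iso \<A> (inv_mor \<A> h)"
proof -
  have "h \<in> Mor \<A>" using assms unfolding is_iso_def by blast
  then show ?thesis
    using inv_mor_inverse[OF assms] by (intro is_isoI[where k = h]) simp_all
qed

lemma monic_split_epic_iso:
  assumes "monic k" "t \<in> Mor \<A>" "tgt \<A> t = src \<A> k" "src \<A> t = tgt \<A> k" "k \<cdot> t = ident \<A> (tgt \<A> k)"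
  shows "is_iso \<A> k"
proof -
  have M: "k \<in> Mor \<A>" using assms unfolding monic_def by blast
  have "t \<cdot> k = ident \<A> (src \<A> k)"
    by (rule monic_cancel[OF assms(1)]) (use M assms cmp_extend[OF assms(5)] in simp_all)
  then show ?thesis
    using is_isoI[of k t] M assms by simp
qed

lemma mutual_factor_iso:
  assumes "monic m" "monic n" "u \<in> Mor \<A>" "v \<in> Mor \<A>"
    "src \<A> u = src \<A> n" "tgt \<A> u = src \<A> m" "src \<A> v = src \<A> m" "tgt \<A> v = src \<A> n"
    "m \<cdot> u = n" "n \<cdot> v = m"
  shows "is_iso \<A> u"
proof -
  have M: "m \<in> Mor \<A>" "n \<in> Mor \<A>" using assms unfolding monic_def by blast+
  have "u \<cdot> v = ident \<A> (src \<A> m)"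
    by (rule monic_cancel[OF assms(1)]) (use M assms cmp_extend[OF assms(9)] in simp_all)
  moreover have "v \<cdot> u = ident \<A> (src \<A> n)"
    by (rule monic_cancel[OF assms(2)]) (use M assms cmp_extend[OF assms(10)] in simp_all)
  ultimately show ?thesis
    using is_isoI[of u v] assms by simp
qed

lemma mutual_cofactor_iso:
  assumes "epic d" "epic e" "u \<in> Mor \<A>" "v \<in> Mor \<A>"
    "src \<A> u = tgt \<A> d" "tgt \<A> u = tgt \<A> e" "src \<A> v = tgt \<A> e" "tgt \<A> v = tgt \<A> d"
    "u \<cdot> d = e" "v \<cdot> e = d"
  shows "is_iso \<A> u"
proof -
  have M: "d \<in> Mor \<A>" "e \<in> Mor \<A>" using assms unfolding epic_def by blast+
  have "u \<cdot> v = ident \<A> (tgt \<A> e)"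
    by (rule epic_cancel[OF assms(2)]) (use M assms in simp_all)
  moreover have "v \<cdot> u = ident \<A> (tgt \<A> d)"
    by (rule epic_cancel[OF assms(1)]) (use M assms in simp_all)
  ultimately show ?thesis
    using is_isoI[of u v] assms by simp
qed

lemma lift_eq:
  assumes "monic m" "u \<in> Mor \<A>" "src \<A> u = src \<A> h" "tgt \<A> u = src \<A> m" "m \<cdot> u = h"
  shows "lift \<A> m h = u"
  unfolding lift_def
proof (rule the_equality)
  fix v assume "v \<in> Hom \<A> (src \<A> h) (src \<A> m) \<and> m \<cdot> v = h"
  then show "v = u"
    using monic_cancel[OF assms(1), of v u] assms by simp
qed (use assms in simp)

end

section \<open>Kernels and cokernels\<close>

context preadditive_category
begin

lemma zmor_typing [simp]:
  assumes "X \<in> Obj \<A>" "Y \<in> Obj \<A>"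
  shows "zmor \<A> X Y \<in> Mor \<A>" "src \<A> (zmor \<A> X Y) = X" "tgt \<A> (zmor \<A> X Y) = Y"
proof -
  interpret G: comm_group "\<lparr>carrier = Hom \<A> X Y, monoid.mult = madd \<A>, one = zmor \<A> X Y\<rparr>"
    using Hom_comm_group[OF assms] .
  show "zmor \<A> X Y \<in> Mor \<A>" "src \<A> (zmor \<A> X Y) = X" "tgt \<A> (zmor \<A> X Y) = Y"
    using G.one_closed by simp_all
qed

lemma madd_typing [simp]:
  assumes "h \<in> Mor \<A>" "k \<in> Mor \<A>" "src \<A> k = src \<A> h" "tgt \<A> k = tgt \<A> h"
  shows "madd \<A> h k \<in> Mor \<A>" "src \<A> (madd \<A> h k) = src \<A> h" "tgt \<A> (madd \<A> h k) = tgt \<A> h"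
proof -
  interpret G: comm_group "\<lparr>carrier = Hom \<A> (src \<A> h) (tgt \<A> h), monoid.mult = madd \<A>,
      one = zmor \<A> (src \<A> h) (tgt \<A> h)\<rparr>"
    using Hom_comm_group assms by simp
  show "madd \<A> h k \<in> Mor \<A>" "src \<A> (madd \<A> h k) = src \<A> h" "tgt \<A> (madd \<A> h k) = tgt \<A> h"
    using G.m_closed[of h k] assms by simp_all
qed

lemma madd_zmor [simp]:
  assumes "h \<in> Mor \<A>" "src \<A> h = X" "tgt \<A> h = Y"
  shows "madd \<A> h (zmor \<A> X Y) = h" "madd \<A> (zmor \<A> X Y) h = h"
proof -
  interpret G: comm_group "\<lparr>carrier = Hom \<A> X Y, monoid.mult = madd \<A>, one = zmor \<A> X Y\<rparr>"
    using Hom_comm_group assms by auto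
  show "madd \<A> h (zmor \<A> X Y) = h" "madd \<A> (zmor \<A> X Y) h = h"
    using G.r_one[of h] G.l_one[of h] assms by simp_all
qed

lemma madd_cancel:
  assumes "madd \<A> h l = madd \<A> k l" "h \<in> Hom \<A> X Y" "k \<in> Hom \<A> X Y" "l \<in> Hom \<A> X Y"
  shows "h = k"
proof -
  interpret G: comm_group "\<lparr>carrier = Hom \<A> X Y, monoid.mult = madd \<A>, one = zmor \<A> X Y\<rparr>"
    using Hom_comm_group assms by auto
  show ?thesis using G.right_cancel[of l h k] assms by simp
qed

lemma madd_inverse:
  assumes "h \<in> Hom \<A> X Y"
  obtains k where "k \<in> Hom \<A> X Y" "madd \<A> h k = zmor \<A> X Y"
proof -
  interpret G: comm_group "\<lparr>carrier = Hom \<A> X Y, monoid.mult = madd \<A>, one = zmor \<A> X Y\<rparr>"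
    using Hom_comm_group assms by auto
  show ?thesis using G.r_inv_ex[of h] assms that by auto
qed

lemma cmp_zmor [simp]:
  assumes "k \<in> Mor \<A>" "X \<in> Obj \<A>" "src \<A> k = Y"
  shows "k \<cdot> zmor \<A> X Y = zmor \<A> X (tgt \<A> k)"
proof (rule madd_cancel)
  have Y: "Y \<in> Obj \<A>" using assms by auto
  show "madd \<A> (k \<cdot> zmor \<A> X Y) (k \<cdot> zmor \<A> X Y) = madd \<A> (zmor \<A> X (tgt \<A> k)) (k \<cdot> zmor \<A> X Y)"
    using cmp_madd_right[of k Y "tgt \<A> k" "zmor \<A> X Y" X "zmor \<A> X Y"] Y assms by simp
qed (use assms in auto)

lemma zmor_cmp [simp]:
  assumes "h \<in> Mor \<A>" "Z \<in> Obj \<A>" "tgt \<A> h = Y"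
  shows "zmor \<A> Y Z \<cdot> h = zmor \<A> (src \<A> h) Z"
proof (rule madd_cancel)
  have Y: "Y \<in> Obj \<A>" using assms by auto
  show "madd \<A> (zmor \<A> Y Z \<cdot> h) (zmor \<A> Y Z \<cdot> h) = madd \<A> (zmor \<A> (src \<A> h) Z) (zmor \<A> Y Z \<cdot> h)"
    using cmp_madd_left[of "zmor \<A> Y Z" Y Z "zmor \<A> Y Z" h "src \<A> h"] Y assms by simp
qed (use assms in auto)

text \<open>Subtracting reduces right cancellation to the case where one side is zero.\<close>

lemma epicI_zero:
  assumes "e \<in> Mor \<A>"
    and zero: "\<And>x. x \<in> Mor \<A> \<Longrightarrow> src \<A> x = tgt \<A> e \<Longrightarrow> x \<cdot> e = zmor \<A> (src \<A> e) (tgt \<A> x)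
      \<Longrightarrow> x = zmor \<A> (tgt \<A> e) (tgt \<A> x)"
  shows "epic e"
proof -
  have "x = y" if xy: "x \<in> Mor \<A>" "y \<in> Mor \<A>" "tgt \<A> x = tgt \<A> y" "src \<A> x = tgt \<A> e"
    "src \<A> y = tgt \<A> e" "x \<cdot> e = y \<cdot> e" for x y
  proof -
    obtain z where z: "z \<in> Hom \<A> (tgt \<A> e) (tgt \<A> y)" "madd \<A> y z = zmor \<A> (tgt \<A> e) (tgt \<A> y)"
      using madd_inverse[of y "tgt \<A> e" "tgt \<A> y"] xy by auto
    have "madd \<A> x z \<cdot> e = madd \<A> y z \<cdot> e"
      using cmp_madd_left[of x "tgt \<A> e" "tgt \<A> y" z e "src \<A> e"]
        cmp_madd_left[of y "tgt \<A> e" "tgt \<A> y" z e "src \<A> e"] xy z assms(1) by simp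
    then have "madd \<A> x z = zmor \<A> (tgt \<A> e) (tgt \<A> y)"
      using zero[of "madd \<A> x z"] xy z assms(1) by simp
    then show ?thesis
      using madd_cancel[of x z y "tgt \<A> e" "tgt \<A> y"] xy z by simp
  qed
  then show ?thesis using assms(1) unfolding epic_def by blast
qed

lemma epic_zero_iff:
  assumes "epic e" "x \<in> Mor \<A>" "src \<A> x = tgt \<A> e"
  shows "x \<cdot> e = zmor \<A> (src \<A> e) (tgt \<A> x) \<longleftrightarrow> x = zmor \<A> (tgt \<A> e) (tgt \<A> x)"
proof -
  have M: "e \<in> Mor \<A>" using assms unfolding epic_def by blast
  show ?thesis
    using epic_cancel[OF assms(1) _ assms(2), of "zmor \<A> (tgt \<A> e) (tgt \<A> x)"] assms M
    by (metis src_in_Obj tgt_in_Obj zmor_cmp zmor_typing)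
qed

lemma monic_zero:
  assumes "monic m" "m \<cdot> x = zmor \<A> (src \<A> x) (tgt \<A> m)" "x \<in> Mor \<A>" "tgt \<A> x = src \<A> m"
  shows "x = zmor \<A> (src \<A> x) (src \<A> m)"
proof -
  have M: "m \<in> Mor \<A>" using assms unfolding monic_def by blast
  show ?thesis
    by (rule monic_cancel[OF assms(1)]) (use assms M in simp_all)
qed

lemma is_kernel_typing:
  assumes "is_kernel \<A> k h"
  shows "k \<in> Mor \<A>" "h \<in> Mor \<A>" "tgt \<A> k = src \<A> h" "h \<cdot> k = zmor \<A> (src \<A> k) (tgt \<A> h)"
  using assms unfolding is_kernel_def by blast+

lemma is_cokernel_typing:
  assumes "is_cokernel \<A> e h"
  shows "e \<in> Mor \<A>" "h \<in> Mor \<A>" "src \<A> e = tgt \<A> h" "e \<cdot> h = zmor \<A> (src \<A> h) (tgt \<A> e)"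
  using assms unfolding is_cokernel_def by blast+

lemma strict_monic_in_Mor: "strict_monic \<A> m \<Longrightarrow> m \<in> Mor \<A>"
  unfolding strict_monic_def is_kernel_def by blast

lemma strict_epic_in_Mor: "strict_epic \<A> e \<Longrightarrow> e \<in> Mor \<A>"
  unfolding strict_epic_def is_cokernel_def by blast

lemma is_kernel_factor:
  assumes "is_kernel \<A> k h" "x \<in> Mor \<A>" "tgt \<A> x = src \<A> h" "h \<cdot> x = zmor \<A> (src \<A> x) (tgt \<A> h)"
  obtains u where "u \<in> Mor \<A>" "src \<A> u = src \<A> x" "tgt \<A> u = src \<A> k" "k \<cdot> u = x"
  using assms unfolding is_kernel_def by (metis Hom_iff)

lemma is_cokernel_factor:
  assumes "is_cokernel \<A> e h" "x \<in> Mor \<A>" "src \<A> x = tgt \<A> h" "x \<cdot> h = zmor \<A> (src \<A> h) (tgt \<A> x)"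
  obtains u where "u \<in> Mor \<A>" "src \<A> u = tgt \<A> e" "tgt \<A> u = tgt \<A> x" "u \<cdot> e = x"
  using assms unfolding is_cokernel_def by (metis Hom_iff)

lemma is_kernel_monic:
  assumes "is_kernel \<A> k h"
  shows "monic k"
  unfolding monic_def
proof (intro conjI ballI impI)
  note K = is_kernel_typing[OF assms]
  show "k \<in> Mor \<A>" by fact
  fix x y assume xy: "x \<in> Mor \<A>" "y \<in> Mor \<A>"
    "src \<A> x = src \<A> y \<and> tgt \<A> x = src \<A> k \<and> tgt \<A> y = src \<A> k \<and> k \<cdot> x = k \<cdot> y"
  have "h \<cdot> k \<cdot> x = zmor \<A> (src \<A> x) (tgt \<A> h)"
    using K xy cmp_extend[OF K(4)] by simp
  then obtain u where "\<And>v. v \<in> Hom \<A> (src \<A> x) (src \<A> k) \<Longrightarrow> k \<cdot> v = k \<cdot> x \<Longrightarrow> v = u"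
    using assms K xy cmp_typing[of k x] unfolding is_kernel_def by metis
  then show "x = y" using xy K by (metis Hom_iff)
qed

lemma is_cokernel_epic:
  assumes "is_cokernel \<A> e h"
  shows "epic e"
  unfolding epic_def
proof (intro conjI ballI impI)
  note K = is_cokernel_typing[OF assms]
  show "e \<in> Mor \<A>" by fact
  fix x y assume xy: "x \<in> Mor \<A>" "y \<in> Mor \<A>"
    "tgt \<A> x = tgt \<A> y \<and> src \<A> x = tgt \<A> e \<and> src \<A> y = tgt \<A> e \<and> x \<cdot> e = y \<cdot> e"
  have "(x \<cdot> e) \<cdot> h = zmor \<A> (src \<A> h) (tgt \<A> x)"
    using K xy by simp
  then obtain u where "\<And>v. v \<in> Hom \<A> (tgt \<A> e) (tgt \<A> x) \<Longrightarrow> v \<cdot> e = x \<cdot> e \<Longrightarrow> v = u"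
    using assms K xy assoc[of x e h] cmp_typing[of x e] unfolding is_cokernel_def by metis
  then show "x = y" using xy K by (metis Hom_iff)
qed

lemma is_kernelI:
  assumes "monic k" "h \<in> Mor \<A>" "tgt \<A> k = src \<A> h" "h \<cdot> k = zmor \<A> (src \<A> k) (tgt \<A> h)"
    and factor: "\<And>x. x \<in> Mor \<A> \<Longrightarrow> tgt \<A> x = src \<A> h \<Longrightarrow> h \<cdot> x = zmor \<A> (src \<A> x) (tgt \<A> h) \<Longrightarrow>
      \<exists>u \<in> Hom \<A> (src \<A> x) (src \<A> k). k \<cdot> u = x"
  shows "is_kernel \<A> k h"
  unfolding is_kernel_def
proof (intro conjI ballI impI)
  show "k \<in> Mor \<A>" using assms(1) unfolding monic_def by blast
  fix x assume x: "x \<in> Mor \<A>" "tgt \<A> x = src \<A> h \<and> h \<cdot> x = zmor \<A> (src \<A> x) (tgt \<A> h)"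
  then obtain u where u: "u \<in> Hom \<A> (src \<A> x) (src \<A> k)" "k \<cdot> u = x"
    using factor by blast
  show "\<exists>!u. u \<in> Hom \<A> (src \<A> x) (src \<A> k) \<and> k \<cdot> u = x"
  proof (rule ex1I[of _ u])
    fix v assume "v \<in> Hom \<A> (src \<A> x) (src \<A> k) \<and> k \<cdot> v = x"
    then show "v = u" using monic_cancel[OF assms(1), of v u] u by simp
  qed (use u in simp)
qed fact+

lemma is_cokernelI:
  assumes "epic e" "h \<in> Mor \<A>" "src \<A> e = tgt \<A> h" "e \<cdot> h = zmor \<A> (src \<A> h) (tgt \<A> e)"
    and factor: "\<And>x. x \<in> Mor \<A> \<Longrightarrow> src \<A> x = tgt \<A> h \<Longrightarrow> x \<cdot> h = zmor \<A> (src \<A> h) (tgt \<A> x) \<Longrightarrow>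
      \<exists>u \<in> Hom \<A> (tgt \<A> e) (tgt \<A> x). u \<cdot> e = x"
  shows "is_cokernel \<A> e h"
  unfolding is_cokernel_def
proof (intro conjI ballI impI)
  show "e \<in> Mor \<A>" using assms(1) unfolding epic_def by blast
  fix x assume x: "x \<in> Mor \<A>" "src \<A> x = tgt \<A> h \<and> x \<cdot> h = zmor \<A> (src \<A> h) (tgt \<A> x)"
  then obtain u where u: "u \<in> Hom \<A> (tgt \<A> e) (tgt \<A> x)" "u \<cdot> e = x"
    using factor by blast
  show "\<exists>!u. u \<in> Hom \<A> (tgt \<A> e) (tgt \<A> x) \<and> u \<cdot> e = x"
  proof (rule ex1I[of _ u])
    fix v assume "v \<in> Hom \<A> (tgt \<A> e) (tgt \<A> x) \<and> v \<cdot> e = x"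
    then show "v = u" using epic_cancel[OF assms(1), of v u] u by simp
  qed (use u in simp)
qed fact+

text \<open>The universal property of a cokernel of \<open>h\<close> mentions \<open>h\<close> only through the morphisms that
  annihilate it from the left.\<close>

lemma is_cokernel_cong:
  assumes "is_cokernel \<A> e h" "h' \<in> Mor \<A>" "tgt \<A> h' = tgt \<A> h"
    and ann: "\<And>x. x \<in> Mor \<A> \<Longrightarrow> src \<A> x = tgt \<A> h \<Longrightarrow>
      x \<cdot> h = zmor \<A> (src \<A> h) (tgt \<A> x) \<longleftrightarrow> x \<cdot> h' = zmor \<A> (src \<A> h') (tgt \<A> x)"
  shows "is_cokernel \<A> e h'"
proof (rule is_cokernelI)
  note E = is_cokernel_typing[OF assms(1)]
  show "e \<cdot> h' = zmor \<A> (src \<A> h') (tgt \<A> e)" using ann E by blast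
  fix x assume x: "x \<in> Mor \<A>" "src \<A> x = tgt \<A> h'" "x \<cdot> h' = zmor \<A> (src \<A> h') (tgt \<A> x)"
  then obtain u where "u \<in> Mor \<A>" "src \<A> u = tgt \<A> e" "tgt \<A> u = tgt \<A> x" "u \<cdot> e = x"
    using is_cokernel_factor[OF assms(1), of x] ann[of x] assms(3) by auto
  then show "\<exists>u \<in> Hom \<A> (tgt \<A> e) (tgt \<A> x). u \<cdot> e = x" by auto
qed (use assms is_cokernel_epic is_cokernel_typing in auto)

lemma is_cokernel_cmp_epic_iff:
  assumes "epic q" "h \<in> Mor \<A>" "src \<A> h = tgt \<A> q"
  shows "is_cokernel \<A> e (h \<cdot> q) \<longleftrightarrow> is_cokernel \<A> e h"
proof -
  have M: "q \<in> Mor \<A>" using assms unfolding epic_def by blast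
  have ann: "x \<cdot> h \<cdot> q = zmor \<A> (src \<A> q) (tgt \<A> x) \<longleftrightarrow> x \<cdot> h = zmor \<A> (src \<A> h) (tgt \<A> x)"
    if "x \<in> Mor \<A>" "src \<A> x = tgt \<A> h" for x
    using epic_zero_iff[OF assms(1), of "x \<cdot> h"] that assms M by simp
  show ?thesis
    using is_cokernel_cong[of e h "h \<cdot> q"] is_cokernel_cong[of e "h \<cdot> q" h] ann M assms by auto
qed

text \<open>If \<open>e\<close> is a cokernel of \<open>h\<close>, then \<open>h\<close> factors through every kernel \<open>k\<close> of \<open>e\<close>, so annihilating
  \<open>k\<close> implies annihilating \<open>h\<close>. The next lemma is dual.\<close>

lemma strict_epic_cokernel_of_kernel:
  assumes "strict_epic \<A> e" "is_kernel \<A> k e"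
  shows "is_cokernel \<A> e k"
proof -
  obtain h where h: "is_cokernel \<A> e h" using assms unfolding strict_epic_def by blast
  note E = is_cokernel_typing[OF h] and K = is_kernel_typing[OF assms(2)]
  obtain v where v: "v \<in> Mor \<A>" "src \<A> v = src \<A> h" "tgt \<A> v = src \<A> k" "k \<cdot> v = h"
    using is_kernel_factor[OF assms(2), of h] E by auto
  show ?thesis
  proof (rule is_cokernelI)
    fix x assume x: "x \<in> Mor \<A>" "src \<A> x = tgt \<A> k" "x \<cdot> k = zmor \<A> (src \<A> k) (tgt \<A> x)"
    have "x \<cdot> h = zmor \<A> (src \<A> h) (tgt \<A> x)"
      using cmp_extend[OF x(3), of v] x v K by simp
    then obtain u where "u \<in> Mor \<A>" "src \<A> u = tgt \<A> e" "tgt \<A> u = tgt \<A> x" "u \<cdot> e = x"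
      using is_cokernel_factor[OF h, of x] x E K by auto
    then show "\<exists>u \<in> Hom \<A> (tgt \<A> e) (tgt \<A> x). u \<cdot> e = x" by auto
  qed (use is_cokernel_epic[OF h] K in auto)
qed

lemma strict_monic_kernel_of_cokernel:
  assumes "strict_monic \<A> m" "is_cokernel \<A> e m"
  shows "is_kernel \<A> m e"
proof -
  obtain h where h: "is_kernel \<A> m h" using assms unfolding strict_monic_def by blast
  note E = is_kernel_typing[OF h] and K = is_cokernel_typing[OF assms(2)]
  obtain v where v: "v \<in> Mor \<A>" "src \<A> v = tgt \<A> e" "tgt \<A> v = tgt \<A> h" "v \<cdot> e = h"
    using is_cokernel_factor[OF assms(2), of h] E by auto
  show ?thesis
  proof (rule is_kernelI)
    fix x assume x: "x \<in> Mor \<A>" "tgt \<A> x = src \<A> e" "e \<cdot> x = zmor \<A> (src \<A> x) (tgt \<A> e)"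
    have "h \<cdot> x = v \<cdot> e \<cdot> x" using x v K by (metis assoc)
    also have "\<dots> = zmor \<A> (src \<A> x) (tgt \<A> h)" using x v by simp
    finally obtain u where "u \<in> Mor \<A>" "src \<A> u = src \<A> x" "tgt \<A> u = src \<A> m" "m \<cdot> u = x"
      using is_kernel_factor[OF h, of x] x E K by auto
    then show "\<exists>u \<in> Hom \<A> (src \<A> x) (src \<A> m). m \<cdot> u = x" by auto
  qed (use is_kernel_monic[OF h] K in auto)
qed

text \<open>Dividing both \<open>N\<close> and \<open>P\<close> by the image of \<open>m\<close> gives a pushout: this brings the stability
  axiom for strict monomorphisms to bear on quotients.\<close>

lemma quotient_pushout:
  assumes e: "is_cokernel \<A> e m" and e': "is_cokernel \<A> e' (n \<cdot> m)"
    and n: "n \<in> Mor \<A>" "src \<A> n = tgt \<A> m"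
    and t: "t \<in> Mor \<A>" "src \<A> t = tgt \<A> e" "tgt \<A> t = tgt \<A> e'" "t \<cdot> e = e' \<cdot> n"
  shows "is_pushout \<A> t e' e n"
proof -
  note E = is_cokernel_typing[OF e] and E' = is_cokernel_typing[OF e']
  have ex: "\<exists>!u. u \<in> Hom \<A> (tgt \<A> t) (tgt \<A> x) \<and> u \<cdot> t = x \<and> u \<cdot> e' = y"
    if xy: "x \<in> Mor \<A>" "y \<in> Mor \<A>" "tgt \<A> x = tgt \<A> y" "src \<A> x = tgt \<A> e" "src \<A> y = tgt \<A> n"
      "x \<cdot> e = y \<cdot> n" for x y
  proof -
    have "y \<cdot> n \<cdot> m = zmor \<A> (src \<A> m) (tgt \<A> y)"
      using cmp_extend[OF xy(6)[symmetric], of m] xy(1-5) n E by simp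
    then obtain u where u: "u \<in> Mor \<A>" "src \<A> u = tgt \<A> e'" "tgt \<A> u = tgt \<A> y" "u \<cdot> e' = y"
      using is_cokernel_factor[OF e', of y] xy E n by auto
    have "(u \<cdot> t) \<cdot> e = x \<cdot> e"
      using cmp_extend[OF u(4)] xy u t E E' n by simp
    then have "u \<cdot> t = x"
      using epic_cancel[OF is_cokernel_epic[OF e], of "u \<cdot> t" x] u t xy E by simp
    show ?thesis
    proof (rule ex1I[of _ u])
      show "u \<in> Hom \<A> (tgt \<A> t) (tgt \<A> x) \<and> u \<cdot> t = x \<and> u \<cdot> e' = y"
        using u t xy \<open>u \<cdot> t = x\<close> by simp
      fix v assume "v \<in> Hom \<A> (tgt \<A> t) (tgt \<A> x) \<and> v \<cdot> t = x \<and> v \<cdot> e' = y"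
      then show "v = u"
        using epic_cancel[OF is_cokernel_epic[OF e'], of v u] u t xy by simp
    qed
  qed
  show ?thesis
    unfolding is_pushout_def using E E' n t ex by auto
qed

end

context additive_category
begin

text \<open>A morphism out of a direct sum enters the invariants only through its cokernel, that is, through
  the morphisms annihilating it; the structure maps of the biproduct stay inside this proof.\<close>

lemma copair_annihilator:
  assumes hk: "h \<in> Mor \<A>" "k \<in> Mor \<A>" "tgt \<A> k = tgt \<A> h"
  shows "copair \<A> h k \<in> Mor \<A>" "tgt \<A> (copair \<A> h k) = tgt \<A> h"
    "\<And>x. x \<in> Mor \<A> \<Longrightarrow> src \<A> x = tgt \<A> h \<Longrightarrow>
      x \<cdot> copair \<A> h k = zmor \<A> (src \<A> (copair \<A> h k)) (tgt \<A> x) \<longleftrightarrow>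
      x \<cdot> h = zmor \<A> (src \<A> h) (tgt \<A> x) \<and> x \<cdot> k = zmor \<A> (src \<A> k) (tgt \<A> x)"
proof -
  define X where "X = src \<A> h"
  define Y where "Y = src \<A> k"
  have XY: "X \<in> Obj \<A>" "Y \<in> Obj \<A>" unfolding X_def Y_def using hk by auto
  obtain i1 i2 p1 p2 where bip: "biproduct \<A> X Y = (i1, i2, p1, p2)"
    by (metis prod.exhaust)
  have "case biproduct \<A> X Y of (i1, i2, p1, p2) \<Rightarrow> is_biproduct \<A> X Y i1 i2 p1 p2"
    unfolding biproduct_def using biproduct_exists[OF XY] by (rule_tac someI_ex) auto
  then have "is_biproduct \<A> X Y i1 i2 p1 p2" unfolding bip by simp
  then obtain P where P: "P \<in> Obj \<A>" "i1 \<in> Hom \<A> X P" "i2 \<in> Hom \<A> Y P" "p1 \<in> Hom \<A> P X"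
    "p2 \<in> Hom \<A> P Y" "p1 \<cdot> i1 = ident \<A> X" "p2 \<cdot> i2 = ident \<A> Y"
    "p1 \<cdot> i2 = zmor \<A> Y X" "p2 \<cdot> i1 = zmor \<A> X Y"
    "madd \<A> (i1 \<cdot> p1) (i2 \<cdot> p2) = ident \<A> P"
    unfolding is_biproduct_def by blast
  have decompose: "x = madd \<A> (x \<cdot> i1 \<cdot> p1) (x \<cdot> i2 \<cdot> p2)" if "x \<in> Mor \<A>" "src \<A> x = P" for x
    using that P cmp_madd_right[of x P "tgt \<A> x" "i1 \<cdot> p1" P "i2 \<cdot> p2"] by simp
  define u where "u = madd \<A> (h \<cdot> p1) (k \<cdot> p2)"
  have u: "u \<in> Mor \<A>" "src \<A> u = P" "tgt \<A> u = tgt \<A> h"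
    unfolding u_def using P hk X_def Y_def by simp_all
  have ui: "u \<cdot> i1 = h" "u \<cdot> i2 = k"
    unfolding u_def using P hk X_def Y_def XY
      cmp_madd_left[of "h \<cdot> p1" P "tgt \<A> h" "k \<cdot> p2" i1 X]
      cmp_madd_left[of "h \<cdot> p1" P "tgt \<A> h" "k \<cdot> p2" i2 Y] by simp_all
  have copair: "copair \<A> h k = u"
    unfolding copair_def X_def[symmetric] Y_def[symmetric] bip prod.case
  proof (rule the_equality)
    show "u \<in> Hom \<A> (tgt \<A> i1) (tgt \<A> h) \<and> u \<cdot> i1 = h \<and> u \<cdot> i2 = k"
      using u ui P by simp
    fix v assume v: "v \<in> Hom \<A> (tgt \<A> i1) (tgt \<A> h) \<and> v \<cdot> i1 = h \<and> v \<cdot> i2 = k"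
    then have v1: "v \<cdot> i1 = h" and v2: "v \<cdot> i2 = k" by blast+
    show "v = u"
      using decompose[of v] cmp_extend[OF v1, of p1] cmp_extend[OF v2, of p2] v P
      unfolding u_def X_def Y_def by simp
  qed
  show "copair \<A> h k \<in> Mor \<A>" "tgt \<A> (copair \<A> h k) = tgt \<A> h"
    unfolding copair by (fact u)+
  fix x assume x: "x \<in> Mor \<A>" "src \<A> x = tgt \<A> h"
  show "x \<cdot> copair \<A> h k = zmor \<A> (src \<A> (copair \<A> h k)) (tgt \<A> x) \<longleftrightarrow>
      x \<cdot> h = zmor \<A> (src \<A> h) (tgt \<A> x) \<and> x \<cdot> k = zmor \<A> (src \<A> k) (tgt \<A> x)"
    unfolding copair
  proof
    assume z: "x \<cdot> u = zmor \<A> (src \<A> u) (tgt \<A> x)"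
    have "x \<cdot> u \<cdot> i1 = zmor \<A> X (tgt \<A> x)" "x \<cdot> u \<cdot> i2 = zmor \<A> Y (tgt \<A> x)"
      using cmp_extend[OF z, of i1] cmp_extend[OF z, of i2] x u P by simp_all
    then show "x \<cdot> h = zmor \<A> (src \<A> h) (tgt \<A> x) \<and> x \<cdot> k = zmor \<A> (src \<A> k) (tgt \<A> x)"
      unfolding ui X_def Y_def by simp
  next
    assume "x \<cdot> h = zmor \<A> (src \<A> h) (tgt \<A> x) \<and> x \<cdot> k = zmor \<A> (src \<A> k) (tgt \<A> x)"
    then have z: "(x \<cdot> u) \<cdot> i1 = zmor \<A> X (tgt \<A> x)" "(x \<cdot> u) \<cdot> i2 = zmor \<A> Y (tgt \<A> x)"
      unfolding X_def Y_def using x u P ui by simp_all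
    have "x \<cdot> u \<in> Mor \<A>" "src \<A> (x \<cdot> u) = P" "tgt \<A> (x \<cdot> u) = tgt \<A> x"
      using x u by simp_all
    then show "x \<cdot> u = zmor \<A> (src \<A> u) (tgt \<A> x)"
      using decompose[of "x \<cdot> u"] cmp_extend[OF z(1), of p1] cmp_extend[OF z(2), of p2] P x u XY
      by simp
  qed
qed

end

section \<open>Images and coimages in a quasi-abelian category\<close>

context quasi_abelian_category
begin

declare kerO_def [simp] cokerO_def [simp] imO_def [simp] coimO_def [simp]

lemma ker_is_kernel: "h \<in> Mor \<A> \<Longrightarrow> is_kernel \<A> (ker \<A> h) h"
  unfolding ker_def by (rule someI_ex) (rule kernel_exists)

lemma coker_is_cokernel: "h \<in> Mor \<A> \<Longrightarrow> is_cokernel \<A> (coker \<A> h) h"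
  unfolding coker_def by (rule someI_ex) (rule cokernel_exists)

lemma ker_typing [simp]:
  assumes "h \<in> Mor \<A>"
  shows "ker \<A> h \<in> Mor \<A>" "tgt \<A> (ker \<A> h) = src \<A> h"
    "h \<cdot> ker \<A> h = zmor \<A> (src \<A> (ker \<A> h)) (tgt \<A> h)"
  using is_kernel_typing[OF ker_is_kernel[OF assms]] by simp_all

lemma coker_typing [simp]:
  assumes "h \<in> Mor \<A>"
  shows "coker \<A> h \<in> Mor \<A>" "src \<A> (coker \<A> h) = tgt \<A> h"
    "coker \<A> h \<cdot> h = zmor \<A> (src \<A> h) (tgt \<A> (coker \<A> h))"
  using is_cokernel_typing[OF coker_is_cokernel[OF assms]] by simp_all

lemma im_is_kernel: "h \<in> Mor \<A> \<Longrightarrow> is_kernel \<A> (im \<A> h) (coker \<A> h)"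
  unfolding im_def by (simp add: ker_is_kernel)

lemma coim_is_cokernel: "h \<in> Mor \<A> \<Longrightarrow> is_cokernel \<A> (coim \<A> h) (ker \<A> h)"
  unfolding coim_def by (simp add: coker_is_cokernel)

lemma im_typing [simp]:
  assumes "h \<in> Mor \<A>"
  shows "im \<A> h \<in> Mor \<A>" "tgt \<A> (im \<A> h) = tgt \<A> h"
    "coker \<A> h \<cdot> im \<A> h = zmor \<A> (src \<A> (im \<A> h)) (tgt \<A> (coker \<A> h))"
  unfolding im_def using assms by simp_all

lemma coim_typing [simp]:
  assumes "h \<in> Mor \<A>"
  shows "coim \<A> h \<in> Mor \<A>" "src \<A> (coim \<A> h) = src \<A> h"
    "coim \<A> h \<cdot> ker \<A> h = zmor \<A> (src \<A> (ker \<A> h)) (tgt \<A> (coim \<A> h))"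
  unfolding coim_def using assms by simp_all

lemma ker_monic: "h \<in> Mor \<A> \<Longrightarrow> monic (ker \<A> h)"
  by (rule is_kernel_monic) (rule ker_is_kernel)

lemma coker_epic: "h \<in> Mor \<A> \<Longrightarrow> epic (coker \<A> h)"
  by (rule is_cokernel_epic) (rule coker_is_cokernel)

lemma im_monic: "h \<in> Mor \<A> \<Longrightarrow> monic (im \<A> h)"
  by (rule is_kernel_monic) (rule im_is_kernel)

lemma coim_epic: "h \<in> Mor \<A> \<Longrightarrow> epic (coim \<A> h)"
  by (rule is_cokernel_epic) (rule coim_is_cokernel)

text \<open>In \<open>(P/M) / (N/M) \<cong> P/N\<close>, the morphism \<open>t : N/M \<rightarrow> P/M\<close> is a pushout of \<open>n : N \<rightarrow> P\<close>, hence itself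
  a strict monomorphism; that \<open>l : P/M \<rightarrow> P/N\<close> is its cokernel is formal.\<close>

lemma third_isomorphism:
  assumes e: "is_cokernel \<A> e m" and e': "is_cokernel \<A> e' (n \<cdot> m)" and s: "is_cokernel \<A> s n"
    and n: "strict_monic \<A> n" "src \<A> n = tgt \<A> m"
    and t: "t \<in> Mor \<A>" "src \<A> t = tgt \<A> e" "tgt \<A> t = tgt \<A> e'" "t \<cdot> e = e' \<cdot> n"
    and l: "l \<in> Mor \<A>" "src \<A> l = tgt \<A> e'" "tgt \<A> l = tgt \<A> s" "l \<cdot> e' = s"
  shows "monic t" "is_cokernel \<A> l t"
proof -
  note E = is_cokernel_typing[OF e] and E' = is_cokernel_typing[OF e']
    and S = is_cokernel_typing[OF s]
  have "strict_monic \<A> t"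
    using quotient_pushout[OF e e' S(2) n(2) t] n(1) by (rule strict_monic_pushout)
  then show "monic t" unfolding strict_monic_def using is_kernel_monic by blast
  show "is_cokernel \<A> l t"
  proof (rule is_cokernelI)
    show "epic l"
    proof (rule epicI_zero)
      fix x assume x: "x \<in> Mor \<A>" "src \<A> x = tgt \<A> l" "x \<cdot> l = zmor \<A> (src \<A> l) (tgt \<A> x)"
      have "x \<cdot> s = zmor \<A> (src \<A> s) (tgt \<A> x)"
        using cmp_extend[OF x(3), of e'] x l E E' S n by simp
      then show "x = zmor \<A> (tgt \<A> l) (tgt \<A> x)"
        using epic_zero_iff[OF is_cokernel_epic[OF s], of x] x l by simp
    qed fact
    have "(l \<cdot> t) \<cdot> e = zmor \<A> (src \<A> e) (tgt \<A> (l \<cdot> t))"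
      using cmp_extend[OF l(4), of n] l t E E' S n by simp
    then show "l \<cdot> t = zmor \<A> (src \<A> t) (tgt \<A> l)"
      using epic_zero_iff[OF is_cokernel_epic[OF e], of "l \<cdot> t"] l t E by simp
    fix x assume x: "x \<in> Mor \<A>" "src \<A> x = tgt \<A> t" "x \<cdot> t = zmor \<A> (src \<A> t) (tgt \<A> x)"
    have "(x \<cdot> e') \<cdot> n = zmor \<A> (src \<A> n) (tgt \<A> (x \<cdot> e'))"
      using cmp_extend[OF x(3), of e] x t E E' S n by simp
    then obtain y where y: "y \<in> Mor \<A>" "src \<A> y = tgt \<A> s" "tgt \<A> y = tgt \<A> x" "y \<cdot> s = x \<cdot> e'"
      using is_cokernel_factor[OF s, of "x \<cdot> e'"] x t E E' n S by auto
    have "(y \<cdot> l) \<cdot> e' = x \<cdot> e'" using y l E' by simp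
    then have "y \<cdot> l = x"
      using epic_cancel[OF is_cokernel_epic[OF e'], of "y \<cdot> l" x] x y l t by simp
    then show "\<exists>u \<in> Hom \<A> (tgt \<A> l) (tgt \<A> x). u \<cdot> l = x"
      using y l by auto
  qed (use l t in simp_all)
qed

lemma strict_monic_cmp:
  assumes m: "strict_monic \<A> m" and k: "strict_monic \<A> k" and mk: "src \<A> m = tgt \<A> k"
  shows "strict_monic \<A> (m \<cdot> k)"
proof -
  have M: "m \<in> Mor \<A>" "k \<in> Mor \<A>"
    using strict_monic_in_Mor m k by simp_all
  define e where "e = coker \<A> k"
  define e' where "e' = coker \<A> (m \<cdot> k)"
  define s where "s = coker \<A> m"
  have e: "is_cokernel \<A> e k" and e': "is_cokernel \<A> e' (m \<cdot> k)" and s: "is_cokernel \<A> s m"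
    unfolding e_def e'_def s_def using M mk by (simp_all add: coker_is_cokernel)
  note E = is_cokernel_typing[OF e] and E' = is_cokernel_typing[OF e']
    and S = is_cokernel_typing[OF s]
  have km: "is_kernel \<A> m s" and kk: "is_kernel \<A> k e"
    using strict_monic_kernel_of_cokernel m k s e by blast+
  obtain t where t: "t \<in> Mor \<A>" "src \<A> t = tgt \<A> e" "tgt \<A> t = tgt \<A> e'" "t \<cdot> e = e' \<cdot> m"
    using is_cokernel_factor[OF e, of "e' \<cdot> m"] E' M mk by auto
  obtain l where l: "l \<in> Mor \<A>" "src \<A> l = tgt \<A> e'" "tgt \<A> l = tgt \<A> s" "l \<cdot> e' = s"
    using is_cokernel_factor[OF e', of s] S M mk cmp_extend[OF S(4), of k] by auto
  have "monic t" using third_isomorphism(1)[OF e e' s m mk t l] .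
  have "is_kernel \<A> (m \<cdot> k) e'"
  proof (rule is_kernelI)
    show "monic (m \<cdot> k)"
      using monic_cmp is_kernel_monic[OF km] is_kernel_monic[OF kk] mk by blast
    fix x assume x: "x \<in> Mor \<A>" "tgt \<A> x = src \<A> e'" "e' \<cdot> x = zmor \<A> (src \<A> x) (tgt \<A> e')"
    have "s \<cdot> x = zmor \<A> (src \<A> x) (tgt \<A> s)"
      using assoc[of l e' x] x l E' by simp
    then obtain y where y: "y \<in> Mor \<A>" "src \<A> y = src \<A> x" "tgt \<A> y = src \<A> m" "m \<cdot> y = x"
      using is_kernel_factor[OF km, of x] x S E' M mk by auto
    have "t \<cdot> (e \<cdot> y) = zmor \<A> (src \<A> x) (tgt \<A> t)"
      using cmp_extend[OF t(4), of y] x y t E E' M mk by simp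
    then have "e \<cdot> y = zmor \<A> (src \<A> y) (tgt \<A> e)"
      using monic_zero[OF \<open>monic t\<close>, of "e \<cdot> y"] y t E mk by simp
    then obtain z where "z \<in> Mor \<A>" "src \<A> z = src \<A> y" "tgt \<A> z = src \<A> k" "k \<cdot> z = y"
      using is_kernel_factor[OF kk, of y] y E mk by auto
    then show "\<exists>u \<in> Hom \<A> (src \<A> x) (src \<A> (m \<cdot> k)). (m \<cdot> k) \<cdot> u = x"
      using y M mk by (intro bexI[of _ z]) simp_all
  qed (use E' M mk in simp_all)
  then show ?thesis unfolding strict_monic_def by blast
qed

text \<open>If \<open>u\<close> annihilates the corestriction
  \<open>q\<close>, then \<open>h\<close> factors through the smaller subobject \<open>m \<cdot> ker u\<close>; as that is again strict, it
  contains the image, so \<open>ker u\<close> has a right inverse and \<open>u = 0\<close>.\<close>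

lemma image_corestriction_epic:
  assumes e: "is_cokernel \<A> e h" and m: "is_kernel \<A> m e"
    and q: "q \<in> Mor \<A>" "src \<A> m = tgt \<A> q" "m \<cdot> q = h"
  shows "epic q"
proof (rule epicI_zero)
  note E = is_cokernel_typing[OF e] and M = is_kernel_typing[OF m]
  fix u assume u: "u \<in> Mor \<A>" "src \<A> u = tgt \<A> q" "u \<cdot> q = zmor \<A> (src \<A> q) (tgt \<A> u)"
  define k where "k = ker \<A> u"
  have k: "k \<in> Mor \<A>" "tgt \<A> k = src \<A> u" "monic k" "u \<cdot> k = zmor \<A> (src \<A> k) (tgt \<A> u)"
    and "is_kernel \<A> k u"
    unfolding k_def using u by (simp_all add: ker_monic ker_is_kernel)
  obtain r where r: "r \<in> Mor \<A>" "src \<A> r = src \<A> q" "tgt \<A> r = src \<A> k" "k \<cdot> r = q"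
    using is_kernel_factor[OF \<open>is_kernel \<A> k u\<close>, of q] u q by auto
  have "strict_monic \<A> m" "strict_monic \<A> k"
    unfolding strict_monic_def using m \<open>is_kernel \<A> k u\<close> by blast+
  then have "strict_monic \<A> (m \<cdot> k)"
    by (rule strict_monic_cmp) (simp only: q k u)
  define d where "d = coker \<A> (m \<cdot> k)"
  have mk: "m \<cdot> k \<in> Mor \<A>" "src \<A> (m \<cdot> k) = src \<A> k" "tgt \<A> (m \<cdot> k) = tgt \<A> m"
    using M q u k by simp_all
  have d: "is_cokernel \<A> d (m \<cdot> k)" unfolding d_def using mk by (simp add: coker_is_cokernel)
  note D = is_cokernel_typing[OF d]
  have d': "is_kernel \<A> (m \<cdot> k) d"
    using strict_monic_kernel_of_cokernel \<open>strict_monic \<A> (m \<cdot> k)\<close> d by blast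
  have "(m \<cdot> k) \<cdot> r = m \<cdot> k \<cdot> r"
    by (rule assoc) (use M q u k r in simp_all)
  then have mkr: "(m \<cdot> k) \<cdot> r = h" using r(4) q(3) by simp
  have h: "src \<A> h = src \<A> r" "tgt \<A> h = tgt \<A> m"
    unfolding mkr[symmetric] using mk r by simp_all
  have "d \<cdot> (m \<cdot> k) \<cdot> r = zmor \<A> (src \<A> (m \<cdot> k)) (tgt \<A> d) \<cdot> r"
    by (rule cmp_extend[OF D(4)]) (use D(1,3) mk r in simp_all)
  then have "d \<cdot> h = zmor \<A> (src \<A> h) (tgt \<A> d)"
    unfolding mkr h using D(1) mk r by simp
  then obtain v where v: "v \<in> Mor \<A>" "src \<A> v = tgt \<A> e" "tgt \<A> v = tgt \<A> d" "v \<cdot> e = d"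
    using is_cokernel_factor[OF e, of d] D mk M E by auto
  have "d \<cdot> m = zmor \<A> (src \<A> m) (tgt \<A> d)"
    using assoc[of v e m] v M by simp
  then obtain w where w: "w \<in> Mor \<A>" "src \<A> w = src \<A> m" "tgt \<A> w = src \<A> k" "(m \<cdot> k) \<cdot> w = m"
    using is_kernel_factor[OF d', of m] M D mk by auto
  have "k \<cdot> w = ident \<A> (src \<A> m)"
    by (rule monic_cancel[OF is_kernel_monic[OF m]]) (use w M k q u in simp_all)
  then have "u = u \<cdot> k \<cdot> w" using u q M by simp
  also have "\<dots> = zmor \<A> (tgt \<A> q) (tgt \<A> u)"
    using cmp_extend[OF k(4), of w] u k w q by simp
  finally show "u = zmor \<A> (tgt \<A> q) (tgt \<A> u)" .
qed fact

lemma im_factor: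
  assumes "h \<in> Mor \<A>"
  obtains q where "q \<in> Mor \<A>" "src \<A> q = src \<A> h" "tgt \<A> q = src \<A> (im \<A> h)" "im \<A> h \<cdot> q = h" "epic q"
proof -
  obtain q where q: "q \<in> Mor \<A>" "src \<A> q = src \<A> h" "tgt \<A> q = src \<A> (im \<A> h)" "im \<A> h \<cdot> q = h"
    using is_kernel_factor[OF im_is_kernel[OF assms], of h] assms by auto
  moreover have "epic q"
    using image_corestriction_epic[OF coker_is_cokernel[OF assms] im_is_kernel[OF assms] q(1)] q by simp
  ultimately show ?thesis by (rule that)
qed

lemma im_cmp_factor:
  assumes "h \<in> Mor \<A>" "k \<in> Mor \<A>" "src \<A> h = tgt \<A> k"
  obtains u where "u \<in> Mor \<A>" "src \<A> u = src \<A> (im \<A> (h \<cdot> k))" "tgt \<A> u = src \<A> (im \<A> h)"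
    "im \<A> h \<cdot> u = im \<A> (h \<cdot> k)"
proof -
  have hk: "h \<cdot> k \<in> Mor \<A>" "tgt \<A> (h \<cdot> k) = tgt \<A> h" using assms by simp_all
  have "coker \<A> h \<cdot> h \<cdot> k = zmor \<A> (src \<A> k) (tgt \<A> (coker \<A> h))"
    using assms cmp_extend[OF coker_typing(3), of h k] by simp
  then obtain v where v: "v \<in> Mor \<A>" "src \<A> v = tgt \<A> (coker \<A> (h \<cdot> k))"
    "tgt \<A> v = tgt \<A> (coker \<A> h)" "v \<cdot> coker \<A> (h \<cdot> k) = coker \<A> h"
    using is_cokernel_factor[OF coker_is_cokernel[OF hk(1)], of "coker \<A> h"] assms hk by auto
  have "coker \<A> h \<cdot> im \<A> (h \<cdot> k) = zmor \<A> (src \<A> (im \<A> (h \<cdot> k))) (tgt \<A> (coker \<A> h))"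
    using assoc[of v "coker \<A> (h \<cdot> k)" "im \<A> (h \<cdot> k)"] v hk by simp
  then show ?thesis
    using is_kernel_factor[OF im_is_kernel[OF assms(1)], of "im \<A> (h \<cdot> k)"] hk assms that by auto
qed

lemma bar_decomposition:
  assumes "h \<in> Mor \<A>"
  shows "bar \<A> h \<in> Mor \<A>" "src \<A> (bar \<A> h) = tgt \<A> (coim \<A> h)"
    "tgt \<A> (bar \<A> h) = src \<A> (im \<A> h)" "im \<A> h \<cdot> bar \<A> h \<cdot> coim \<A> h = h"
proof -
  obtain q where q: "q \<in> Mor \<A>" "src \<A> q = src \<A> h" "tgt \<A> q = src \<A> (im \<A> h)" "im \<A> h \<cdot> q = h"
    using im_factor[OF assms] by blast
  have "im \<A> h \<cdot> (q \<cdot> ker \<A> h) = zmor \<A> (src \<A> (ker \<A> h)) (tgt \<A> h)"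
    using cmp_extend[OF q(4), of "ker \<A> h"] q assms by simp
  then have "q \<cdot> ker \<A> h = zmor \<A> (src \<A> (ker \<A> h)) (tgt \<A> q)"
    using monic_zero[OF im_monic[OF assms], of "q \<cdot> ker \<A> h"] q assms by simp
  then obtain z where z: "z \<in> Mor \<A>" "src \<A> z = tgt \<A> (coim \<A> h)" "tgt \<A> z = tgt \<A> q"
    "z \<cdot> coim \<A> h = q"
    using is_cokernel_factor[OF coim_is_cokernel[OF assms], of q] q assms by auto
  have "bar \<A> h = z"
    unfolding bar_def
  proof (rule the_equality)
    fix y assume y: "y \<in> Hom \<A> (coimO \<A> h) (imO \<A> h) \<and> im \<A> h \<cdot> y \<cdot> coim \<A> h = h"
    have "y \<cdot> coim \<A> h = q"
      by (rule monic_cancel[OF im_monic[OF assms]]) (use y q assms in simp_all)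
    then show "y = z"
      using epic_cancel[OF coim_epic[OF assms], of y z] y z q assms by simp
  qed (use z q in simp)
  then show "bar \<A> h \<in> Mor \<A>" "src \<A> (bar \<A> h) = tgt \<A> (coim \<A> h)"
    "tgt \<A> (bar \<A> h) = src \<A> (im \<A> h)" "im \<A> h \<cdot> bar \<A> h \<cdot> coim \<A> h = h"
    using z q by simp_all
qed

lemma strict_monic_bar_iso:
  assumes "strict_monic \<A> h"
  shows "is_iso \<A> (coim \<A> h)" "is_iso \<A> (bar \<A> h)"
proof -
  have h: "h \<in> Mor \<A>"
    using strict_monic_in_Mor assms .
  have K: "is_kernel \<A> h (coker \<A> h)"
    using strict_monic_kernel_of_cokernel[OF assms coker_is_cokernel[OF h]] .
  have "monic h" using is_kernel_monic[OF K] .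
  have "ker \<A> h = zmor \<A> (src \<A> (ker \<A> h)) (src \<A> h)"
    using monic_zero[OF \<open>monic h\<close>, of "ker \<A> h"] h by simp
  then have "ident \<A> (src \<A> h) \<cdot> ker \<A> h = zmor \<A> (src \<A> (ker \<A> h)) (src \<A> h)"
    using h by simp
  then obtain v where v: "v \<in> Mor \<A>" "src \<A> v = tgt \<A> (coim \<A> h)" "tgt \<A> v = src \<A> h"
    "v \<cdot> coim \<A> h = ident \<A> (src \<A> h)"
    using is_cokernel_factor[OF coim_is_cokernel[OF h], of "ident \<A> (src \<A> h)"] h by auto
  have "is_iso \<A> (ident \<A> (src \<A> h))"
    using is_isoI[of "ident \<A> (src \<A> h)" "ident \<A> (src \<A> h)"] h by simp
  then show ci: "is_iso \<A> (coim \<A> h)"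
    using mutual_cofactor_iso[OF iso_epic coim_epic[OF h], of "ident \<A> (src \<A> h)" "coim \<A> h" v] v h
    by simp
  note B = bar_decomposition[OF h] and I = inv_mor_inverse[OF ci]
  have "coker \<A> h \<cdot> im \<A> h = zmor \<A> (src \<A> (im \<A> h)) (tgt \<A> (coker \<A> h))"
    using h by simp
  then obtain w where w: "w \<in> Mor \<A>" "src \<A> w = src \<A> (im \<A> h)" "tgt \<A> w = src \<A> h" "h \<cdot> w = im \<A> h"
    using is_kernel_factor[OF K, of "im \<A> h"] h by auto
  have "is_iso \<A> (bar \<A> h \<cdot> coim \<A> h)"
    using mutual_factor_iso[OF im_monic[OF h] \<open>monic h\<close>, of "bar \<A> h \<cdot> coim \<A> h" w] B w h by simp
  then have "is_iso \<A> ((bar \<A> h \<cdot> coim \<A> h) \<cdot> inv_mor \<A> (coim \<A> h))"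
    by (rule iso_cmp) (use iso_inv_mor ci I B h in simp_all)
  then show "is_iso \<A> (bar \<A> h)" using I B h by simp
qed

lemma strict_epic_bar_iso:
  assumes "strict_epic \<A> h"
  shows "is_iso \<A> (im \<A> h)" "is_iso \<A> (bar \<A> h)"
proof -
  have h: "h \<in> Mor \<A>"
    using strict_epic_in_Mor assms .
  have K: "is_cokernel \<A> h (ker \<A> h)"
    using strict_epic_cokernel_of_kernel[OF assms ker_is_kernel[OF h]] .
  have "epic h" using is_cokernel_epic[OF K] .
  have "coker \<A> h = zmor \<A> (tgt \<A> h) (tgt \<A> (coker \<A> h))"
    using epic_zero_iff[OF \<open>epic h\<close>, of "coker \<A> h"] h by simp
  then have "coker \<A> h \<cdot> ident \<A> (tgt \<A> h) = zmor \<A> (tgt \<A> h) (tgt \<A> (coker \<A> h))"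
    using h by simp
  then obtain v where v: "v \<in> Mor \<A>" "src \<A> v = tgt \<A> h" "tgt \<A> v = src \<A> (im \<A> h)"
    "im \<A> h \<cdot> v = ident \<A> (tgt \<A> h)"
    using is_kernel_factor[OF im_is_kernel[OF h], of "ident \<A> (tgt \<A> h)"] h by auto
  show ii: "is_iso \<A> (im \<A> h)"
    using monic_split_epic_iso[OF im_monic[OF h], of v] v h by simp
  note B = bar_decomposition[OF h] and I = inv_mor_inverse[OF ii]
  have "coim \<A> h \<cdot> ker \<A> h = zmor \<A> (src \<A> (ker \<A> h)) (tgt \<A> (coim \<A> h))"
    using h by simp
  then obtain w where w: "w \<in> Mor \<A>" "src \<A> w = tgt \<A> h" "tgt \<A> w = tgt \<A> (coim \<A> h)"
    "w \<cdot> h = coim \<A> h"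
    using is_cokernel_factor[OF K, of "coim \<A> h"] h by auto
  have "is_iso \<A> (im \<A> h \<cdot> bar \<A> h)"
    using mutual_cofactor_iso[OF coim_epic[OF h] \<open>epic h\<close>, of "im \<A> h \<cdot> bar \<A> h" w] B w h by simp
  then have "is_iso \<A> (inv_mor \<A> (im \<A> h) \<cdot> (im \<A> h \<cdot> bar \<A> h))"
    by (intro iso_cmp[OF iso_inv_mor[OF ii]]) (use I B h in simp_all)
  then show "is_iso \<A> (bar \<A> h)" using I B h cmp_extend[OF I(4), of "bar \<A> h"] by simp
qed

section \<open>The invariants of a commutative square\<close>

text \<open>Along a kernel \<open>k\<close> of \<open>d\<close>, the pullback of \<open>h\<close> is \<open>ker (d \<cdot> h)\<close>; the pushout is dual.\<close>

lemma pullback_of_strict_monic_exists: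
  assumes "h \<in> Mor \<A>" "is_kernel \<A> k d" "tgt \<A> h = tgt \<A> k"
  shows "\<exists>p q. is_pullback \<A> p q h k"
proof -
  note K = is_kernel_typing[OF assms(2)]
  define p where "p = ker \<A> (d \<cdot> h)"
  have dh: "d \<cdot> h \<in> Mor \<A>" using assms K by simp
  have p: "p \<in> Mor \<A>" "tgt \<A> p = src \<A> h" and P: "is_kernel \<A> p (d \<cdot> h)"
    unfolding p_def using assms K dh by (simp_all add: ker_is_kernel)
  have "d \<cdot> (h \<cdot> p) = zmor \<A> (src \<A> p) (tgt \<A> d)"
    using is_kernel_typing(4)[OF P] p K assms by simp
  then obtain q where q: "q \<in> Mor \<A>" "src \<A> q = src \<A> p" "tgt \<A> q = src \<A> k" "k \<cdot> q = h \<cdot> p"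
    using is_kernel_factor[OF assms(2), of "h \<cdot> p"] p K assms by auto
  have "\<exists>!u. u \<in> Hom \<A> (src \<A> x) (src \<A> p) \<and> p \<cdot> u = x \<and> q \<cdot> u = y"
    if xy: "x \<in> Mor \<A>" "y \<in> Mor \<A>" "src \<A> x = src \<A> y" "tgt \<A> x = src \<A> h" "tgt \<A> y = src \<A> k"
      "h \<cdot> x = k \<cdot> y" for x y
  proof -
    have "(d \<cdot> h) \<cdot> x = zmor \<A> (src \<A> x) (tgt \<A> (d \<cdot> h))"
      using xy assms K cmp_extend[OF K(4), of y] by simp
    then obtain u where u: "u \<in> Mor \<A>" "src \<A> u = src \<A> x" "tgt \<A> u = src \<A> p" "p \<cdot> u = x"
      using is_kernel_factor[OF P, of x] xy assms K by auto
    have "k \<cdot> q \<cdot> u = k \<cdot> y"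
      using cmp_extend[OF q(4), of u] u p q xy assms K by simp
    then have "q \<cdot> u = y"
      using monic_cancel[OF is_kernel_monic[OF assms(2)], of "q \<cdot> u" y] u q xy by simp
    show ?thesis
    proof (rule ex1I[of _ u])
      show "u \<in> Hom \<A> (src \<A> x) (src \<A> p) \<and> p \<cdot> u = x \<and> q \<cdot> u = y"
        using u \<open>q \<cdot> u = y\<close> by simp
      fix v assume "v \<in> Hom \<A> (src \<A> x) (src \<A> p) \<and> p \<cdot> v = x \<and> q \<cdot> v = y"
      then show "v = u" using monic_cancel[OF is_kernel_monic[OF P], of v u] u by simp
    qed
  qed
  then show ?thesis
    unfolding is_pullback_def using p q assms K
    by (intro exI[of _ p] exI[of _ q]) simp
qed

lemma pushout_of_strict_epic_exists:
  assumes "h \<in> Mor \<A>" "is_cokernel \<A> k d" "src \<A> h = src \<A> k"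
  shows "\<exists>i j. is_pushout \<A> i j k h"
proof -
  note K = is_cokernel_typing[OF assms(2)]
  define j where "j = coker \<A> (h \<cdot> d)"
  have hd: "h \<cdot> d \<in> Mor \<A>" using assms K by simp
  have j: "j \<in> Mor \<A>" "src \<A> j = tgt \<A> h" and J: "is_cokernel \<A> j (h \<cdot> d)"
    unfolding j_def using assms K hd by (simp_all add: coker_is_cokernel)
  have "(j \<cdot> h) \<cdot> d = zmor \<A> (src \<A> d) (tgt \<A> (j \<cdot> h))"
    using is_cokernel_typing(4)[OF J] j K assms by simp
  then obtain i where i: "i \<in> Mor \<A>" "src \<A> i = tgt \<A> k" "tgt \<A> i = tgt \<A> j" "i \<cdot> k = j \<cdot> h"
    using is_cokernel_factor[OF assms(2), of "j \<cdot> h"] j K assms by auto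
  have "\<exists>!u. u \<in> Hom \<A> (tgt \<A> i) (tgt \<A> x) \<and> u \<cdot> i = x \<and> u \<cdot> j = y"
    if xy: "x \<in> Mor \<A>" "y \<in> Mor \<A>" "tgt \<A> x = tgt \<A> y" "src \<A> x = tgt \<A> k" "src \<A> y = tgt \<A> h"
      "x \<cdot> k = y \<cdot> h" for x y
  proof -
    have "y \<cdot> h \<cdot> d = zmor \<A> (src \<A> d) (tgt \<A> y)"
      using xy(1-5) assms K cmp_extend[OF xy(6)[symmetric], of d] by simp
    then obtain u where u: "u \<in> Mor \<A>" "src \<A> u = tgt \<A> j" "tgt \<A> u = tgt \<A> y" "u \<cdot> j = y"
      using is_cokernel_factor[OF J, of y] xy assms K by auto
    have "(u \<cdot> i) \<cdot> k = x \<cdot> k"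
      using cmp_extend[OF u(4), of h] u j i xy assms K by simp
    then have "u \<cdot> i = x"
      using epic_cancel[OF is_cokernel_epic[OF assms(2)], of "u \<cdot> i" x] u i xy by simp
    show ?thesis
    proof (rule ex1I[of _ u])
      show "u \<in> Hom \<A> (tgt \<A> i) (tgt \<A> x) \<and> u \<cdot> i = x \<and> u \<cdot> j = y"
        using u i xy \<open>u \<cdot> i = x\<close> by simp
      fix v assume "v \<in> Hom \<A> (tgt \<A> i) (tgt \<A> x) \<and> v \<cdot> i = x \<and> v \<cdot> j = y"
      then show "v = u" using epic_cancel[OF is_cokernel_epic[OF J], of v u] u i xy by simp
    qed
  qed
  then show ?thesis
    unfolding is_pushout_def using j i assms K
    by (intro exI[of _ i] exI[of _ j]) simp
qed

definition commutes where
  "commutes S \<longleftrightarrow> sq_top S \<in> Mor \<A> \<and> sq_left S \<in> Mor \<A> \<and> sq_bottom S \<in> Mor \<A> \<and> sq_right S \<in> Mor \<A> \<and>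
     src \<A> (sq_top S) = src \<A> (sq_left S) \<and> tgt \<A> (sq_top S) = src \<A> (sq_right S) \<and>
     src \<A> (sq_bottom S) = tgt \<A> (sq_left S) \<and> tgt \<A> (sq_bottom S) = tgt \<A> (sq_right S) \<and>
     sq_bottom S \<cdot> sq_left S = sq_right S \<cdot> sq_top S"

lemma commutes_typing:
  assumes "commutes S"
  shows "sq_top S \<in> Mor \<A>" "sq_left S \<in> Mor \<A>" "sq_bottom S \<in> Mor \<A>" "sq_right S \<in> Mor \<A>"
    "src \<A> (sq_top S) = src \<A> (sq_left S)" "tgt \<A> (sq_top S) = src \<A> (sq_right S)"
    "src \<A> (sq_bottom S) = tgt \<A> (sq_left S)" "tgt \<A> (sq_bottom S) = tgt \<A> (sq_right S)"
    "sq_bottom S \<cdot> sq_left S = sq_right S \<cdot> sq_top S"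
    "sq_diag \<A> S \<in> Mor \<A>" "src \<A> (sq_diag \<A> S) = src \<A> (sq_left S)"
    "tgt \<A> (sq_diag \<A> S) = tgt \<A> (sq_right S)"
  using assms unfolding commutes_def sq_diag_def by simp_all

lemma sq_intersection:
  assumes "commutes S"
  shows "is_pullback \<A> (sq_k \<A> S) (sq_l \<A> S) (im \<A> (sq_right S)) (im \<A> (sq_bottom S))"
proof -
  note S = commutes_typing[OF assms]
  have "\<exists>pq. case pq of (p, q) \<Rightarrow> is_pullback \<A> p q (im \<A> (sq_right S)) (im \<A> (sq_bottom S))"
    using pullback_of_strict_monic_exists[OF _ im_is_kernel[OF S(3)], of "im \<A> (sq_right S)"] S by simp
  then have "case pullback \<A> (im \<A> (sq_right S)) (im \<A> (sq_bottom S)) of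
      (p, q) \<Rightarrow> is_pullback \<A> p q (im \<A> (sq_right S)) (im \<A> (sq_bottom S))"
    unfolding pullback_def by (rule someI_ex)
  then show ?thesis unfolding sq_k_def sq_l_def by (simp add: case_prod_beta)
qed

lemma sq_intersection_typing:
  assumes "commutes S"
  shows "sq_k \<A> S \<in> Mor \<A>" "src \<A> (sq_k \<A> S) = sq_I \<A> S" "tgt \<A> (sq_k \<A> S) = src \<A> (im \<A> (sq_right S))"
    "sq_l \<A> S \<in> Mor \<A>" "src \<A> (sq_l \<A> S) = sq_I \<A> S" "tgt \<A> (sq_l \<A> S) = src \<A> (im \<A> (sq_bottom S))"
    "im \<A> (sq_bottom S) \<cdot> sq_l \<A> S = im \<A> (sq_right S) \<cdot> sq_k \<A> S"
  using sq_intersection[OF assms] unfolding is_pullback_def sq_I_def by simp_all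

lemma sq_intersection_factor:
  assumes "commutes S" and "x \<in> Mor \<A>" "y \<in> Mor \<A>" "src \<A> x = src \<A> y"
    "tgt \<A> x = src \<A> (im \<A> (sq_right S))" "tgt \<A> y = src \<A> (im \<A> (sq_bottom S))"
    "im \<A> (sq_right S) \<cdot> x = im \<A> (sq_bottom S) \<cdot> y"
  obtains u where "u \<in> Mor \<A>" "src \<A> u = src \<A> x" "tgt \<A> u = sq_I \<A> S"
    "sq_k \<A> S \<cdot> u = x" "sq_l \<A> S \<cdot> u = y"
proof -
  have "\<exists>!u. u \<in> Hom \<A> (src \<A> x) (src \<A> (sq_k \<A> S)) \<and> sq_k \<A> S \<cdot> u = x \<and> sq_l \<A> S \<cdot> u = y"
    using sq_intersection[OF assms(1)] assms(2-) unfolding is_pullback_def by blast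
  then show ?thesis using that unfolding sq_I_def by auto
qed

text \<open>The intersection \<open>sq_I S\<close> embeds into the codomain of the square, so morphisms into it can
  be compared there.\<close>

lemma sq_intersection_monic:
  assumes "commutes S"
  shows "monic (im \<A> (sq_right S) \<cdot> sq_k \<A> S)"
proof -
  note S = commutes_typing[OF assms] and K = sq_intersection_typing[OF assms]
  have univ: "\<exists>!u. u \<in> Hom \<A> (src \<A> x) (sq_I \<A> S) \<and> sq_k \<A> S \<cdot> u = x \<and> sq_l \<A> S \<cdot> u = y"
    if "x \<in> Mor \<A>" "y \<in> Mor \<A>" "src \<A> x = src \<A> y" "tgt \<A> x = src \<A> (im \<A> (sq_right S))"
      "tgt \<A> y = src \<A> (im \<A> (sq_bottom S))" "im \<A> (sq_right S) \<cdot> x = im \<A> (sq_bottom S) \<cdot> y" for x y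
    using sq_intersection[OF assms] that unfolding is_pullback_def sq_I_def by blast
  have "x = y" if xy: "x \<in> Mor \<A>" "y \<in> Mor \<A>" "src \<A> x = src \<A> y" "tgt \<A> x = sq_I \<A> S" "tgt \<A> y = sq_I \<A> S"
    and eq: "sq_k \<A> S \<cdot> x = sq_k \<A> S \<cdot> y" for x y
  proof -
    have "im \<A> (sq_bottom S) \<cdot> sq_l \<A> S \<cdot> x = im \<A> (sq_bottom S) \<cdot> sq_l \<A> S \<cdot> y"
      using cmp_extend[OF K(7), of x] cmp_extend[OF K(7), of y] S K xy eq by simp
    then have l: "sq_l \<A> S \<cdot> x = sq_l \<A> S \<cdot> y"
      using monic_cancel[OF im_monic[OF S(3)], of "sq_l \<A> S \<cdot> x" "sq_l \<A> S \<cdot> y"] S K xy by simp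
    have "im \<A> (sq_right S) \<cdot> sq_k \<A> S \<cdot> x = im \<A> (sq_bottom S) \<cdot> sq_l \<A> S \<cdot> x"
      using cmp_extend[OF K(7), of x] S K xy by simp
    then have "\<exists>!u. u \<in> Hom \<A> (src \<A> (sq_k \<A> S \<cdot> x)) (sq_I \<A> S) \<and>
        sq_k \<A> S \<cdot> u = sq_k \<A> S \<cdot> x \<and> sq_l \<A> S \<cdot> u = sq_l \<A> S \<cdot> x"
      by (intro univ) (use S K xy in simp_all)
    moreover have "x \<in> Hom \<A> (src \<A> (sq_k \<A> S \<cdot> x)) (sq_I \<A> S)"
      "y \<in> Hom \<A> (src \<A> (sq_k \<A> S \<cdot> x)) (sq_I \<A> S)"
      using K xy by simp_all
    ultimately show ?thesis using eq l by metis
  qed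
  then have "monic (sq_k \<A> S)" unfolding monic_def using K by auto
  then show ?thesis using monic_cmp[OF im_monic] S K by simp
qed

lemma sq_rho_characterization:
  assumes "commutes S"
  shows "sq_rho \<A> S \<in> Mor \<A>" "src \<A> (sq_rho \<A> S) = src \<A> (im \<A> (sq_diag \<A> S))"
    "tgt \<A> (sq_rho \<A> S) = sq_I \<A> S"
    "im \<A> (sq_right S) \<cdot> sq_k \<A> S \<cdot> sq_rho \<A> S = im \<A> (sq_diag \<A> S)"
proof -
  note S = commutes_typing[OF assms] and K = sq_intersection_typing[OF assms]
  obtain x where x: "x \<in> Mor \<A>" "src \<A> x = src \<A> (im \<A> (sq_diag \<A> S))"
    "tgt \<A> x = src \<A> (im \<A> (sq_right S))" "im \<A> (sq_right S) \<cdot> x = im \<A> (sq_diag \<A> S)"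
    using im_cmp_factor[of "sq_right S" "sq_top S"] S unfolding sq_diag_def by auto
  obtain y where y: "y \<in> Mor \<A>" "src \<A> y = src \<A> (im \<A> (sq_diag \<A> S))"
    "tgt \<A> y = src \<A> (im \<A> (sq_bottom S))" "im \<A> (sq_bottom S) \<cdot> y = im \<A> (sq_diag \<A> S)"
    using im_cmp_factor[of "sq_bottom S" "sq_left S"] S unfolding sq_diag_def by auto
  have lifts: "lift \<A> (im \<A> (sq_right S)) (im \<A> (sq_diag \<A> S)) = x"
    "lift \<A> (im \<A> (sq_bottom S)) (im \<A> (sq_diag \<A> S)) = y"
    using lift_eq im_monic S x y by simp_all
  obtain u where u: "u \<in> Mor \<A>" "src \<A> u = src \<A> x" "tgt \<A> u = sq_I \<A> S"
    "sq_k \<A> S \<cdot> u = x" "sq_l \<A> S \<cdot> u = y"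
    using sq_intersection_factor[OF assms x(1) y(1)] x y by auto
  have "sq_rho \<A> S = u"
    unfolding sq_rho_def lifts
  proof (rule the_equality)
    fix v assume v: "v \<in> Hom \<A> (imO \<A> (sq_diag \<A> S)) (sq_I \<A> S) \<and> sq_k \<A> S \<cdot> v = x \<and> sq_l \<A> S \<cdot> v = y"
    then show "v = u"
      using monic_cancel[OF sq_intersection_monic[OF assms], of v u] u x S K by simp
  qed (use u x in simp)
  then show "sq_rho \<A> S \<in> Mor \<A>" "src \<A> (sq_rho \<A> S) = src \<A> (im \<A> (sq_diag \<A> S))"
    "tgt \<A> (sq_rho \<A> S) = sq_I \<A> S"
    "im \<A> (sq_right S) \<cdot> sq_k \<A> S \<cdot> sq_rho \<A> S = im \<A> (sq_diag \<A> S)"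
    using u x by simp_all
qed

lemma sq_pushout:
  assumes "commutes S"
  shows "is_pushout \<A> (sq_i \<A> S) (sq_j \<A> S) (coim \<A> (sq_left S)) (coim \<A> (sq_top S))"
proof -
  note S = commutes_typing[OF assms]
  have "\<exists>ij. case ij of (i, j) \<Rightarrow> is_pushout \<A> i j (coim \<A> (sq_left S)) (coim \<A> (sq_top S))"
    using pushout_of_strict_epic_exists[OF _ coim_is_cokernel[OF S(2)], of "coim \<A> (sq_top S)"] S by simp
  then have "case pushout \<A> (coim \<A> (sq_left S)) (coim \<A> (sq_top S)) of
      (i, j) \<Rightarrow> is_pushout \<A> i j (coim \<A> (sq_left S)) (coim \<A> (sq_top S))"
    unfolding pushout_def by (rule someI_ex)
  then show ?thesis unfolding sq_i_def sq_j_def by (simp add: case_prod_beta)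
qed

lemma sq_pushout_typing:
  assumes "commutes S"
  shows "sq_i \<A> S \<in> Mor \<A>" "src \<A> (sq_i \<A> S) = tgt \<A> (coim \<A> (sq_left S))" "tgt \<A> (sq_i \<A> S) = sq_J \<A> S"
    "sq_j \<A> S \<in> Mor \<A>" "src \<A> (sq_j \<A> S) = tgt \<A> (coim \<A> (sq_top S))" "tgt \<A> (sq_j \<A> S) = sq_J \<A> S"
    "sq_i \<A> S \<cdot> coim \<A> (sq_left S) = sq_j \<A> S \<cdot> coim \<A> (sq_top S)"
  using sq_pushout[OF assms] unfolding is_pushout_def sq_J_def by simp_all

text \<open>The composite from the initial corner to the pushout \<open>sq_J S\<close> of the two coimages is the
  quotient by the sum of the kernels of \<open>left\<close> and \<open>top\<close>: a morphism factors through it iff it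
  annihilates both kernels, and then the factor is unique.\<close>

lemma sq_pushout_quotient:
  assumes "commutes S"
  shows "epic (sq_j \<A> S \<cdot> coim \<A> (sq_top S))"
    "sq_j \<A> S \<cdot> coim \<A> (sq_top S) \<cdot> ker \<A> (sq_left S) = zmor \<A> (src \<A> (ker \<A> (sq_left S))) (sq_J \<A> S)"
    "sq_j \<A> S \<cdot> coim \<A> (sq_top S) \<cdot> ker \<A> (sq_top S) = zmor \<A> (src \<A> (ker \<A> (sq_top S))) (sq_J \<A> S)"
    "\<And>x. \<lbrakk>x \<in> Mor \<A>; src \<A> x = src \<A> (sq_left S);
      x \<cdot> ker \<A> (sq_left S) = zmor \<A> (src \<A> (ker \<A> (sq_left S))) (tgt \<A> x);
      x \<cdot> ker \<A> (sq_top S) = zmor \<A> (src \<A> (ker \<A> (sq_top S))) (tgt \<A> x)\<rbrakk> \<Longrightarrow>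
      \<exists>u \<in> Hom \<A> (sq_J \<A> S) (tgt \<A> x). u \<cdot> sq_j \<A> S \<cdot> coim \<A> (sq_top S) = x"
proof -
  note S = commutes_typing[OF assms] and J = sq_pushout_typing[OF assms]
  let ?i = "sq_i \<A> S" and ?j = "sq_j \<A> S" and ?g = "coim \<A> (sq_top S)" and ?b = "coim \<A> (sq_left S)"
  have univ: "\<exists>!u. u \<in> Hom \<A> (sq_J \<A> S) (tgt \<A> x) \<and> u \<cdot> ?i = x \<and> u \<cdot> ?j = y"
    if "x \<in> Mor \<A>" "y \<in> Mor \<A>" "tgt \<A> x = tgt \<A> y" "src \<A> x = tgt \<A> ?b" "src \<A> y = tgt \<A> ?g"
      "x \<cdot> ?b = y \<cdot> ?g" for x y
    using sq_pushout[OF assms] that unfolding is_pushout_def sq_J_def by blast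
  show "?j \<cdot> ?g \<cdot> ker \<A> (sq_left S) = zmor \<A> (src \<A> (ker \<A> (sq_left S))) (sq_J \<A> S)"
    using cmp_extend[OF J(7)[symmetric], of "ker \<A> (sq_left S)"] S J(1-6) by simp
  show "?j \<cdot> ?g \<cdot> ker \<A> (sq_top S) = zmor \<A> (src \<A> (ker \<A> (sq_top S))) (sq_J \<A> S)"
    using S J by simp
  have "x = y" if xy: "x \<in> Mor \<A>" "y \<in> Mor \<A>" "tgt \<A> x = tgt \<A> y" "src \<A> x = sq_J \<A> S"
    "src \<A> y = sq_J \<A> S" "x \<cdot> ?j \<cdot> ?g = y \<cdot> ?j \<cdot> ?g" for x y
  proof -
    have j: "x \<cdot> ?j = y \<cdot> ?j"
      using epic_cancel[OF coim_epic[OF S(1)], of "x \<cdot> ?j" "y \<cdot> ?j"] S J xy by simp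
    have "(x \<cdot> ?i) \<cdot> ?b = (y \<cdot> ?i) \<cdot> ?b"
      using S J xy by simp
    then have i: "x \<cdot> ?i = y \<cdot> ?i"
      using epic_cancel[OF coim_epic[OF S(2)], of "x \<cdot> ?i" "y \<cdot> ?i"] S J xy(1-5) by simp
    have "\<exists>!u. u \<in> Hom \<A> (sq_J \<A> S) (tgt \<A> (x \<cdot> ?i)) \<and> u \<cdot> ?i = x \<cdot> ?i \<and> u \<cdot> ?j = x \<cdot> ?j"
      by (rule univ) (use S J xy in simp_all)
    moreover have "x \<in> Hom \<A> (sq_J \<A> S) (tgt \<A> (x \<cdot> ?i))" "y \<in> Hom \<A> (sq_J \<A> S) (tgt \<A> (x \<cdot> ?i))"
      using S J xy(1-5) by simp_all
    ultimately show ?thesis using i j by metis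
  qed
  then show "epic (?j \<cdot> ?g)" unfolding epic_def using S J by auto
  fix x assume x: "x \<in> Mor \<A>" "src \<A> x = src \<A> (sq_left S)"
    "x \<cdot> ker \<A> (sq_left S) = zmor \<A> (src \<A> (ker \<A> (sq_left S))) (tgt \<A> x)"
    "x \<cdot> ker \<A> (sq_top S) = zmor \<A> (src \<A> (ker \<A> (sq_top S))) (tgt \<A> x)"
  obtain y where y: "y \<in> Mor \<A>" "src \<A> y = tgt \<A> ?b" "tgt \<A> y = tgt \<A> x" "y \<cdot> ?b = x"
    using is_cokernel_factor[OF coim_is_cokernel[OF S(2)], of x] S x by auto
  obtain z where z: "z \<in> Mor \<A>" "src \<A> z = tgt \<A> ?g" "tgt \<A> z = tgt \<A> x" "z \<cdot> ?g = x"
    using is_cokernel_factor[OF coim_is_cokernel[OF S(1)], of x] S x by auto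
  obtain u where "u \<in> Hom \<A> (sq_J \<A> S) (tgt \<A> y)" "u \<cdot> ?j = z"
    using univ[of y z] y z by auto
  then show "\<exists>u \<in> Hom \<A> (sq_J \<A> S) (tgt \<A> x). u \<cdot> ?j \<cdot> ?g = x"
    using y z S J cmp_extend[of u ?j z ?g] by (intro bexI[of _ u]) simp_all
qed

lemma sq_sigma_characterization:
  assumes "commutes S"
  shows "sq_sigma \<A> S \<in> Mor \<A>" "src \<A> (sq_sigma \<A> S) = sq_J \<A> S"
    "tgt \<A> (sq_sigma \<A> S) = tgt \<A> (sq_right S)"
    "sq_sigma \<A> S \<cdot> sq_j \<A> S \<cdot> coim \<A> (sq_top S) = sq_diag \<A> S"
    "sq_sigma \<A> S \<cdot> sq_i \<A> S = sq_bottom S \<cdot> im \<A> (sq_left S) \<cdot> bar \<A> (sq_left S)"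
proof -
  note S = commutes_typing[OF assms] and J = sq_pushout_typing[OF assms]
  define x where "x = sq_bottom S \<cdot> im \<A> (sq_left S) \<cdot> bar \<A> (sq_left S)"
  define y where "y = sq_right S \<cdot> im \<A> (sq_top S) \<cdot> bar \<A> (sq_top S)"
  note L = bar_decomposition[OF S(2)] and T = bar_decomposition[OF S(1)]
  have xy: "x \<in> Mor \<A>" "src \<A> x = tgt \<A> (coim \<A> (sq_left S))" "tgt \<A> x = tgt \<A> (sq_right S)"
    "y \<in> Mor \<A>" "src \<A> y = tgt \<A> (coim \<A> (sq_top S))" "tgt \<A> y = tgt \<A> (sq_right S)"
    and x: "x \<cdot> coim \<A> (sq_left S) = sq_diag \<A> S" and y: "y \<cdot> coim \<A> (sq_top S) = sq_diag \<A> S"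
    unfolding x_def y_def sq_diag_def using L T S by simp_all
  have "\<exists>!u. u \<in> Hom \<A> (sq_J \<A> S) (tgt \<A> (sq_right S)) \<and> u \<cdot> sq_i \<A> S = x \<and> u \<cdot> sq_j \<A> S = y"
    using sq_pushout[OF assms] xy x y unfolding is_pushout_def sq_J_def by metis
  then have "\<exists>!u. u \<in> Hom \<A> (sq_J \<A> S) (tgt \<A> (sq_right S)) \<and> u \<cdot> sq_j \<A> S = y \<and> u \<cdot> sq_i \<A> S = x"
    by metis
  from theI'[OF this]
  have u: "sq_sigma \<A> S \<in> Hom \<A> (sq_J \<A> S) (tgt \<A> (sq_right S))"
    "sq_sigma \<A> S \<cdot> sq_j \<A> S = y" "sq_sigma \<A> S \<cdot> sq_i \<A> S = x"
    unfolding sq_sigma_def x_def y_def by blast+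
  then show "sq_sigma \<A> S \<in> Mor \<A>" "src \<A> (sq_sigma \<A> S) = sq_J \<A> S"
    "tgt \<A> (sq_sigma \<A> S) = tgt \<A> (sq_right S)"
    "sq_sigma \<A> S \<cdot> sq_i \<A> S = sq_bottom S \<cdot> im \<A> (sq_left S) \<cdot> bar \<A> (sq_left S)"
    unfolding x_def by simp_all
  show "sq_sigma \<A> S \<cdot> sq_j \<A> S \<cdot> coim \<A> (sq_top S) = sq_diag \<A> S"
    using cmp_extend[OF u(2), of "coim \<A> (sq_top S)"] u(1) y S J by simp
qed

lemma ker_cmp_factor:
  assumes "h \<in> Mor \<A>" "k \<in> Mor \<A>" "src \<A> h = tgt \<A> k"
  shows "lift \<A> (ker \<A> (h \<cdot> k)) (ker \<A> k) \<in> Mor \<A>"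
    "src \<A> (lift \<A> (ker \<A> (h \<cdot> k)) (ker \<A> k)) = src \<A> (ker \<A> k)"
    "tgt \<A> (lift \<A> (ker \<A> (h \<cdot> k)) (ker \<A> k)) = src \<A> (ker \<A> (h \<cdot> k))"
    "ker \<A> (h \<cdot> k) \<cdot> lift \<A> (ker \<A> (h \<cdot> k)) (ker \<A> k) = ker \<A> k"
proof -
  have hk: "h \<cdot> k \<in> Mor \<A>" using assms by simp
  obtain u where u: "u \<in> Mor \<A>" "src \<A> u = src \<A> (ker \<A> k)" "tgt \<A> u = src \<A> (ker \<A> (h \<cdot> k))"
    "ker \<A> (h \<cdot> k) \<cdot> u = ker \<A> k"
    using is_kernel_factor[OF ker_is_kernel[OF hk], of "ker \<A> k"] assms by auto
  have "lift \<A> (ker \<A> (h \<cdot> k)) (ker \<A> k) = u"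
    using lift_eq[OF ker_monic[OF hk] u] .
  then show "lift \<A> (ker \<A> (h \<cdot> k)) (ker \<A> k) \<in> Mor \<A>"
    "src \<A> (lift \<A> (ker \<A> (h \<cdot> k)) (ker \<A> k)) = src \<A> (ker \<A> k)"
    "tgt \<A> (lift \<A> (ker \<A> (h \<cdot> k)) (ker \<A> k)) = src \<A> (ker \<A> (h \<cdot> k))"
    "ker \<A> (h \<cdot> k) \<cdot> lift \<A> (ker \<A> (h \<cdot> k)) (ker \<A> k) = ker \<A> k"
    using u by simp_all
qed

lemma sq_mu_nu:
  assumes "commutes S"
  shows "sq_mu \<A> S \<in> Mor \<A>" "src \<A> (sq_mu \<A> S) = src \<A> (ker \<A> (sq_left S))"
    "tgt \<A> (sq_mu \<A> S) = src \<A> (ker \<A> (sq_diag \<A> S))"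
    "ker \<A> (sq_diag \<A> S) \<cdot> sq_mu \<A> S = ker \<A> (sq_left S)"
    "sq_nu \<A> S \<in> Mor \<A>" "src \<A> (sq_nu \<A> S) = src \<A> (ker \<A> (sq_top S))"
    "tgt \<A> (sq_nu \<A> S) = src \<A> (ker \<A> (sq_diag \<A> S))"
    "ker \<A> (sq_diag \<A> S) \<cdot> sq_nu \<A> S = ker \<A> (sq_top S)"
proof -
  note S = commutes_typing[OF assms]
  have diag: "sq_diag \<A> S = sq_bottom S \<cdot> sq_left S" using S by (simp add: sq_diag_def)
  show "sq_mu \<A> S \<in> Mor \<A>" "src \<A> (sq_mu \<A> S) = src \<A> (ker \<A> (sq_left S))"
    "tgt \<A> (sq_mu \<A> S) = src \<A> (ker \<A> (sq_diag \<A> S))"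
    "ker \<A> (sq_diag \<A> S) \<cdot> sq_mu \<A> S = ker \<A> (sq_left S)"
    unfolding sq_mu_def diag using ker_cmp_factor[of "sq_bottom S" "sq_left S"] S(1-8) by simp_all
  show "sq_nu \<A> S \<in> Mor \<A>" "src \<A> (sq_nu \<A> S) = src \<A> (ker \<A> (sq_top S))"
    "tgt \<A> (sq_nu \<A> S) = src \<A> (ker \<A> (sq_diag \<A> S))"
    "ker \<A> (sq_diag \<A> S) \<cdot> sq_nu \<A> S = ker \<A> (sq_top S)"
    unfolding sq_nu_def sq_diag_def using ker_cmp_factor[of "sq_right S" "sq_top S"] S(1-8) by simp_all
qed

text \<open>For a strict epimorphism \<open>p\<close>, the preimage \<open>Ker (h \<cdot> p)\<close> of \<open>Ker h\<close> maps onto \<open>Ker h\<close>, being a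
  pullback of \<open>p\<close>, and the kernel is still that of \<open>p\<close>.\<close>

lemma kernel_restriction_cokernel:
  assumes k: "is_kernel \<A> k h" and kp: "is_kernel \<A> kp (h \<cdot> p)" and m: "is_kernel \<A> m p"
    and p: "strict_epic \<A> p" "src \<A> h = tgt \<A> p"
    and w: "w \<in> Mor \<A>" "src \<A> w = src \<A> kp" "tgt \<A> w = src \<A> k" "k \<cdot> w = p \<cdot> kp"
    and z: "z \<in> Mor \<A>" "src \<A> z = src \<A> m" "tgt \<A> z = src \<A> kp" "kp \<cdot> z = m"
  shows "is_cokernel \<A> w z"
proof -
  note K = is_kernel_typing[OF k] and KP = is_kernel_typing[OF kp] and M = is_kernel_typing[OF m]
  have kp_tgt: "tgt \<A> kp = src \<A> p" using KP K M p by simp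
  have factor: "\<exists>u \<in> Hom \<A> (src \<A> y) (src \<A> kp). kp \<cdot> u = y \<and> w \<cdot> u = x"
    if xy: "x \<in> Mor \<A>" "y \<in> Mor \<A>" "src \<A> x = src \<A> y" "tgt \<A> x = src \<A> k" "tgt \<A> y = src \<A> p"
      "k \<cdot> x = p \<cdot> y" for x y
  proof -
    have "h \<cdot> p \<cdot> y = zmor \<A> (src \<A> y) (tgt \<A> h)"
      using cmp_extend[OF K(4), of x] K xy p M by simp
    then obtain u where u: "u \<in> Mor \<A>" "src \<A> u = src \<A> y" "tgt \<A> u = src \<A> kp" "kp \<cdot> u = y"
      using is_kernel_factor[OF kp, of y] K M xy p by auto
    have "k \<cdot> w \<cdot> u = k \<cdot> x"
      using cmp_extend[OF w(4), of u] u w xy K KP M kp_tgt by simp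
    then have "w \<cdot> u = x"
      using monic_cancel[OF is_kernel_monic[OF k], of "w \<cdot> u" x] u w xy by simp
    then show ?thesis using u by auto
  qed
  have "is_pullback \<A> w kp k p"
    unfolding is_pullback_def
  proof (intro conjI ballI impI)
    fix x y assume xy: "x \<in> Mor \<A>" "y \<in> Mor \<A>"
      "src \<A> x = src \<A> y \<and> tgt \<A> x = src \<A> k \<and> tgt \<A> y = src \<A> p \<and> k \<cdot> x = p \<cdot> y"
    then obtain u where u: "u \<in> Hom \<A> (src \<A> y) (src \<A> kp)" "kp \<cdot> u = y" "w \<cdot> u = x"
      using factor[of x y] by blast
    show "\<exists>!u. u \<in> Hom \<A> (src \<A> x) (src \<A> w) \<and> w \<cdot> u = x \<and> kp \<cdot> u = y"
    proof (rule ex1I[of _ u])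
      fix v assume "v \<in> Hom \<A> (src \<A> x) (src \<A> w) \<and> w \<cdot> v = x \<and> kp \<cdot> v = y"
      then show "v = u" using monic_cancel[OF is_kernel_monic[OF kp], of v u] u w xy by simp
    qed (use u w xy in simp)
  qed (use K KP M p w kp_tgt in simp_all)
  then have "strict_epic \<A> w" using p(1) by (rule strict_epic_pullback)
  moreover have "is_kernel \<A> z w"
  proof (rule is_kernelI)
    show "monic z"
      unfolding monic_def
    proof (intro conjI ballI impI)
      fix x y assume xy: "x \<in> Mor \<A>" "y \<in> Mor \<A>"
        "src \<A> x = src \<A> y \<and> tgt \<A> x = src \<A> z \<and> tgt \<A> y = src \<A> z \<and> z \<cdot> x = z \<cdot> y"
      have "m \<cdot> x = m \<cdot> y"
        using cmp_extend[OF z(4), of x] cmp_extend[OF z(4), of y] z KP xy by simp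
      then show "x = y"
        using monic_cancel[OF is_kernel_monic[OF m], of x y] z xy by simp
    qed fact
    have "k \<cdot> (w \<cdot> z) = zmor \<A> (src \<A> (w \<cdot> z)) (tgt \<A> k)"
      using cmp_extend[OF w(4), of z] w z K M KP p kp_tgt by simp
    then show "w \<cdot> z = zmor \<A> (src \<A> z) (tgt \<A> w)"
      using monic_zero[OF is_kernel_monic[OF k], of "w \<cdot> z"] w z by simp
    fix x assume x: "x \<in> Mor \<A>" "tgt \<A> x = src \<A> w" "w \<cdot> x = zmor \<A> (src \<A> x) (tgt \<A> w)"
    have "p \<cdot> (kp \<cdot> x) = zmor \<A> (src \<A> (kp \<cdot> x)) (tgt \<A> p)"
      using cmp_extend[OF w(4), of x] x w(1-3) K M KP p kp_tgt by simp
    then obtain u where u: "u \<in> Mor \<A>" "src \<A> u = src \<A> x" "tgt \<A> u = src \<A> m" "m \<cdot> u = kp \<cdot> x"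
      using is_kernel_factor[OF m, of "kp \<cdot> x"] x w KP M kp_tgt by auto
    have "kp \<cdot> z \<cdot> u = kp \<cdot> x"
      using cmp_extend[OF z(4), of u] u z KP by simp
    then have "z \<cdot> u = x"
      using monic_cancel[OF is_kernel_monic[OF kp], of "z \<cdot> u" x] u z x w by simp
    then show "\<exists>u \<in> Hom \<A> (src \<A> x) (src \<A> z). z \<cdot> u = x" using u z by auto
  qed (use w z in simp_all)
  ultimately show ?thesis by (rule strict_epic_cokernel_of_kernel)
qed

lemma sq_copair_typing:
  assumes "commutes S"
  shows "copair \<A> (sq_mu \<A> S) (sq_nu \<A> S) \<in> Mor \<A>"
    "tgt \<A> (copair \<A> (sq_mu \<A> S) (sq_nu \<A> S)) = src \<A> (ker \<A> (sq_diag \<A> S))"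
  using copair_annihilator(1,2)[of "sq_mu \<A> S" "sq_nu \<A> S"] sq_mu_nu[OF assms] by simp_all

lemma sq_copair_annihilator:
  assumes "commutes S" "x \<in> Mor \<A>" "src \<A> x = src \<A> (ker \<A> (sq_diag \<A> S))"
  shows "x \<cdot> copair \<A> (sq_mu \<A> S) (sq_nu \<A> S) =
      zmor \<A> (src \<A> (copair \<A> (sq_mu \<A> S) (sq_nu \<A> S))) (tgt \<A> x) \<longleftrightarrow>
    x \<cdot> sq_mu \<A> S = zmor \<A> (src \<A> (ker \<A> (sq_left S))) (tgt \<A> x) \<and>
    x \<cdot> sq_nu \<A> S = zmor \<A> (src \<A> (ker \<A> (sq_top S))) (tgt \<A> x)"
  using copair_annihilator(3)[of "sq_mu \<A> S" "sq_nu \<A> S" x] sq_mu_nu[OF assms(1)] assms(2,3) by simp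

text \<open>The two descriptions of \<open>Ker_sq\<close> agree: the quotient \<open>p\<close> of the initial corner onto \<open>sq_J\<close>
  satisfies \<open>sq_sigma \<cdot> p = sq_diag\<close>, so \<open>Ker sq_diag \<rightarrow> Ker sq_sigma\<close> is the quotient by \<open>Ker p\<close>, and
  the direct sum of the kernels of \<open>left\<close> and \<open>top\<close> maps epimorphically to \<open>Ker p\<close>.\<close>

lemma sq_eta_characterization:
  assumes comm: "commutes S"
  shows "is_iso \<A> (sq_eta \<A> S)" "src \<A> (sq_eta \<A> S) = Ker_sq \<A> S"
    "tgt \<A> (sq_eta \<A> S) = src \<A> (ker \<A> (sq_sigma \<A> S))"
    "ker \<A> (sq_sigma \<A> S) \<cdot> sq_eta \<A> S \<cdot> coker \<A> (copair \<A> (sq_mu \<A> S) (sq_nu \<A> S)) =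
     sq_j \<A> S \<cdot> coim \<A> (sq_top S) \<cdot> ker \<A> (sq_diag \<A> S)"
proof -
  note S = commutes_typing[OF comm] and J = sq_pushout_typing[OF comm]
    and N = sq_mu_nu[OF comm] and Q = sq_pushout_quotient[OF comm]
    and Sig = sq_sigma_characterization[OF comm] and C = sq_copair_typing[OF comm]
  define c where "c = copair \<A> (sq_mu \<A> S) (sq_nu \<A> S)"
  define kd where "kd = ker \<A> (sq_diag \<A> S)"
  define p where "p = sq_j \<A> S \<cdot> coim \<A> (sq_top S)"
  define K where "K = ker \<A> (sq_sigma \<A> S)"
  have c: "c \<in> Mor \<A>" "tgt \<A> c = src \<A> kd" unfolding c_def kd_def by (fact C)+
  have kd: "kd \<in> Mor \<A>" "tgt \<A> kd = src \<A> (sq_left S)" and kd_ker: "is_kernel \<A> kd (sq_diag \<A> S)"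
    unfolding kd_def using S by (simp_all add: ker_is_kernel)
  have p: "p \<in> Mor \<A>" "src \<A> p = src \<A> (sq_left S)" "tgt \<A> p = sq_J \<A> S"
    unfolding p_def using S J by simp_all
  have K: "K \<in> Mor \<A>" "tgt \<A> K = sq_J \<A> S" "is_kernel \<A> K (sq_sigma \<A> S)"
    unfolding K_def using Sig by (simp_all add: ker_is_kernel)
  have sp: "sq_sigma \<A> S \<cdot> p = sq_diag \<A> S" unfolding p_def by (fact Sig)
  have p_epic: "epic p" unfolding p_def by (fact Q)
  have p_coker: "is_cokernel \<A> p (kd \<cdot> c)"
  proof (rule is_cokernelI)
    have "(p \<cdot> kd) \<cdot> sq_mu \<A> S = zmor \<A> (src \<A> (ker \<A> (sq_left S))) (sq_J \<A> S)"
      "(p \<cdot> kd) \<cdot> sq_nu \<A> S = zmor \<A> (src \<A> (ker \<A> (sq_top S))) (sq_J \<A> S)"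
      unfolding p_def kd_def using S J N Q(2,3) by simp_all
    then have "(p \<cdot> kd) \<cdot> c = zmor \<A> (src \<A> c) (sq_J \<A> S)"
      using sq_copair_annihilator[OF comm, of "p \<cdot> kd"] p kd unfolding c_def kd_def by simp
    then show "p \<cdot> kd \<cdot> c = zmor \<A> (src \<A> (kd \<cdot> c)) (tgt \<A> p)"
      using p kd c by simp
    fix x assume x: "x \<in> Mor \<A>" "src \<A> x = tgt \<A> (kd \<cdot> c)"
      "x \<cdot> kd \<cdot> c = zmor \<A> (src \<A> (kd \<cdot> c)) (tgt \<A> x)"
    then have "(x \<cdot> kd) \<cdot> c = zmor \<A> (src \<A> c) (tgt \<A> (x \<cdot> kd))"
      using kd c by simp
    then have "(x \<cdot> kd) \<cdot> sq_mu \<A> S = zmor \<A> (src \<A> (ker \<A> (sq_left S))) (tgt \<A> x)"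
      "(x \<cdot> kd) \<cdot> sq_nu \<A> S = zmor \<A> (src \<A> (ker \<A> (sq_top S))) (tgt \<A> x)"
      using sq_copair_annihilator[OF comm, of "x \<cdot> kd"] x kd c unfolding c_def kd_def by simp_all
    then have "x \<cdot> ker \<A> (sq_left S) = zmor \<A> (src \<A> (ker \<A> (sq_left S))) (tgt \<A> x)"
      "x \<cdot> ker \<A> (sq_top S) = zmor \<A> (src \<A> (ker \<A> (sq_top S))) (tgt \<A> x)"
      unfolding kd_def using x(1,2) N kd c S kd_def by simp_all
    then obtain u where "u \<in> Hom \<A> (sq_J \<A> S) (tgt \<A> x)" "u \<cdot> p = x"
      unfolding p_def using Q(4)[of x] x(1,2) kd c by auto
    then show "\<exists>u \<in> Hom \<A> (tgt \<A> p) (tgt \<A> x). u \<cdot> p = x" using p by auto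
  qed (use p_epic p kd c in simp_all)
  obtain w where w: "w \<in> Mor \<A>" "src \<A> w = src \<A> kd" "tgt \<A> w = src \<A> K" "K \<cdot> w = p \<cdot> kd"
  proof (rule is_kernel_factor[OF K(3)])
    show "sq_sigma \<A> S \<cdot> (p \<cdot> kd) = zmor \<A> (src \<A> (p \<cdot> kd)) (tgt \<A> (sq_sigma \<A> S))"
      using cmp_extend[OF sp, of kd] p kd Sig S is_kernel_typing(4)[OF kd_ker] by simp
  qed (use p kd Sig in auto)
  define m where "m = ker \<A> p"
  have m: "m \<in> Mor \<A>" "tgt \<A> m = src \<A> p" "is_kernel \<A> m p"
    unfolding m_def using p by (simp_all add: ker_is_kernel)
  obtain z where z: "z \<in> Mor \<A>" "src \<A> z = src \<A> m" "tgt \<A> z = src \<A> kd" "kd \<cdot> z = m"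
  proof (rule is_kernel_factor[OF kd_ker])
    show "sq_diag \<A> S \<cdot> m = zmor \<A> (src \<A> m) (tgt \<A> (sq_diag \<A> S))"
      using assoc[of "sq_sigma \<A> S" p m] is_kernel_typing(4)[OF m(3)] sp p m Sig S by simp
  qed (use m p S in auto)
  have wz: "is_cokernel \<A> w z"
  proof (rule kernel_restriction_cokernel[OF K(3) _ m(3)])
    show "is_kernel \<A> kd (sq_sigma \<A> S \<cdot> p)" unfolding sp by fact
    show "strict_epic \<A> p" using p_coker unfolding strict_epic_def by blast
  qed (use Sig p w z in simp_all)
  obtain q where q: "q \<in> Mor \<A>" "src \<A> q = src \<A> (kd \<cdot> c)" "tgt \<A> q = src \<A> m" "m \<cdot> q = kd \<cdot> c"
    using is_kernel_factor[OF m(3), of "kd \<cdot> c"] is_cokernel_typing[OF p_coker] kd c p by auto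
  have "epic q" using image_corestriction_epic[OF p_coker m(3) q(1)] q by simp
  have "kd \<cdot> (z \<cdot> q) = kd \<cdot> c"
    using cmp_extend[OF z(4), of q] z q kd by simp
  then have "z \<cdot> q = c"
    using monic_cancel[OF is_kernel_monic[OF kd_ker], of "z \<cdot> q" c] z q c kd by simp
  then have wc: "is_cokernel \<A> w c"
    using is_cokernel_cmp_epic_iff[OF \<open>epic q\<close>, of z w] wz z q by simp
  define d where "d = coker \<A> c"
  have d: "d \<in> Mor \<A>" "src \<A> d = tgt \<A> c" "is_cokernel \<A> d c" and dK: "tgt \<A> d = Ker_sq \<A> S"
    unfolding d_def Ker_sq_def using c by (simp_all add: coker_is_cokernel c_def)
  note W = is_cokernel_typing[OF wc] and D = is_cokernel_typing[OF d(3)]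
  obtain u where u: "u \<in> Mor \<A>" "src \<A> u = tgt \<A> d" "tgt \<A> u = tgt \<A> w" "u \<cdot> d = w"
    using is_cokernel_factor[OF d(3), of w] W by auto
  obtain v where v: "v \<in> Mor \<A>" "src \<A> v = tgt \<A> w" "tgt \<A> v = tgt \<A> d" "v \<cdot> w = d"
    using is_cokernel_factor[OF wc, of d] D by auto
  have "is_iso \<A> u"
    using mutual_cofactor_iso[OF is_cokernel_epic[OF d(3)] is_cokernel_epic[OF wc], of u v] u v by simp
  have eq: "K \<cdot> u \<cdot> d = sq_j \<A> S \<cdot> coim \<A> (sq_top S) \<cdot> kd"
    using u(4) w(4) S J kd unfolding p_def by simp
  have "sq_eta \<A> S = u"
    unfolding sq_eta_def c_def[symmetric] d_def[symmetric] K_def[symmetric] kd_def[symmetric]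
  proof (rule the_equality)
    show "u \<in> Hom \<A> (Ker_sq \<A> S) (kerO \<A> (sq_sigma \<A> S)) \<and> is_iso \<A> u \<and>
        K \<cdot> u \<cdot> d = sq_j \<A> S \<cdot> coim \<A> (sq_top S) \<cdot> kd"
      using u w \<open>is_iso \<A> u\<close> eq dK by (simp add: K_def)
    fix y assume y: "y \<in> Hom \<A> (Ker_sq \<A> S) (kerO \<A> (sq_sigma \<A> S)) \<and> is_iso \<A> y \<and>
        K \<cdot> y \<cdot> d = sq_j \<A> S \<cdot> coim \<A> (sq_top S) \<cdot> kd"
    then have y': "y \<in> Mor \<A>" "src \<A> y = tgt \<A> d" "tgt \<A> y = src \<A> K" "K \<cdot> (y \<cdot> d) = K \<cdot> (u \<cdot> d)"
      using eq dK by (simp_all add: K_def)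
    have "y \<cdot> d = u \<cdot> d"
      by (rule monic_cancel[OF is_kernel_monic[OF K(3)] y'(4)]) (use y'(1-3) u w c d in simp_all)
    then show "y = u"
      using epic_cancel[OF is_cokernel_epic[OF d(3)], of y u] y'(1-3) u w by simp
  qed
  then show "is_iso \<A> (sq_eta \<A> S)" "src \<A> (sq_eta \<A> S) = Ker_sq \<A> S"
    "tgt \<A> (sq_eta \<A> S) = src \<A> (ker \<A> (sq_sigma \<A> S))"
    "ker \<A> (sq_sigma \<A> S) \<cdot> sq_eta \<A> S \<cdot> coker \<A> (copair \<A> (sq_mu \<A> S) (sq_nu \<A> S)) =
     sq_j \<A> S \<cdot> coim \<A> (sq_top S) \<cdot> ker \<A> (sq_diag \<A> S)"
    using \<open>is_iso \<A> u\<close> u w dK eq unfolding K_def d_def kd_def c_def by simp_all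
qed

section \<open>Short exact sequences\<close>

text \<open>Since \<open>im h\<close> is a kernel of \<open>coker h\<close>, it is a kernel of \<open>k\<close> as soon as \<open>k\<close> and \<open>coker h\<close>
  annihilate the same morphisms.\<close>

lemma exactI:
  assumes h: "h \<in> Mor \<A>" and k: "k \<in> Mor \<A>" "tgt \<A> h = src \<A> k" "k \<cdot> h = zmor \<A> (src \<A> h) (tgt \<A> k)"
    and ker: "\<And>x. x \<in> Mor \<A> \<Longrightarrow> tgt \<A> x = src \<A> k \<Longrightarrow> k \<cdot> x = zmor \<A> (src \<A> x) (tgt \<A> k) \<Longrightarrow>
      coker \<A> h \<cdot> x = zmor \<A> (src \<A> x) (tgt \<A> (coker \<A> h))"
  shows "exact \<A> h k"
proof -
  obtain v where v: "v \<in> Mor \<A>" "src \<A> v = tgt \<A> (coker \<A> h)" "tgt \<A> v = tgt \<A> k" "v \<cdot> coker \<A> h = k"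
    using is_cokernel_factor[OF coker_is_cokernel[OF h], of k] k h by auto
  have "k \<cdot> im \<A> h = zmor \<A> (src \<A> (im \<A> h)) (tgt \<A> k)"
    using assoc[of v "coker \<A> h" "im \<A> h"] v h by simp
  then obtain s where s: "s \<in> Mor \<A>" "src \<A> s = src \<A> (im \<A> h)" "tgt \<A> s = src \<A> (ker \<A> k)"
    "ker \<A> k \<cdot> s = im \<A> h"
    using is_kernel_factor[OF ker_is_kernel[OF k(1)], of "im \<A> h"] h k by auto
  obtain t where t: "t \<in> Mor \<A>" "src \<A> t = src \<A> (ker \<A> k)" "tgt \<A> t = src \<A> (im \<A> h)"
    "im \<A> h \<cdot> t = ker \<A> k"
    using is_kernel_factor[OF im_is_kernel[OF h], of "ker \<A> k"] ker[of "ker \<A> k"] h k by auto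
  have "is_iso \<A> s"
    using mutual_factor_iso[OF ker_monic[OF k(1)] im_monic[OF h], of s t] s t by simp
  then show ?thesis unfolding exact_def using s h k by auto
qed

lemma zero_object_in_Obj: "zero_object \<A> \<in> Obj \<A>"
  using someI_ex[OF zero_object_exists] unfolding zero_object_def is_zero_object_def by blast

lemma short_exact_seq:
  assumes t: "monic t" and l: "is_cokernel \<A> l t"
  shows "exact_seq \<A> [zmor \<A> (zero_object \<A>) (src \<A> t), t, l, zmor \<A> (tgt \<A> l) (zero_object \<A>)]"
proof -
  note L = is_cokernel_typing[OF l]
  have "exact \<A> (zmor \<A> (zero_object \<A>) (src \<A> t)) t"
  proof (rule exactI)
    fix x assume x: "x \<in> Mor \<A>" "tgt \<A> x = src \<A> t" "t \<cdot> x = zmor \<A> (src \<A> x) (tgt \<A> t)"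
    have "x = zmor \<A> (src \<A> x) (src \<A> t)"
      using monic_zero[OF t x(3,1,2)] .
    moreover have "coker \<A> (zmor \<A> (zero_object \<A>) (src \<A> t)) \<cdot> zmor \<A> (src \<A> x) (src \<A> t) =
        zmor \<A> (src \<A> x) (tgt \<A> (coker \<A> (zmor \<A> (zero_object \<A>) (src \<A> t))))"
      using x L zero_object_in_Obj by simp
    ultimately show "coker \<A> (zmor \<A> (zero_object \<A>) (src \<A> t)) \<cdot> x =
        zmor \<A> (src \<A> x) (tgt \<A> (coker \<A> (zmor \<A> (zero_object \<A>) (src \<A> t))))"
      by metis
  qed (use L zero_object_in_Obj in simp_all)
  moreover have "exact \<A> t l"
  proof (rule exactI)
    fix x assume x: "x \<in> Mor \<A>" "tgt \<A> x = src \<A> l" "l \<cdot> x = zmor \<A> (src \<A> x) (tgt \<A> l)"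
    obtain v where v: "v \<in> Mor \<A>" "src \<A> v = tgt \<A> l" "tgt \<A> v = tgt \<A> (coker \<A> t)" "v \<cdot> l = coker \<A> t"
      using is_cokernel_factor[OF l, of "coker \<A> t"] L by auto
    show "coker \<A> t \<cdot> x = zmor \<A> (src \<A> x) (tgt \<A> (coker \<A> t))"
      using assoc[of v l x] v x L by simp
  qed (use L in simp_all)
  moreover have "exact \<A> l (zmor \<A> (tgt \<A> l) (zero_object \<A>))"
  proof (rule exactI)
    fix x assume x: "x \<in> Mor \<A>" "tgt \<A> x = src \<A> (zmor \<A> (tgt \<A> l) (zero_object \<A>))"
    have "coker \<A> l = zmor \<A> (tgt \<A> l) (tgt \<A> (coker \<A> l))"
      using epic_zero_iff[OF is_cokernel_epic[OF l], of "coker \<A> l"] L by simp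
    moreover have "zmor \<A> (tgt \<A> l) (tgt \<A> (coker \<A> l)) \<cdot> x = zmor \<A> (src \<A> x) (tgt \<A> (coker \<A> l))"
      using x L zero_object_in_Obj by simp
    ultimately show "coker \<A> l \<cdot> x = zmor \<A> (src \<A> x) (tgt \<A> (coker \<A> l))"
      by metis
  qed (use L zero_object_in_Obj in simp_all)
  ultimately show ?thesis unfolding exact_seq_def by simp
qed

lemma homology_eps_typing:
  assumes "semiexact \<A> h k"
  shows "homology_eps \<A> h k \<in> Mor \<A>" "src \<A> (homology_eps \<A> h k) = src \<A> (im \<A> h)"
    "tgt \<A> (homology_eps \<A> h k) = src \<A> (ker \<A> k)" "ker \<A> k \<cdot> homology_eps \<A> h k = im \<A> h"
    "k \<cdot> im \<A> h = zmor \<A> (src \<A> (im \<A> h)) (tgt \<A> k)"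
proof -
  have hk: "h \<in> Mor \<A>" "k \<in> Mor \<A>" "tgt \<A> h = src \<A> k" "k \<cdot> h = zmor \<A> (src \<A> h) (tgt \<A> k)"
    using assms unfolding semiexact_def by simp_all
  obtain v where v: "v \<in> Mor \<A>" "src \<A> v = tgt \<A> (coker \<A> h)" "tgt \<A> v = tgt \<A> k" "v \<cdot> coker \<A> h = k"
    using is_cokernel_factor[OF coker_is_cokernel[OF hk(1)], of k] hk by auto
  show z: "k \<cdot> im \<A> h = zmor \<A> (src \<A> (im \<A> h)) (tgt \<A> k)"
    using assoc[of v "coker \<A> h" "im \<A> h"] v hk by simp
  obtain u where u: "u \<in> Mor \<A>" "src \<A> u = src \<A> (im \<A> h)" "tgt \<A> u = src \<A> (ker \<A> k)" "ker \<A> k \<cdot> u = im \<A> h"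
    using is_kernel_factor[OF ker_is_kernel[OF hk(2)], of "im \<A> h"] z hk by auto
  have "homology_eps \<A> h k = u"
    unfolding homology_eps_def using lift_eq[OF ker_monic[OF hk(2)] u] .
  then show "homology_eps \<A> h k \<in> Mor \<A>" "src \<A> (homology_eps \<A> h k) = src \<A> (im \<A> h)"
    "tgt \<A> (homology_eps \<A> h k) = src \<A> (ker \<A> k)" "ker \<A> k \<cdot> homology_eps \<A> h k = im \<A> h"
    using u by simp_all
qed

lemma is_kernel_right_factor:
  assumes mn: "is_kernel \<A> (m \<cdot> n) h" and m: "monic m" and n: "n \<in> Mor \<A>" "src \<A> m = tgt \<A> n"
  shows "is_kernel \<A> n (h \<cdot> m)"
proof -
  have M: "m \<in> Mor \<A>" using m unfolding monic_def by blast
  note K = is_kernel_typing[OF mn]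
  have mh: "tgt \<A> m = src \<A> h" using K M n by simp
  show ?thesis
  proof (rule is_kernelI)
    show "monic n"
      unfolding monic_def
    proof (intro conjI ballI impI)
      fix x y assume xy: "x \<in> Mor \<A>" "y \<in> Mor \<A>"
        "src \<A> x = src \<A> y \<and> tgt \<A> x = src \<A> n \<and> tgt \<A> y = src \<A> n \<and> n \<cdot> x = n \<cdot> y"
      then show "x = y"
        using monic_cancel[OF is_kernel_monic[OF mn], of x y] M n by simp
    qed fact
    fix x assume x: "x \<in> Mor \<A>" "tgt \<A> x = src \<A> (h \<cdot> m)"
      "(h \<cdot> m) \<cdot> x = zmor \<A> (src \<A> x) (tgt \<A> (h \<cdot> m))"
    then obtain u where u: "u \<in> Mor \<A>" "src \<A> u = src \<A> x" "tgt \<A> u = src \<A> n" "(m \<cdot> n) \<cdot> u = m \<cdot> x"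
      using is_kernel_factor[OF mn, of "m \<cdot> x"] K(2) M n mh by auto
    have "n \<cdot> u = x"
      by (rule monic_cancel[OF m]) (use u x K(2) M n mh in simp_all)
    then show "\<exists>u \<in> Hom \<A> (src \<A> x) (src \<A> n). n \<cdot> u = x" using u by auto
  qed (use K M n mh in simp_all)
qed

lemma is_cokernel_precompose_iso:
  assumes e: "is_cokernel \<A> e (v \<cdot> h)" and v: "is_iso \<A> v" and h: "h \<in> Mor \<A>" "src \<A> v = tgt \<A> h"
  shows "is_cokernel \<A> (e \<cdot> v) h"
proof -
  have V: "v \<in> Mor \<A>" using v unfolding is_iso_def by blast
  note I = inv_mor_inverse[OF v] and E = is_cokernel_typing[OF e]
  have ev: "src \<A> e = tgt \<A> v" using E V h by simp
  show ?thesis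
  proof (rule is_cokernelI)
    show "epic (e \<cdot> v)" using epic_cmp[OF is_cokernel_epic[OF e] iso_epic[OF v]] ev by simp
    fix x assume x: "x \<in> Mor \<A>" "src \<A> x = tgt \<A> h" "x \<cdot> h = zmor \<A> (src \<A> h) (tgt \<A> x)"
    have "(x \<cdot> inv_mor \<A> v) \<cdot> v \<cdot> h = zmor \<A> (src \<A> h) (tgt \<A> x)"
      using cmp_extend[OF I(4), of h] x I V h by simp
    then obtain u where u: "u \<in> Mor \<A>" "src \<A> u = tgt \<A> e" "tgt \<A> u = tgt \<A> x" "u \<cdot> e = x \<cdot> inv_mor \<A> v"
      using is_cokernel_factor[OF e, of "x \<cdot> inv_mor \<A> v"] x I V h by auto
    have "u \<cdot> e \<cdot> v = x"
      using cmp_extend[OF u(4), of v] u x I V E ev h by simp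
    then show "\<exists>u \<in> Hom \<A> (tgt \<A> (e \<cdot> v)) (tgt \<A> x). u \<cdot> e \<cdot> v = x"
      using u V E ev by auto
  qed (use E V h ev in simp_all)
qed

end

section \<open>Two adjacent squares\<close>

locale adjacent_squares = quasi_abelian_category +
  fixes f g f' g' a b c and S T
  assumes typing: "f \<in> Mor \<A>" "g \<in> Mor \<A>" "f' \<in> Mor \<A>" "g' \<in> Mor \<A>" "a \<in> Mor \<A>" "b \<in> Mor \<A>" "c \<in> Mor \<A>"
      "tgt \<A> f = src \<A> b" "src \<A> g = src \<A> b" "src \<A> a = src \<A> f" "tgt \<A> a = src \<A> f'"
      "tgt \<A> f' = tgt \<A> b" "src \<A> g' = tgt \<A> b" "src \<A> c = tgt \<A> g" "tgt \<A> c = tgt \<A> g'"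
    and commute_S: "b \<cdot> f = f' \<cdot> a" and commute_T: "c \<cdot> g = g' \<cdot> b"
    and semiexact_top: "semiexact \<A> f g" and semiexact_bottom: "semiexact \<A> f' g'"
    and S_def: "S = \<lparr>sq_top = f, sq_left = a, sq_bottom = f', sq_right = b\<rparr>"
    and T_def: "T = \<lparr>sq_top = g, sq_left = b, sq_bottom = g', sq_right = c\<rparr>"
begin

declare typing [simp]

lemma sides [simp]:
  "sq_top S = f" "sq_left S = a" "sq_bottom S = f'" "sq_right S = b"
  "sq_top T = g" "sq_left T = b" "sq_bottom T = g'" "sq_right T = c"
  by (simp_all add: S_def T_def)

lemma commutes_S: "commutes S" and commutes_T: "commutes T"
  unfolding commutes_def using commute_S commute_T by simp_all

lemma diag_S: "sq_diag \<A> S = b \<cdot> f" and diag_T: "sq_diag \<A> T = g' \<cdot> b"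
  unfolding sq_diag_def using commute_T by simp_all

lemmas zero_cmp = semiexact_top[unfolded semiexact_def, THEN conjunct2, THEN conjunct2, THEN conjunct2]
  semiexact_bottom[unfolded semiexact_def, THEN conjunct2, THEN conjunct2, THEN conjunct2]

text \<open>Here \<open>kd\<close> embeds \<open>Ker (g' \<cdot> b)\<close> into the source of \<open>b\<close>, and \<open>d\<close> is the quotient of \<open>Ker (g' \<cdot> b)\<close>
  defining \<open>Ker_sq T\<close>.\<close>

abbreviation "k \<equiv> sq_k \<A> S"
abbreviation "l \<equiv> sq_l \<A> S"
abbreviation "\<rho> \<equiv> sq_rho \<A> S"
abbreviation "\<mu> \<equiv> sq_mu \<A> T"
abbreviation "\<nu> \<equiv> sq_nu \<A> T"
abbreviation "i \<equiv> sq_i \<A> T"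
abbreviation "j \<equiv> sq_j \<A> T"
abbreviation "\<sigma> \<equiv> sq_sigma \<A> T"
abbreviation "kd \<equiv> ker \<A> (g' \<cdot> b)"
abbreviation "d \<equiv> coker \<A> (copair \<A> \<mu> \<nu>)"
abbreviation "\<epsilon> \<equiv> homology_eps \<A> f g"
abbreviation "\<epsilon>' \<equiv> homology_eps \<A> f' g'"

text \<open>The embedding of \<open>Ker_sq T\<close> into the pushout \<open>sq_J T\<close>; equations between morphisms into
  \<open>Ker_sq T\<close> are checked after composing with it.\<close>

definition \<iota> where "\<iota> = ker \<A> \<sigma> \<cdot> sq_eta \<A> T"

lemmas sq_typing [simp] =
  sq_intersection_typing(1-6)[OF commutes_S, simplified]
  sq_rho_characterization(1-3)[OF commutes_S, unfolded diag_S]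
  sq_mu_nu(1-3,5-7)[OF commutes_T, unfolded diag_T, simplified]
  sq_pushout_typing(1-6)[OF commutes_T, simplified]
  sq_sigma_characterization(1-3)[OF commutes_T, simplified]
  sq_copair_typing[OF commutes_T, unfolded diag_T, simplified]
  homology_eps_typing(1-3)[OF semiexact_top]
  homology_eps_typing(1-3)[OF semiexact_bottom]
  bar_decomposition(1-3)[OF typing(6)]

lemmas f'_l = sq_intersection_typing(7)[OF commutes_S, simplified]
lemmas b_k_\<rho> = sq_rho_characterization(4)[OF commutes_S, unfolded diag_S, simplified]
lemmas b_k_monic = sq_intersection_monic[OF commutes_S, simplified]
lemmas kd_\<mu> = sq_mu_nu(4)[OF commutes_T, unfolded diag_T, simplified]
lemmas kd_\<nu> = sq_mu_nu(8)[OF commutes_T, unfolded diag_T, simplified]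
lemmas i_coim_b = sq_pushout_typing(7)[OF commutes_T, simplified]
lemmas \<sigma>_i = sq_sigma_characterization(5)[OF commutes_T, simplified]
lemmas g_\<epsilon> = homology_eps_typing(4)[OF semiexact_top]
lemmas g'_\<epsilon>' = homology_eps_typing(4)[OF semiexact_bottom]
lemmas b_decomposition = bar_decomposition(4)[OF typing(6)]

lemma kd_typing: "kd \<in> Mor \<A>" "tgt \<A> kd = src \<A> b" "g' \<cdot> b \<cdot> kd = zmor \<A> (src \<A> kd) (tgt \<A> g')"
  using is_kernel_typing(4)[OF ker_is_kernel[of "g' \<cdot> b"]] by (simp_all del: ker_typing(3))

lemma d_typing [simp]: "d \<in> Mor \<A>" "src \<A> d = src \<A> kd" "tgt \<A> d = Ker_sq \<A> T"
  unfolding Ker_sq_def by simp_all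

lemma coker_\<rho>_typing [simp]: "coker \<A> \<rho> \<in> Mor \<A>" "src \<A> (coker \<A> \<rho>) = sq_I \<A> S"
  "tgt \<A> (coker \<A> \<rho>) = Im_sq \<A> S"
  unfolding Im_sq_def by simp_all

lemma \<iota>_embedding:
  shows "monic \<iota>" "\<iota> \<in> Mor \<A>" "src \<A> \<iota> = Ker_sq \<A> T" "tgt \<A> \<iota> = sq_J \<A> T"
    "\<iota> \<cdot> d = i \<cdot> coim \<A> b \<cdot> kd"
proof -
  note E = sq_eta_characterization[OF commutes_T]
  have M: "sq_eta \<A> T \<in> Mor \<A>" using E(1) unfolding is_iso_def by blast
  show "monic \<iota>" "\<iota> \<in> Mor \<A>" "src \<A> \<iota> = Ker_sq \<A> T" "tgt \<A> \<iota> = sq_J \<A> T"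
    unfolding \<iota>_def using monic_cmp[OF ker_monic iso_monic[OF E(1)]] E M by simp_all
  show "\<iota> \<cdot> d = i \<cdot> coim \<A> b \<cdot> kd"
    unfolding \<iota>_def using E M cmp_extend[OF i_coim_b, of kd] by (simp add: diag_T)
qed

declare \<iota>_embedding(2-4) [simp]

text \<open>The composite \<open>i \<cdot> (bar b)\<inverse> \<cdot> k\<close> annihilates \<open>\<rho>\<close> because \<open>g \<cdot> f = 0\<close>, and is annihilated by \<open>\<sigma>\<close>
  because \<open>g' \<cdot> f' = 0\<close>; hence it descends to \<open>Im_sq S\<close> and lifts to \<open>Ker_sq T\<close>.\<close>

lemma Lambda_characterization:
  assumes bar: "is_iso \<A> (bar \<A> b)"
  shows "Lambda \<A> S T \<in> Mor \<A>" "src \<A> (Lambda \<A> S T) = Im_sq \<A> S" "tgt \<A> (Lambda \<A> S T) = Ker_sq \<A> T"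
    "\<iota> \<cdot> Lambda \<A> S T \<cdot> coker \<A> \<rho> = i \<cdot> inv_mor \<A> (bar \<A> b) \<cdot> k"
proof -
  note E = sq_eta_characterization[OF commutes_T]
  have M: "sq_eta \<A> T \<in> Mor \<A>" using E(1) unfolding is_iso_def by blast
  note B = inv_mor_inverse[OF bar]
  define y where "y = i \<cdot> inv_mor \<A> (bar \<A> b) \<cdot> k"
  have y: "y \<in> Mor \<A>" "src \<A> y = sq_I \<A> S" "tgt \<A> y = sq_J \<A> T"
    unfolding y_def using B by simp_all
  obtain q where q: "q \<in> Mor \<A>" "src \<A> q = src \<A> (b \<cdot> f)" "tgt \<A> q = src \<A> (im \<A> (b \<cdot> f))"
    "im \<A> (b \<cdot> f) \<cdot> q = b \<cdot> f" "epic q"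
    using im_factor[of "b \<cdot> f"] by auto
  have "k \<cdot> \<rho> \<cdot> q = bar \<A> b \<cdot> coim \<A> b \<cdot> f"
  proof (rule monic_cancel[OF im_monic])
    have "(im \<A> b \<cdot> k \<cdot> \<rho>) \<cdot> q = (im \<A> b \<cdot> bar \<A> b \<cdot> coim \<A> b) \<cdot> f"
      unfolding b_k_\<rho> b_decomposition using q by simp
    then show "im \<A> b \<cdot> k \<cdot> \<rho> \<cdot> q = im \<A> b \<cdot> bar \<A> b \<cdot> coim \<A> b \<cdot> f"
      using q by simp
  qed (use q in simp_all)
  then have y_q: "y \<cdot> \<rho> \<cdot> q = i \<cdot> coim \<A> b \<cdot> f"
    unfolding y_def using q B cmp_extend[OF B(4), of "coim \<A> b \<cdot> f"] by simp
  obtain f1 where f1: "f1 \<in> Mor \<A>" "src \<A> f1 = src \<A> f" "tgt \<A> f1 = src \<A> (ker \<A> g)" "ker \<A> g \<cdot> f1 = f"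
    using is_kernel_factor[OF ker_is_kernel, of g f] zero_cmp by auto
  have "coim \<A> g \<cdot> f = zmor \<A> (src \<A> f) (tgt \<A> (coim \<A> g))"
    using cmp_extend[OF coim_typing(3), of g f1] f1 by simp
  then have "(y \<cdot> \<rho>) \<cdot> q = zmor \<A> (src \<A> q) (tgt \<A> (y \<cdot> \<rho>))"
    using y_q cmp_extend[OF i_coim_b, of f] q y by simp
  then have "y \<cdot> \<rho> = zmor \<A> (src \<A> \<rho>) (tgt \<A> y)"
    using epic_zero_iff[OF q(5), of "y \<cdot> \<rho>"] q y by simp
  then obtain x where x: "x \<in> Mor \<A>" "src \<A> x = Im_sq \<A> S" "tgt \<A> x = sq_J \<A> T" "x \<cdot> coker \<A> \<rho> = y"
    using is_cokernel_factor[OF coker_is_cokernel, of \<rho> y] y by auto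
  have "\<sigma> \<cdot> y = g' \<cdot> im \<A> f' \<cdot> l"
    unfolding y_def f'_l
    using cmp_extend[OF \<sigma>_i, of "inv_mor \<A> (bar \<A> b) \<cdot> k"] cmp_extend[OF B(5), of k] B by simp
  also have "\<dots> = zmor \<A> (sq_I \<A> S) (tgt \<A> \<sigma>)"
    using cmp_extend[OF homology_eps_typing(5)[OF semiexact_bottom], of l] by simp
  finally have "(\<sigma> \<cdot> x) \<cdot> coker \<A> \<rho> = zmor \<A> (src \<A> (coker \<A> \<rho>)) (tgt \<A> (\<sigma> \<cdot> x))"
    using x by simp
  then have "\<sigma> \<cdot> x = zmor \<A> (src \<A> x) (tgt \<A> \<sigma>)"
    using epic_zero_iff[OF coker_epic, of \<rho> "\<sigma> \<cdot> x"] x by simp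
  then obtain z where z: "z \<in> Mor \<A>" "src \<A> z = src \<A> x" "tgt \<A> z = src \<A> (ker \<A> \<sigma>)" "ker \<A> \<sigma> \<cdot> z = x"
    using is_kernel_factor[OF ker_is_kernel, of \<sigma> x] x by auto
  note H = inv_mor_inverse[OF E(1)]
  define L where "L = inv_mor \<A> (sq_eta \<A> T) \<cdot> z"
  have L: "L \<in> Mor \<A>" "src \<A> L = Im_sq \<A> S" "tgt \<A> L = Ker_sq \<A> T"
    unfolding L_def using H E z x by simp_all
  have "sq_eta \<A> T \<cdot> L = z"
    unfolding L_def using cmp_extend[OF H(5), of z] H E z M by simp
  then have "sq_eta \<A> T \<cdot> L \<cdot> coker \<A> \<rho> = z \<cdot> coker \<A> \<rho>"
    using cmp_extend[of "sq_eta \<A> T" L z "coker \<A> \<rho>"] L M E by simp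
  then have eq: "ker \<A> \<sigma> \<cdot> sq_eta \<A> T \<cdot> L \<cdot> coker \<A> \<rho> = y"
    using cmp_extend[OF z(4), of "coker \<A> \<rho>"] x z by simp
  have "Lambda \<A> S T = L"
    unfolding Lambda_def sides y_def[symmetric]
  proof (rule the_equality)
    fix L' assume L': "L' \<in> Hom \<A> (Im_sq \<A> S) (Ker_sq \<A> T) \<and>
      ker \<A> \<sigma> \<cdot> sq_eta \<A> T \<cdot> L' \<cdot> coker \<A> \<rho> = y"
    have "\<iota> \<cdot> L' \<cdot> coker \<A> \<rho> = \<iota> \<cdot> L \<cdot> coker \<A> \<rho>"
      unfolding \<iota>_def using eq L L' M E by simp
    then have "L' \<cdot> coker \<A> \<rho> = L \<cdot> coker \<A> \<rho>"
      using monic_cancel[OF \<iota>_embedding(1), of "L' \<cdot> coker \<A> \<rho>" "L \<cdot> coker \<A> \<rho>"] L L' by simp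
    then show "L' = L"
      using epic_cancel[OF coker_epic, of \<rho> L' L] L L' by simp
  qed (use L eq in simp)
  then show "Lambda \<A> S T \<in> Mor \<A>" "src \<A> (Lambda \<A> S T) = Im_sq \<A> S" "tgt \<A> (Lambda \<A> S T) = Ker_sq \<A> T"
    "\<iota> \<cdot> Lambda \<A> S T \<cdot> coker \<A> \<rho> = i \<cdot> inv_mor \<A> (bar \<A> b) \<cdot> k"
    unfolding \<iota>_def using L eq M E by (simp_all add: y_def)
qed

text \<open>If the bottom row is exact, \<open>sq_I S\<close> consists of everything in the image of \<open>b\<close> that \<open>g'\<close>
  kills, so \<open>b\<close> maps any subobject of \<open>Ker (g' \<cdot> b)\<close> into it.\<close>

lemma factor_through_intersection:
  assumes ex: "exact \<A> f' g'" and x: "x \<in> Mor \<A>" "tgt \<A> x = src \<A> b"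
    "g' \<cdot> b \<cdot> x = zmor \<A> (src \<A> x) (tgt \<A> g')"
  obtains z where "z \<in> Mor \<A>" "src \<A> z = src \<A> x" "tgt \<A> z = sq_I \<A> S"
    "im \<A> b \<cdot> k \<cdot> z = b \<cdot> x" "k \<cdot> z = bar \<A> b \<cdot> coim \<A> b \<cdot> x"
proof -
  obtain u where u: "u \<in> Hom \<A> (imO \<A> f') (kerO \<A> g')" "is_iso \<A> u" "ker \<A> g' \<cdot> u = im \<A> f'"
    using ex unfolding exact_def by blast
  note U = inv_mor_inverse[OF u(2)]
  obtain y where y: "y \<in> Mor \<A>" "src \<A> y = src \<A> x" "tgt \<A> y = src \<A> (ker \<A> g')" "ker \<A> g' \<cdot> y = b \<cdot> x"
    using is_kernel_factor[OF ker_is_kernel, of g' "b \<cdot> x"] x by auto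
  have "im \<A> f' \<cdot> inv_mor \<A> u \<cdot> y = ker \<A> g' \<cdot> u \<cdot> inv_mor \<A> u \<cdot> y"
    using cmp_extend[OF u(3), of "inv_mor \<A> u \<cdot> y"] u(1) U y by simp
  also have "\<dots> = b \<cdot> x"
    using cmp_extend[OF U(5), of y] u(1) U y by simp
  also have bx: "b \<cdot> x = im \<A> b \<cdot> bar \<A> b \<cdot> coim \<A> b \<cdot> x"
    using assoc[of "im \<A> b" "bar \<A> b \<cdot> coim \<A> b" x] b_decomposition x by simp
  finally have eq: "im \<A> b \<cdot> bar \<A> b \<cdot> coim \<A> b \<cdot> x = im \<A> f' \<cdot> inv_mor \<A> u \<cdot> y" ..
  obtain z where "z \<in> Mor \<A>" "src \<A> z = src \<A> x" "tgt \<A> z = sq_I \<A> S" "k \<cdot> z = bar \<A> b \<cdot> coim \<A> b \<cdot> x"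
  proof (rule sq_intersection_factor[OF commutes_S, unfolded sides])
    show "im \<A> b \<cdot> bar \<A> b \<cdot> coim \<A> b \<cdot> x = im \<A> f' \<cdot> inv_mor \<A> u \<cdot> y" by (fact eq)
  qed (use u(1) U x y in auto)
  then show ?thesis using that bx by simp
qed

text \<open>With \<open>b\<close> a strict monomorphism and the bottom row exact, \<open>sq_I S\<close> is \<open>Ker (g' \<cdot> b)\<close>, and
  \<open>Im_sq S\<close>, \<open>Ker_sq T\<close> and the homology of the top row are the quotients of the chain
  \<open>Im f \<rightarrow> Ker g \<rightarrow> Ker (g' \<cdot> b)\<close>.\<close>

lemma theta_sequence:
  assumes ex: "exact \<A> f' g'" and b: "strict_monic \<A> b"
  shows "\<exists>\<theta>. is_canonical_theta \<A> S T \<theta> \<and> (\<forall>\<theta>'. is_canonical_theta \<A> S T \<theta>' \<longrightarrow> \<theta>' = \<theta>) \<and>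
    exact_seq \<A> [zmor \<A> (zero_object \<A>) (homology \<A> f g), \<theta>, Lambda \<A> S T,
      zmor \<A> (Ker_sq \<A> T) (zero_object \<A>)]"
proof -
  note coim_iso = strict_monic_bar_iso(1)[OF b] and bar_iso = strict_monic_bar_iso(2)[OF b]
  note C = inv_mor_inverse[OF coim_iso] and B = inv_mor_inverse[OF bar_iso]
    and L = Lambda_characterization[OF bar_iso]
  \<comment> \<open>\<open>r\<close> inverts the corestriction of \<open>b\<close> to its image.\<close>
  define r where "r = inv_mor \<A> (coim \<A> b) \<cdot> inv_mor \<A> (bar \<A> b)"
  have r: "r \<in> Mor \<A>" "src \<A> r = src \<A> (im \<A> b)" "tgt \<A> r = src \<A> b"
    unfolding r_def using B C by simp_all
  have r_bar: "r \<cdot> bar \<A> b \<cdot> coim \<A> b = ident \<A> (src \<A> b)"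
    unfolding r_def using cmp_extend[OF B(4), of "coim \<A> b"] B C by simp
  have "b \<cdot> r = (im \<A> b \<cdot> bar \<A> b \<cdot> coim \<A> b) \<cdot> r"
    unfolding b_decomposition ..
  also have "\<dots> = im \<A> b"
    unfolding r_def using cmp_extend[OF C(5), of "inv_mor \<A> (bar \<A> b)"] B C by simp
  finally have b_r: "b \<cdot> r = im \<A> b" .
  have kd_monic: "monic kd" by (simp add: ker_monic)
  obtain v where v: "v \<in> Mor \<A>" "src \<A> v = src \<A> kd" "tgt \<A> v = sq_I \<A> S"
    "im \<A> b \<cdot> k \<cdot> v = b \<cdot> kd" "k \<cdot> v = bar \<A> b \<cdot> coim \<A> b \<cdot> kd"
    using factor_through_intersection[OF ex kd_typing] .
  have "g' \<cdot> b \<cdot> r \<cdot> k = g' \<cdot> im \<A> f' \<cdot> l"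
    using cmp_extend[OF b_r, of k] r f'_l by simp
  also have "\<dots> = zmor \<A> (sq_I \<A> S) (tgt \<A> g')"
    using cmp_extend[OF homology_eps_typing(5)[OF semiexact_bottom], of l] by simp
  finally obtain v' where v': "v' \<in> Mor \<A>" "src \<A> v' = sq_I \<A> S" "tgt \<A> v' = src \<A> kd" "kd \<cdot> v' = r \<cdot> k"
    using is_kernel_factor[OF ker_is_kernel, of "g' \<cdot> b" "r \<cdot> k"] r by auto
  \<comment> \<open>\<open>Ker (g' \<cdot> b)\<close> and \<open>sq_I S\<close> are the same subobject of the target of \<open>b\<close>.\<close>
  have "is_iso \<A> v"
  proof (rule mutual_factor_iso[OF b_k_monic _ v(1) v'(1)])
    have "monic b" using b is_kernel_monic unfolding strict_monic_def by blast
    then show "monic (b \<cdot> kd)" using monic_cmp[OF _ kd_monic] by simp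
    show "(im \<A> b \<cdot> k) \<cdot> v = b \<cdot> kd" using v by simp
    show "(b \<cdot> kd) \<cdot> v' = im \<A> b \<cdot> k" using v' cmp_extend[OF b_r, of k] r by simp
  qed (use v v' in simp_all)
  define w where "w = v \<cdot> \<nu>"
  have w: "w \<in> Mor \<A>" "src \<A> w = src \<A> (ker \<A> g)" "tgt \<A> w = sq_I \<A> S"
    unfolding w_def using v by simp_all
  have w_eq: "im \<A> b \<cdot> k \<cdot> w = b \<cdot> ker \<A> g"
  proof -
    have "(im \<A> b \<cdot> k \<cdot> v) \<cdot> \<nu> = (b \<cdot> kd) \<cdot> \<nu>" unfolding v(4) ..
    then show ?thesis unfolding w_def using v(1-3) kd_\<nu> by simp
  qed
  obtain qf where qf: "qf \<in> Mor \<A>" "src \<A> qf = src \<A> f" "tgt \<A> qf = src \<A> (im \<A> f)" "im \<A> f \<cdot> qf = f" "epic qf"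
    using im_factor[of f] by auto
  obtain q where q: "q \<in> Mor \<A>" "src \<A> q = src \<A> (b \<cdot> f)" "tgt \<A> q = src \<A> (im \<A> (b \<cdot> f))"
    "im \<A> (b \<cdot> f) \<cdot> q = b \<cdot> f" "epic q"
    using im_factor[of "b \<cdot> f"] by auto
  \<comment> \<open>Up to epimorphisms and \<open>v\<close>, \<open>\<rho>\<close> is the inclusion \<open>\<nu> \<cdot> \<epsilon>\<close> of \<open>Im f\<close> into \<open>Ker (g' \<cdot> b)\<close>: both become
    \<open>b \<cdot> f\<close> in the target of \<open>b\<close>.\<close>
  have \<rho>_q: "\<rho> \<cdot> q = (v \<cdot> \<nu> \<cdot> \<epsilon>) \<cdot> qf"
  proof (rule monic_cancel[OF b_k_monic])
    have "(im \<A> b \<cdot> k \<cdot> \<rho>) \<cdot> q = b \<cdot> f" unfolding b_k_\<rho> by (fact q(4))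
    moreover have "(im \<A> b \<cdot> k \<cdot> w) \<cdot> \<epsilon> \<cdot> qf = b \<cdot> f"
      unfolding w_eq using cmp_extend[OF g_\<epsilon>, of qf] qf by simp
    ultimately show "(im \<A> b \<cdot> k) \<cdot> \<rho> \<cdot> q = (im \<A> b \<cdot> k) \<cdot> (v \<cdot> \<nu> \<cdot> \<epsilon>) \<cdot> qf"
      unfolding w_def using q(1-3) qf(1-3) v(1-3) by simp
  qed (use q qf v in simp_all)
  have "is_cokernel \<A> (coker \<A> \<rho>) (\<rho> \<cdot> q)"
    using is_cokernel_cmp_epic_iff[OF q(5), of \<rho>] q by (simp add: coker_is_cokernel)
  then have "is_cokernel \<A> (coker \<A> \<rho>) (v \<cdot> \<nu> \<cdot> \<epsilon>)"
    unfolding \<rho>_q using is_cokernel_cmp_epic_iff[OF qf(5), of "v \<cdot> \<nu> \<cdot> \<epsilon>"] qf v by simp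
  then have e': "is_cokernel \<A> (coker \<A> \<rho> \<cdot> v) (\<nu> \<cdot> \<epsilon>)"
    using is_cokernel_precompose_iso[OF _ \<open>is_iso \<A> v\<close>, of "coker \<A> \<rho>" "\<nu> \<cdot> \<epsilon>"] v by simp
  have e: "is_cokernel \<A> (coker \<A> \<epsilon>) \<epsilon>" by (simp add: coker_is_cokernel)
  have "strict_monic \<A> \<nu>"
    unfolding strict_monic_def
    using is_kernel_right_factor[OF _ kd_monic, of \<nu> g] kd_\<nu> by (auto simp: ker_is_kernel)
  \<comment> \<open>As \<open>Ker b = 0\<close>, the quotient \<open>d\<close> is taken by \<open>Ker g\<close> alone.\<close>
  have "\<mu> = zmor \<A> (src \<A> (ker \<A> b)) (src \<A> kd)"
  proof -
    have "monic b" using b is_kernel_monic unfolding strict_monic_def by blast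
    then have "ker \<A> b = zmor \<A> (src \<A> (ker \<A> b)) (src \<A> b)"
      using monic_zero[of b "ker \<A> b"] by simp
    then have "kd \<cdot> \<mu> = zmor \<A> (src \<A> \<mu>) (tgt \<A> kd)" using kd_\<mu> by simp
    then show ?thesis using monic_zero[OF kd_monic, of \<mu>] by simp
  qed
  then have \<mu>_ann: "x \<cdot> \<mu> = zmor \<A> (src \<A> (ker \<A> b)) (tgt \<A> x)"
    if "x \<in> Mor \<A>" "src \<A> x = src \<A> kd" for x
    using that by simp
  have s: "is_cokernel \<A> d \<nu>"
  proof (rule is_cokernel_cong)
    show "is_cokernel \<A> d (copair \<A> \<mu> \<nu>)" by (simp add: coker_is_cokernel)
    fix x assume "x \<in> Mor \<A>" "src \<A> x = tgt \<A> (copair \<A> \<mu> \<nu>)"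
    then show "x \<cdot> copair \<A> \<mu> \<nu> = zmor \<A> (src \<A> (copair \<A> \<mu> \<nu>)) (tgt \<A> x) \<longleftrightarrow>
        x \<cdot> \<nu> = zmor \<A> (src \<A> \<nu>) (tgt \<A> x)"
      using sq_copair_annihilator[OF commutes_T, of x] \<mu>_ann[of x] by (simp add: diag_T)
  qed simp_all
  obtain \<theta> where \<theta>: "\<theta> \<in> Mor \<A>" "src \<A> \<theta> = tgt \<A> (coker \<A> \<epsilon>)" "tgt \<A> \<theta> = Im_sq \<A> S"
    "\<theta> \<cdot> coker \<A> \<epsilon> = coker \<A> \<rho> \<cdot> w"
  proof (rule is_cokernel_factor[OF e])
    show "(coker \<A> \<rho> \<cdot> w) \<cdot> \<epsilon> = zmor \<A> (src \<A> \<epsilon>) (tgt \<A> (coker \<A> \<rho> \<cdot> w))"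
      unfolding w_def using is_cokernel_typing(4)[OF e'] v by simp
  qed (use w in auto)
  have "\<iota> \<cdot> Lambda \<A> S T \<cdot> coker \<A> \<rho> \<cdot> v = (\<iota> \<cdot> Lambda \<A> S T \<cdot> coker \<A> \<rho>) \<cdot> v"
    using L(1-3) v by simp
  also have "\<dots> = i \<cdot> inv_mor \<A> (bar \<A> b) \<cdot> k \<cdot> v"
    unfolding L(4) using B v(1-3) by simp
  also have "\<dots> = \<iota> \<cdot> d"
    unfolding v(5) \<iota>_embedding(5) using cmp_extend[OF B(4), of "coim \<A> b \<cdot> kd"] B by simp
  finally have "Lambda \<A> S T \<cdot> coker \<A> \<rho> \<cdot> v = d"
    using monic_cancel[OF \<iota>_embedding(1), of "Lambda \<A> S T \<cdot> coker \<A> \<rho> \<cdot> v" d] L v by simp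
  then have "monic \<theta>" "is_cokernel \<A> (Lambda \<A> S T) \<theta>"
    using third_isomorphism[OF e e' s \<open>strict_monic \<A> \<nu>\<close> _ \<theta>(1,2) _ _ L(1)] L \<theta> v unfolding w_def by simp_all
  then have "exact_seq \<A> [zmor \<A> (zero_object \<A>) (src \<A> \<theta>), \<theta>, Lambda \<A> S T,
      zmor \<A> (tgt \<A> (Lambda \<A> S T)) (zero_object \<A>)]"
    by (rule short_exact_seq)
  then have "exact_seq \<A> [zmor \<A> (zero_object \<A>) (homology \<A> f g), \<theta>, Lambda \<A> S T,
      zmor \<A> (Ker_sq \<A> T) (zero_object \<A>)]"
    using \<theta> L by (simp add: homology_def)
  moreover have "is_canonical_theta \<A> S T \<theta>"
    unfolding is_canonical_theta_def homology_def using \<theta> w w_eq by auto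
  moreover have "\<theta>' = \<theta>" if canonical: "is_canonical_theta \<A> S T \<theta>'" for \<theta>'
  proof -
    obtain w' where w': "w' \<in> Hom \<A> (src \<A> (ker \<A> g)) (sq_I \<A> S)" "im \<A> b \<cdot> k \<cdot> w' = b \<cdot> ker \<A> g"
      "\<theta>' \<cdot> coker \<A> \<epsilon> = coker \<A> \<rho> \<cdot> w'" and \<theta>': "\<theta>' \<in> Hom \<A> (tgt \<A> (coker \<A> \<epsilon>)) (Im_sq \<A> S)"
      using canonical unfolding is_canonical_theta_def homology_def sides kerO_def cokerO_def by blast
    have "w' = w"
      using monic_cancel[OF b_k_monic, of w' w] w w_eq w'(1,2) by simp
    then show ?thesis
      using epic_cancel[OF coker_epic, of \<epsilon> \<theta>' \<theta>] w' \<theta> \<theta>' by simp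
  qed
  ultimately show ?thesis by blast
qed

text \<open>With \<open>b\<close> a strict epimorphism and the top row exact, \<open>Ker_sq T\<close> is the quotient of \<open>Ker g'\<close> by
  \<open>b (Ker g) = b (Im f)\<close>, and \<open>Im_sq S\<close>, \<open>Ker_sq T\<close> and the homology of the bottom row are the
  quotients of the chain \<open>Im (b \<cdot> f) \<rightarrow> Im f' \<rightarrow> Ker g'\<close>.\<close>

lemma kappa_sequence:
  assumes ex: "exact \<A> f g" and b: "strict_epic \<A> b"
  shows "\<exists>\<kappa>. is_canonical_kappa \<A> S T \<kappa> \<and> (\<forall>\<kappa>'. is_canonical_kappa \<A> S T \<kappa>' \<longrightarrow> \<kappa>' = \<kappa>) \<and>
    exact_seq \<A> [zmor \<A> (zero_object \<A>) (Im_sq \<A> S), Lambda \<A> S T, \<kappa>,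
      zmor \<A> (homology \<A> f' g') (zero_object \<A>)]"
proof -
  note im_iso = strict_epic_bar_iso(1)[OF b] and bar_iso = strict_epic_bar_iso(2)[OF b]
  note I = inv_mor_inverse[OF im_iso] and B = inv_mor_inverse[OF bar_iso]
    and L = Lambda_characterization[OF bar_iso]
  have kg'_monic: "monic (ker \<A> g')" by (simp add: ker_monic)
  obtain w where w: "w \<in> Mor \<A>" "src \<A> w = src \<A> kd" "tgt \<A> w = src \<A> (ker \<A> g')" "ker \<A> g' \<cdot> w = b \<cdot> kd"
    using is_kernel_factor[OF ker_is_kernel, of g' "b \<cdot> kd"] kd_typing by auto
  have w_\<mu>: "is_cokernel \<A> w \<mu>"
    by (rule kernel_restriction_cokernel[OF ker_is_kernel ker_is_kernel ker_is_kernel b])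
      (use w kd_\<mu> in simp_all)
  have d_coker: "is_cokernel \<A> d (copair \<A> \<mu> \<nu>)" by (simp add: coker_is_cokernel)
  have ann: "x \<cdot> copair \<A> \<mu> \<nu> = zmor \<A> (src \<A> (copair \<A> \<mu> \<nu>)) (tgt \<A> x) \<longleftrightarrow>
      x \<cdot> \<mu> = zmor \<A> (src \<A> (ker \<A> b)) (tgt \<A> x) \<and> x \<cdot> \<nu> = zmor \<A> (src \<A> (ker \<A> g)) (tgt \<A> x)"
    if "x \<in> Mor \<A>" "src \<A> x = src \<A> kd" for x
    using sq_copair_annihilator[OF commutes_T, of x] that by (simp add: diag_T)
  have d_\<mu>: "d \<cdot> \<mu> = zmor \<A> (src \<A> \<mu>) (tgt \<A> d)" and d_\<nu>: "d \<cdot> \<nu> = zmor \<A> (src \<A> \<nu>) (tgt \<A> d)"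
    using ann[of d] is_cokernel_typing(4)[OF d_coker] by simp_all
  \<comment> \<open>The quotient \<open>d\<close> kills \<open>Ker b\<close>, so it descends along \<open>w\<close> to a quotient \<open>e'\<close> of \<open>Ker g'\<close>.\<close>
  obtain e' where e': "e' \<in> Mor \<A>" "src \<A> e' = src \<A> (ker \<A> g')" "tgt \<A> e' = Ker_sq \<A> T" "e' \<cdot> w = d"
    using is_cokernel_factor[OF w_\<mu>, of d] d_\<mu> w by auto
  have "is_cokernel \<A> e' (w \<cdot> \<nu>)"
  proof (rule is_cokernelI)
    show "epic e'"
    proof (rule epicI_zero)
      fix x assume x: "x \<in> Mor \<A>" "src \<A> x = tgt \<A> e'" "x \<cdot> e' = zmor \<A> (src \<A> e') (tgt \<A> x)"
      then have "x \<cdot> d = zmor \<A> (src \<A> d) (tgt \<A> x)"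
        using cmp_extend[OF x(3), of w] e' w by simp
      then show "x = zmor \<A> (tgt \<A> e') (tgt \<A> x)"
        using epic_zero_iff[OF is_cokernel_epic[OF d_coker], of x] x e' by simp
    qed fact
    show "e' \<cdot> w \<cdot> \<nu> = zmor \<A> (src \<A> (w \<cdot> \<nu>)) (tgt \<A> e')"
      using cmp_extend[OF e'(4), of \<nu>] d_\<nu> e' w by simp
    fix x assume x: "x \<in> Mor \<A>" "src \<A> x = tgt \<A> (w \<cdot> \<nu>)" "x \<cdot> w \<cdot> \<nu> = zmor \<A> (src \<A> (w \<cdot> \<nu>)) (tgt \<A> x)"
    have "(x \<cdot> w) \<cdot> copair \<A> \<mu> \<nu> = zmor \<A> (src \<A> (copair \<A> \<mu> \<nu>)) (tgt \<A> (x \<cdot> w))"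
      using ann[of "x \<cdot> w"] is_cokernel_typing(4)[OF w_\<mu>] x w by simp
    then obtain y where y: "y \<in> Mor \<A>" "src \<A> y = tgt \<A> d" "tgt \<A> y = tgt \<A> x" "y \<cdot> d = x \<cdot> w"
      using is_cokernel_factor[OF d_coker, of "x \<cdot> w"] x w by auto
    have "(y \<cdot> e') \<cdot> w = x \<cdot> w" using y e' w by simp
    then have "y \<cdot> e' = x"
      using epic_cancel[OF is_cokernel_epic[OF w_\<mu>], of "y \<cdot> e'" x] x y e' w by simp
    then show "\<exists>u \<in> Hom \<A> (tgt \<A> e') (tgt \<A> x). u \<cdot> e' = x" using y e' by auto
  qed (use e' w in simp_all)
  obtain u where u: "u \<in> Hom \<A> (imO \<A> f) (kerO \<A> g)" "is_iso \<A> u" "ker \<A> g \<cdot> u = im \<A> f"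
    using ex unfolding exact_def by blast
  obtain qf where qf: "qf \<in> Mor \<A>" "src \<A> qf = src \<A> f" "tgt \<A> qf = src \<A> (im \<A> f)" "im \<A> f \<cdot> qf = f" "epic qf"
    using im_factor[of f] by auto
  obtain q where q: "q \<in> Mor \<A>" "src \<A> q = src \<A> (b \<cdot> f)" "tgt \<A> q = src \<A> (im \<A> (b \<cdot> f))"
    "im \<A> (b \<cdot> f) \<cdot> q = b \<cdot> f" "epic q"
    using im_factor[of "b \<cdot> f"] by auto
  have uqf: "epic (u \<cdot> qf)" using epic_cmp[OF iso_epic[OF u(2)] qf(5)] u(1) qf by simp
  \<comment> \<open>The images of \<open>Ker g\<close> and of \<open>Im (b \<cdot> f)\<close> in \<open>Ker g'\<close> agree: both composites become \<open>b \<cdot> f\<close>.\<close>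
  have same: "(w \<cdot> \<nu>) \<cdot> u \<cdot> qf = (\<epsilon>' \<cdot> l \<cdot> \<rho>) \<cdot> q"
  proof (rule monic_cancel[OF kg'_monic])
    have "ker \<A> g' \<cdot> (w \<cdot> \<nu>) \<cdot> u \<cdot> qf = b \<cdot> f"
      using cmp_extend[OF w(4), of "\<nu> \<cdot> u \<cdot> qf"] cmp_extend[OF kd_\<nu>, of "u \<cdot> qf"]
        cmp_extend[OF u(3), of qf] w(1-3) u(1) qf by simp
    moreover have "(im \<A> b \<cdot> k \<cdot> \<rho>) \<cdot> q = b \<cdot> f" unfolding b_k_\<rho> by (fact q(4))
    then have "ker \<A> g' \<cdot> (\<epsilon>' \<cdot> l \<cdot> \<rho>) \<cdot> q = b \<cdot> f"
      using cmp_extend[OF g'_\<epsilon>', of "l \<cdot> \<rho> \<cdot> q"] cmp_extend[OF f'_l, of "\<rho> \<cdot> q"] q(1-3) by simp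
    ultimately show "ker \<A> g' \<cdot> (w \<cdot> \<nu>) \<cdot> u \<cdot> qf = ker \<A> g' \<cdot> (\<epsilon>' \<cdot> l \<cdot> \<rho>) \<cdot> q" by simp
  qed (use w u(1) q qf in simp_all)
  have "is_cokernel \<A> e' ((w \<cdot> \<nu>) \<cdot> u \<cdot> qf)"
    using is_cokernel_cmp_epic_iff[OF uqf, of "w \<cdot> \<nu>"] \<open>is_cokernel \<A> e' (w \<cdot> \<nu>)\<close> w u(1) qf by simp
  then have e'_coker: "is_cokernel \<A> e' (\<epsilon>' \<cdot> l \<cdot> \<rho>)"
    unfolding same using is_cokernel_cmp_epic_iff[OF q(5), of "\<epsilon>' \<cdot> l \<cdot> \<rho>"] q by simp
  \<comment> \<open>\<open>im b\<close> is an isomorphism, hence so is its pullback \<open>l\<close>.\<close>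
  have "is_iso \<A> l"
  proof -
    define x where "x = inv_mor \<A> (im \<A> b) \<cdot> im \<A> f'"
    have x: "x \<in> Mor \<A>" "src \<A> x = src \<A> (im \<A> f')" "tgt \<A> x = src \<A> (im \<A> b)"
      unfolding x_def using I by simp_all
    define y where "y = ident \<A> (src \<A> (im \<A> f'))"
    have y: "y \<in> Mor \<A>" "src \<A> y = src \<A> (im \<A> f')" "tgt \<A> y = src \<A> (im \<A> f')"
      unfolding y_def by simp_all
    have "src \<A> x = src \<A> y" using x y by simp
    moreover have "im \<A> b \<cdot> x = im \<A> f' \<cdot> y"
      unfolding x_def y_def using cmp_extend[OF I(5), of "im \<A> f'"] I by simp
    ultimately obtain t where "t \<in> Mor \<A>" "src \<A> t = src \<A> x" "tgt \<A> t = sq_I \<A> S" "k \<cdot> t = x" "l \<cdot> t = y"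
      using sq_intersection_factor[OF commutes_S x(1) y(1), unfolded sides] x(3) y(3) by blast
    then have t: "t \<in> Mor \<A>" "src \<A> t = src \<A> (im \<A> f')" "tgt \<A> t = sq_I \<A> S"
      "l \<cdot> t = ident \<A> (src \<A> (im \<A> f'))"
      using x(2) y_def by simp_all
    have "(im \<A> b \<cdot> k) \<cdot> t \<cdot> l = im \<A> f' \<cdot> l \<cdot> t \<cdot> l"
      by (rule cmp_extend[OF f'_l, symmetric]) (use t(1-3) in simp_all)
    also have "\<dots> = im \<A> b \<cdot> k"
      using cmp_extend[OF t(4), of l] f'_l t(1-3) by simp
    finally have "t \<cdot> l = ident \<A> (sq_I \<A> S)"
      using monic_cancel[OF b_k_monic, of "t \<cdot> l" "ident \<A> (sq_I \<A> S)"] t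
        src_in_Obj[of k] by simp
    then show ?thesis using is_isoI[of l t] t by simp
  qed
  note Li = inv_mor_inverse[OF \<open>is_iso \<A> l\<close>]
  have "inv_mor \<A> l \<cdot> l \<cdot> \<rho> = \<rho>" using cmp_extend[OF Li(4), of \<rho>] Li by simp
  then have e: "is_cokernel \<A> (coker \<A> \<rho> \<cdot> inv_mor \<A> l) (l \<cdot> \<rho>)"
    using is_cokernel_precompose_iso[OF _ iso_inv_mor[OF \<open>is_iso \<A> l\<close>], of "coker \<A> \<rho>" "l \<cdot> \<rho>"] Li
    by (simp add: coker_is_cokernel)
  have s: "is_cokernel \<A> (coker \<A> \<epsilon>') \<epsilon>'" by (simp add: coker_is_cokernel)
  have "strict_monic \<A> \<epsilon>'"
    unfolding strict_monic_def
    using is_kernel_right_factor[OF _ kg'_monic, of \<epsilon>' "coker \<A> f'"] g'_\<epsilon>' by (auto simp: im_is_kernel)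
  have "(coker \<A> \<epsilon>') \<cdot> (\<epsilon>' \<cdot> l \<cdot> \<rho>) = zmor \<A> (src \<A> \<rho>) (tgt \<A> (coker \<A> \<epsilon>'))"
    using cmp_extend[OF is_cokernel_typing(4)[OF s], of "l \<cdot> \<rho>"] by simp
  then obtain \<kappa> where \<kappa>: "\<kappa> \<in> Mor \<A>" "src \<A> \<kappa> = Ker_sq \<A> T" "tgt \<A> \<kappa> = tgt \<A> (coker \<A> \<epsilon>')"
    "\<kappa> \<cdot> e' = coker \<A> \<epsilon>'"
    using is_cokernel_factor[OF e'_coker, of "coker \<A> \<epsilon>'"] e' by auto
  have "\<iota> \<cdot> e' = i \<cdot> inv_mor \<A> (bar \<A> b) \<cdot> inv_mor \<A> (im \<A> b) \<cdot> ker \<A> g'"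
  proof (rule epic_cancel[OF is_cokernel_epic[OF w_\<mu>]])
    have "b \<cdot> kd = im \<A> b \<cdot> bar \<A> b \<cdot> coim \<A> b \<cdot> kd"
      using assoc[of "im \<A> b" "bar \<A> b \<cdot> coim \<A> b" kd] b_decomposition by simp
    then have "inv_mor \<A> (bar \<A> b) \<cdot> inv_mor \<A> (im \<A> b) \<cdot> b \<cdot> kd = coim \<A> b \<cdot> kd"
      using cmp_extend[OF I(4), of "bar \<A> b \<cdot> coim \<A> b \<cdot> kd"] cmp_extend[OF B(4), of "coim \<A> b \<cdot> kd"] I B
      by simp
    then show "(\<iota> \<cdot> e') \<cdot> w = (i \<cdot> inv_mor \<A> (bar \<A> b) \<cdot> inv_mor \<A> (im \<A> b) \<cdot> ker \<A> g') \<cdot> w"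
      using e' w I B \<iota>_embedding(5) by simp
  qed (use e' w I B in simp_all)
  then have "\<iota> \<cdot> e' \<cdot> \<epsilon>' = i \<cdot> inv_mor \<A> (bar \<A> b) \<cdot> inv_mor \<A> (im \<A> b) \<cdot> im \<A> f'"
    using cmp_extend[of \<iota> e' "i \<cdot> inv_mor \<A> (bar \<A> b) \<cdot> inv_mor \<A> (im \<A> b) \<cdot> ker \<A> g'" \<epsilon>'] e' I B g'_\<epsilon>'
    by simp
  also have "inv_mor \<A> (im \<A> b) \<cdot> im \<A> f' = k \<cdot> inv_mor \<A> l"
  proof (rule monic_cancel[OF im_monic])
    show "im \<A> b \<cdot> inv_mor \<A> (im \<A> b) \<cdot> im \<A> f' = im \<A> b \<cdot> k \<cdot> inv_mor \<A> l"
      using cmp_extend[OF I(5), of "im \<A> f'"] cmp_extend[OF f'_l, of "inv_mor \<A> l"] I Li by simp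
  qed (use I Li in simp_all)
  also have "i \<cdot> inv_mor \<A> (bar \<A> b) \<cdot> k \<cdot> inv_mor \<A> l = \<iota> \<cdot> Lambda \<A> S T \<cdot> coker \<A> \<rho> \<cdot> inv_mor \<A> l"
  proof -
    have "(\<iota> \<cdot> Lambda \<A> S T \<cdot> coker \<A> \<rho>) \<cdot> inv_mor \<A> l = (i \<cdot> inv_mor \<A> (bar \<A> b) \<cdot> k) \<cdot> inv_mor \<A> l"
      unfolding L(4) ..
    then show ?thesis using L(1-3) B Li by simp
  qed
  finally have t: "Lambda \<A> S T \<cdot> coker \<A> \<rho> \<cdot> inv_mor \<A> l = e' \<cdot> \<epsilon>'"
    using monic_cancel[OF \<iota>_embedding(1), of "Lambda \<A> S T \<cdot> coker \<A> \<rho> \<cdot> inv_mor \<A> l" "e' \<cdot> \<epsilon>'"] L(1-3) Li e' by simp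
  have "monic (Lambda \<A> S T)" "is_cokernel \<A> \<kappa> (Lambda \<A> S T)"
    using third_isomorphism[OF e e'_coker s \<open>strict_monic \<A> \<epsilon>'\<close> _ L(1) _ _ _ \<kappa>(1)] t L(1-3) \<kappa> e' Li by simp_all
  then have "exact_seq \<A> [zmor \<A> (zero_object \<A>) (src \<A> (Lambda \<A> S T)), Lambda \<A> S T, \<kappa>,
      zmor \<A> (tgt \<A> \<kappa>) (zero_object \<A>)]"
    by (rule short_exact_seq)
  then have "exact_seq \<A> [zmor \<A> (zero_object \<A>) (Im_sq \<A> S), Lambda \<A> S T, \<kappa>,
      zmor \<A> (homology \<A> f' g') (zero_object \<A>)]"
    using \<kappa> L by (simp add: homology_def)
  moreover have \<kappa>_d: "\<kappa> \<cdot> d = coker \<A> \<epsilon>' \<cdot> w"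
    using cmp_extend[OF \<kappa>(4), of w] \<kappa>(1-3) e' w by simp
  then have "is_canonical_kappa \<A> S T \<kappa>"
    unfolding is_canonical_kappa_def homology_def using \<kappa> w by (auto simp: diag_T)
  moreover have "\<kappa>' = \<kappa>" if canonical: "is_canonical_kappa \<A> S T \<kappa>'" for \<kappa>'
  proof -
    obtain w' where w': "w' \<in> Hom \<A> (src \<A> kd) (src \<A> (ker \<A> g'))" "ker \<A> g' \<cdot> w' = b \<cdot> kd"
      "\<kappa>' \<cdot> d = coker \<A> \<epsilon>' \<cdot> w'" and \<kappa>': "\<kappa>' \<in> Hom \<A> (Ker_sq \<A> T) (tgt \<A> (coker \<A> \<epsilon>'))"
      using canonical unfolding is_canonical_kappa_def homology_def sides diag_T kerO_def cokerO_def by blast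
    have "w' = w"
      using monic_cancel[OF kg'_monic, of w' w] w w' by simp
    then show ?thesis
      using epic_cancel[OF is_cokernel_epic[OF d_coker], of \<kappa>' \<kappa>] w' \<kappa>_d \<kappa> \<kappa>' by simp
  qed
  ultimately show ?thesis by blast
qed

end

theorem theorem3:
  fixes \<A> :: "('o, 'm) precategory" (structure)
    and A B C A' B' C' :: 'o
    and f g f' g' a b c :: 'm
    and S T :: "'m square"
  assumes "quasi_abelian_category \<A>"
    and "f \<in> Hom \<A> A B" and "g \<in> Hom \<A> B C"
    and "f' \<in> Hom \<A> A' B'" and "g' \<in> Hom \<A> B' C'"
    and "a \<in> Hom \<A> A A'" and "b \<in> Hom \<A> B B'" and "c \<in> Hom \<A> C C'"
    and "b \<cdot> f = f' \<cdot> a" and "c \<cdot> g = g' \<cdot> b"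
    and "semiexact \<A> f g" and "semiexact \<A> f' g'"
    and "S = \<lparr>sq_top = f, sq_left = a, sq_bottom = f', sq_right = b\<rparr>"
    and "T = \<lparr>sq_top = g, sq_left = b, sq_bottom = g', sq_right = c\<rparr>"
  shows
    "(exact \<A> f' g' \<and> strict_monic \<A> b \<longrightarrow>
        (\<exists>\<theta>. is_canonical_theta \<A> S T \<theta> \<and>
           (\<forall>\<theta>'. is_canonical_theta \<A> S T \<theta>' \<longrightarrow> \<theta>' = \<theta>) \<and>
           exact_seq \<A> [zmor \<A> (zero_object \<A>) (homology \<A> f g), \<theta>, Lambda \<A> S T,
                        zmor \<A> (Ker_sq \<A> T) (zero_object \<A>)])) \<and>
     (exact \<A> f g \<and> strict_epic \<A> b \<longrightarrow>
        (\<exists>\<kappa>. is_canonical_kappa \<A> S T \<kappa> \<and>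
           (\<forall>\<kappa>'. is_canonical_kappa \<A> S T \<kappa>' \<longrightarrow> \<kappa>' = \<kappa>) \<and>
           exact_seq \<A> [zmor \<A> (zero_object \<A>) (Im_sq \<A> S), Lambda \<A> S T, \<kappa>,
                        zmor \<A> (homology \<A> f' g') (zero_object \<A>)]))"
proof -
  interpret quasi_abelian_category \<A> by fact
  interpret adjacent_squares \<A> f g f' g' a b c S T
    by unfold_locales (use assms in simp_all)
  show ?thesis using theta_sequence kappa_sequence by blast
qed

end
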